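(* Let $X^1,X^2,X^3$ be smooth functions in a neighbourhood of a point $(z_0,y_0)\in\mathbf R^2\times\mathbf R$, and consider the equation $$X^{1}(z,v(z))\frac{\partial v}{\partial z_{1}}(z)+X^{2}(z,v(z))\frac{\partial v}{\partial z_{2}}(z)=X^{3}(z,v(z)),\quad z=(z_1,z_2). \qquad (A)$$ (1) In order that $(A)$ can be transformed through a local bundle map, in the neighbourhood of $(z_0,y_0)$, into an equation of the form $$\frac{\partial u}{\partial t}(t,x)+u(t,x)\frac{\partial u}{\partial x}(t,x)=a(t,x)u(t,x)^{3}+b(t,x)u(t,x)^{2}+c(t,x)u(t,x)+d(t,x) \qquad (B)$$ with smooth $a,b,c,d$, it is necessary and sufficient that the following conditions be fulfilled: (i) $(X^1(z,y),X^2(z,y))\neq(0,0)$ around $(z_0,y_0)$; then, after renaming the indices $1,2$ of the base coordinates if necessary, $X^1(z,y)\ne0$ around $(z_0,y_0)$; (ii) with this choice of indices, $\dfrac{\partial}{\partial y}\bigl(X^{2}(z,y)/X^{1}(z,y)\bigr)\neq 0$ around $(z_0,y_0)$; (iii) there exist smooth functions $a(z),b(z),c(z),d(z)$ around $z_0$ such that, for all $(z,y)$ around $(z_0,y_0)$, putting $w=X^2/X^1$, $$\frac{\partial w}{\partial z_{1}}(z,y)+w(z,y)\frac{\partial w}{\partial z_{2}}(z,y)+\frac{X^{3}(z,y)}{X^{1}(z,y)}\frac{\partial w}{\partial y}(z,y)=a(z)w(z,y)^{3}+b(z)w(z,y)^{2}+c(z)w(z,y)+d(z).$$ In this case the function $u(z)=X^{2}(z,v(z))/X^{1}(z,v(z))$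 satisfies $(B)$ (with $t=z_1$, $x=z_2$ and these $a,b,c,d$) as soon as $v$ satisfies $(A)$. (2) The equation $(B)$ can be transformed through a local bundle map, around the point considered, into the equation $$\frac{\partial u}{\partial z_{1}}(z)+u(z)\frac{\partial u}{\partial z_{2}}(z)=0 \qquad (C)$$ if and only if $a,b,c,d$ satisfy around $z_0$ (with $z_1=t$, $z_2=x$) the system $$\tfrac{1}{3}\tfrac{\partial^{2}c}{\partial z_{2}^{2}}-\tfrac{2}{3}\tfrac{\partial^{2}b}{\partial z_{2}\partial z_{1}}+\tfrac{\partial^{2}a}{\partial z_{1}^{2}}-\tfrac{2}{3}b\tfrac{\partial b}{\partial z_{1}}+a\tfrac{\partial c}{\partial z_{1}}+c\tfrac{\partial a}{\partial z_{1}}+\tfrac{1}{3}b\tfrac{\partial c}{\partial z_{2}}-2a\tfrac{\partial d}{\partial z_{2}}-d\tfrac{\partial a}{\partial z_{2}}=0,$$ $$\tfrac{1}{3}\tfrac{\partial^{2}b}{\partial z_{1}^{2}}-\tfrac{2}{3}\tfrac{\partial^{2}c}{\partial z_{1}\partial z_{2}}+\tfrac{\partial^{2}d}{\partial z_{2}^{2}}+\tfrac{2}{3}c\tfrac{\partial c}{\partial z_{2}}-d\tfrac{\partial b}{\partial z_{2}}-b\tfrac{\partial d}{\partial z_{2}}-\tfrac{1}{3}c\tfrac{\partial b}{\partial z_{1}}+2d\tfrac{\partial a}{\partial z_{1}}+a\tfrac{\partial d}{\partial z_{1}}=0.$$ In that case there exists a diffeomorphism $\phi(z)=(\tau(t,x),\xi(t,x))$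 around $z_0$ such that the function $\tilde u$ defined by $$\tilde{u}(\tau(t,x),\xi(t,x))=\frac{\frac{\partial\xi}{\partial t}(t,x)+\frac{\partial\xi}{\partial x}(t,x)u(t,x)}{\frac{\partial\tau}{\partial t}(t,x)+\frac{\partial\tau}{\partial x}(t,x)u(t,x)}$$ satisfies $\partial_t\tilde u+\tilde u\,\partial_x\tilde u=0$ as soon as $u$ satisfies $(B)$.
   Context: A (local) bundle map is a local diffeomorphism of the form $\Phi(z,y)=(\phi(z),\theta(z,y))$ of $\mathbf R^2\times\mathbf R$ with $\phi(z)=(\phi_1(z),\phi_2(z))$ a local diffeomorphism of $\mathbf R^2$. It transforms one first order equation for functions $u$ into another for functions $v$ if $v(z)=\theta(\phi^{-1}(z),u(\phi^{-1}(z)))$ satisfies the second as soon as $u$ satisfies the first (that is, graphs of local classical solutions are mapped into graphs of local classical solutions). The formula for $\tilde u$ is used where its denominator does not vanish. In part (2) the fiber variable of $(B)$ is $u$, and the point corresponding to $(z_0,y_0)$ is $(z_0,X^2(z_0,y_0)/X^1(z_0,y_0))$.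
   Formalization: In (1), necessity of (i) fails as stated (X=(0,0,1) has no solutions); it is proved for maps carrying solutions to solutions both ways, with X1,X2,X3 not all zero at (z0,y0). One-way transformability is shown equivalent to (ii),(iii) given X1≠0 at (z0,y0). *)

theory Defs
  imports "HOL-Analysis.Analysis"
begin

type_synonym plane = "real \<times> real"


section \<open>Differentiability classes\<close>

text \<open>Only meant for open \<open>S\<close>: the derivatives are taken in the ambient space.\<close>

fun Ck_on :: "nat \<Rightarrow> 'a::euclidean_space set \<Rightarrow> ('a \<Rightarrow> 'b::real_normed_vector) \<Rightarrow> bool" where
  "Ck_on 0 S f \<longleftrightarrow> continuous_on S f"
| "Ck_on (Suc k) S f \<longleftrightarrow>
     (\<forall>x\<in>S. f differentiable at x) \<and> (\<forall>h. Ck_on k S (\<lambda>x. frechet_derivative f (at x) h))"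

definition smooth_on :: "'a::euclidean_space set \<Rightarrow> ('a \<Rightarrow> 'b::real_normed_vector) \<Rightarrow> bool" where
  "smooth_on S f \<longleftrightarrow> (\<forall>k. Ck_on k S f)"

definition smooth_near :: "'a::euclidean_space \<Rightarrow> ('a \<Rightarrow> 'b::real_normed_vector) \<Rightarrow> bool" where
  "smooth_near p f \<longleftrightarrow> (\<exists>N. open N \<and> p \<in> N \<and> smooth_on N f)"

definition diffeo_on :: "'a::euclidean_space set \<Rightarrow> ('a \<Rightarrow> 'a) \<Rightarrow> bool" where
  "diffeo_on U f \<longleftrightarrow>
     open U \<and> inj_on f U \<and> open (f ` U) \<and> smooth_on U f \<and> smooth_on (f ` U) (inv_into U f)"


section \<open>Partial derivatives\<close>

text \<open>Coordinates are \<open>z = (z\<^sub>1, z\<^sub>2)\<close> on the plane and \<open>(z, y)\<close> on the total space.\<close>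

definition pd1 :: "(plane \<Rightarrow> real) \<Rightarrow> plane \<Rightarrow> real" where
  "pd1 f z = frechet_derivative f (at z) (1, 0)"

definition pd2 :: "(plane \<Rightarrow> real) \<Rightarrow> plane \<Rightarrow> real" where
  "pd2 f z = frechet_derivative f (at z) (0, 1)"

definition pdz1 :: "(plane \<times> real \<Rightarrow> real) \<Rightarrow> plane \<times> real \<Rightarrow> real" where
  "pdz1 f p = frechet_derivative f (at p) ((1, 0), 0)"

definition pdz2 :: "(plane \<times> real \<Rightarrow> real) \<Rightarrow> plane \<times> real \<Rightarrow> real" where
  "pdz2 f p = frechet_derivative f (at p) ((0, 1), 0)"

definition pdy :: "(plane \<times> real \<Rightarrow> real) \<Rightarrow> plane \<times> real \<Rightarrow> real" where
  "pdy f p = frechet_derivative f (at p) ((0, 0), 1)"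


section \<open>First order equations and their classical solutions\<close>

text \<open>\<open>E z y p\<^sub>1 p\<^sub>2\<close> is the relation imposed at the point \<open>z\<close> on the value \<open>y\<close> and
  the partial derivatives \<open>p\<^sub>1\<close>, \<open>p\<^sub>2\<close> of the unknown function.\<close>

type_synonym pde = "plane \<Rightarrow> real \<Rightarrow> real \<Rightarrow> real \<Rightarrow> bool"

definition classical_solution :: "pde \<Rightarrow> plane set \<Rightarrow> (plane \<Rightarrow> real) \<Rightarrow> bool" where
  "classical_solution E D u \<longleftrightarrow>
     open D \<and> Ck_on 1 D u \<and> (\<forall>z\<in>D. E z (u z) (pd1 u z) (pd2 u z))"

definition graph_in :: "(plane \<times> real) set \<Rightarrow> plane set \<Rightarrow> (plane \<Rightarrow> real) \<Rightarrow> bool" where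
  "graph_in W D u \<longleftrightarrow> (\<forall>z\<in>D. (z, u z) \<in> W)"

definition quasilinear_eq ::
    "(plane \<times> real \<Rightarrow> real) \<Rightarrow> (plane \<times> real \<Rightarrow> real) \<Rightarrow> (plane \<times> real \<Rightarrow> real) \<Rightarrow> pde" where
  "quasilinear_eq X1 X2 X3 =
     (\<lambda>z y p1 p2. X1 (z, y) * p1 + X2 (z, y) * p2 = X3 (z, y))"

definition cubic_burgers_eq ::
    "(plane \<Rightarrow> real) \<Rightarrow> (plane \<Rightarrow> real) \<Rightarrow> (plane \<Rightarrow> real) \<Rightarrow> (plane \<Rightarrow> real) \<Rightarrow> pde" where
  "cubic_burgers_eq a b c d =
     (\<lambda>z u p1 p2. p1 + u * p2 = a z * u ^ 3 + b z * u ^ 2 + c z * u + d z)"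

definition burgers_eq :: pde where
  "burgers_eq = (\<lambda>z u p1 p2. p1 + u * p2 = 0)"


section \<open>Local bundle maps\<close>

definition bundle_map ::
    "(plane \<Rightarrow> plane) \<Rightarrow> (plane \<times> real \<Rightarrow> real) \<Rightarrow> plane set \<Rightarrow> (plane \<times> real) set \<Rightarrow> bool" where
  "bundle_map \<phi> \<theta> U W \<longleftrightarrow>
     W \<subseteq> U \<times> UNIV \<and> diffeo_on U \<phi> \<and> diffeo_on W (\<lambda>(z, y). (\<phi> z, \<theta> (z, y)))"

definition push ::
    "(plane \<Rightarrow> plane) \<Rightarrow> (plane \<times> real \<Rightarrow> real) \<Rightarrow> plane set \<Rightarrow> (plane \<Rightarrow> real) \<Rightarrow> plane \<Rightarrow> real" where
  "push \<phi> \<theta> U u = (\<lambda>z. \<theta> (inv_into U \<phi> z, u (inv_into U \<phi> z)))"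

definition maps_solutions :: "pde \<Rightarrow> pde \<Rightarrow>
    (plane \<Rightarrow> plane) \<Rightarrow> (plane \<times> real \<Rightarrow> real) \<Rightarrow> plane set \<Rightarrow> (plane \<times> real) set \<Rightarrow> bool" where
  "maps_solutions E F \<phi> \<theta> U W \<longleftrightarrow>
     (\<forall>D u. graph_in W D u \<and> classical_solution E D u
        \<longrightarrow> classical_solution F (\<phi> ` D) (push \<phi> \<theta> U u))"

definition exchanges_solutions :: "pde \<Rightarrow> pde \<Rightarrow>
    (plane \<Rightarrow> plane) \<Rightarrow> (plane \<times> real \<Rightarrow> real) \<Rightarrow> plane set \<Rightarrow> (plane \<times> real) set \<Rightarrow> bool" where
  "exchanges_solutions E F \<phi> \<theta> U W \<longleftrightarrow>
     (\<forall>D u. open D \<and> graph_in W D u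
        \<longrightarrow> (classical_solution E D u \<longleftrightarrow> classical_solution F (\<phi> ` D) (push \<phi> \<theta> U u)))"

definition transformable :: "pde \<Rightarrow> pde \<Rightarrow> plane \<times> real \<Rightarrow> bool" where
  "transformable E F p0 \<longleftrightarrow>
     (\<exists>\<phi> \<theta> U W. bundle_map \<phi> \<theta> U W \<and> p0 \<in> W \<and> maps_solutions E F \<phi> \<theta> U W)"

definition transformable_to_cubic_burgers :: "pde \<Rightarrow> plane \<times> real \<Rightarrow> bool" where
  "transformable_to_cubic_burgers E p0 \<longleftrightarrow>
     (\<exists>\<phi> \<theta> U W a b c d. bundle_map \<phi> \<theta> U W \<and> p0 \<in> W
        \<and> smooth_near (\<phi> (fst p0)) a \<and> smooth_near (\<phi> (fst p0)) b
        \<and> smooth_near (\<phi> (fst p0)) c \<and> smooth_near (\<phi> (fst p0)) d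
        \<and> maps_solutions E (cubic_burgers_eq a b c d) \<phi> \<theta> U W)"

text \<open>The two-sided variant matters where the coefficients in front of the derivatives vanish:
  the equation \<open>0 = 1\<close> has no solutions, so every bundle map maps its solutions vacuously to
  solutions of any other equation, but none exchanges the solutions. At isolated common zeros of
  all three coefficients even exchanging the solutions says nothing about the coefficients:
  \<open>(y\<^sup>2 + \<bar>z\<bar>\<^sup>2) (\<partial>\<^sub>1v + v \<partial>\<^sub>2v) = 0\<close> and \<open>\<partial>\<^sub>1v + v \<partial>\<^sub>2v = 0\<close>
  have the same classical solutions.\<close>

definition equivalent_to_cubic_burgers :: "pde \<Rightarrow> plane \<times> real \<Rightarrow> bool" where
  "equivalent_to_cubic_burgers E p0 \<longleftrightarrow>
     (\<exists>\<phi> \<theta> U W a b c d. bundle_map \<phi> \<theta> U W \<and> p0 \<in> W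
        \<and> smooth_near (\<phi> (fst p0)) a \<and> smooth_near (\<phi> (fst p0)) b
        \<and> smooth_near (\<phi> (fst p0)) c \<and> smooth_near (\<phi> (fst p0)) d
        \<and> exchanges_solutions E (cubic_burgers_eq a b c d) \<phi> \<theta> U W)"


section \<open>The conditions on the coefficients\<close>

definition slope :: "(plane \<times> real \<Rightarrow> real) \<Rightarrow> (plane \<times> real \<Rightarrow> real) \<Rightarrow> plane \<times> real \<Rightarrow> real" where
  "slope X1 X2 = (\<lambda>p. X2 p / X1 p)"

definition slope_y_nonzero_near ::
    "(plane \<times> real \<Rightarrow> real) \<Rightarrow> (plane \<times> real \<Rightarrow> real) \<Rightarrow> plane \<times> real \<Rightarrow> bool" where
  "slope_y_nonzero_near X1 X2 p0 \<longleftrightarrow> (\<forall>\<^sub>F p in nhds p0. pdy (slope X1 X2) p \<noteq> 0)"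

definition cubic_identity_near ::
    "(plane \<times> real \<Rightarrow> real) \<Rightarrow> (plane \<times> real \<Rightarrow> real) \<Rightarrow> (plane \<times> real \<Rightarrow> real) \<Rightarrow> plane \<times> real \<Rightarrow>
     (plane \<Rightarrow> real) \<Rightarrow> (plane \<Rightarrow> real) \<Rightarrow> (plane \<Rightarrow> real) \<Rightarrow> (plane \<Rightarrow> real) \<Rightarrow> bool" where
  "cubic_identity_near X1 X2 X3 p0 a b c d \<longleftrightarrow>
     smooth_near (fst p0) a \<and> smooth_near (fst p0) b \<and>
     smooth_near (fst p0) c \<and> smooth_near (fst p0) d \<and>
     (let w = slope X1 X2 in
      \<forall>\<^sub>F (z, y) in nhds p0.
        pdz1 w (z, y) + w (z, y) * pdz2 w (z, y) + X3 (z, y) / X1 (z, y) * pdy w (z, y)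
        = a z * w (z, y) ^ 3 + b z * w (z, y) ^ 2 + c z * w (z, y) + d z)"

text \<open>Renaming the indices of the base coordinates turns \<open>(X\<^sup>1, X\<^sup>2, X\<^sup>3)\<close> into
  \<open>(swap_base X\<^sup>2, swap_base X\<^sup>1, swap_base X\<^sup>3)\<close> and \<open>z\<^sub>0\<close> into \<open>prod.swap z\<^sub>0\<close>.\<close>

definition swap_base :: "(plane \<times> real \<Rightarrow> real) \<Rightarrow> plane \<times> real \<Rightarrow> real" where
  "swap_base X = (\<lambda>(z, y). X (prod.swap z, y))"

definition admissible ::
    "(plane \<times> real \<Rightarrow> real) \<Rightarrow> (plane \<times> real \<Rightarrow> real) \<Rightarrow> (plane \<times> real \<Rightarrow> real) \<Rightarrow> plane \<times> real \<Rightarrow> bool" where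
  "admissible X1 X2 X3 p0 \<longleftrightarrow>
     (\<forall>\<^sub>F p in nhds p0. X1 p \<noteq> 0) \<and> slope_y_nonzero_near X1 X2 p0 \<and>
     (\<exists>a b c d. cubic_identity_near X1 X2 X3 p0 a b c d)"

definition linearizable_system ::
    "(plane \<Rightarrow> real) \<Rightarrow> (plane \<Rightarrow> real) \<Rightarrow> (plane \<Rightarrow> real) \<Rightarrow> (plane \<Rightarrow> real) \<Rightarrow> plane \<Rightarrow> bool" where
  "linearizable_system a b c d z \<longleftrightarrow>
     1/3 * pd2 (pd2 c) z - 2/3 * pd2 (pd1 b) z + pd1 (pd1 a) z
       - 2/3 * b z * pd1 b z + a z * pd1 c z + c z * pd1 a z
       + 1/3 * b z * pd2 c z - 2 * a z * pd2 d z - d z * pd2 a z = 0 \<and>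
     1/3 * pd1 (pd1 b) z - 2/3 * pd1 (pd2 c) z + pd2 (pd2 d) z
       + 2/3 * c z * pd2 c z - d z * pd2 b z - b z * pd2 d z
       - 1/3 * c z * pd1 b z + 2 * d z * pd1 a z + a z * pd1 d z = 0"

end

theory Submission
  imports Defs
begin

text \<open>
  A graph with tangent directions \<open>(k, Dv k)\<close> solves \<open>(A)\<close> iff it is tangent to the field
  \<open>X = (X\<^sup>1, X\<^sup>2, X\<^sup>3)\<close>. Flowing transversal curves along \<open>X\<close> yields, through every point with
  \<open>(X\<^sup>1, X\<^sup>2) \<noteq> 0\<close>, solutions with different tangent planes, so a bundle map that transforms \<open>(A)\<close>
  into \<open>(B)\<close> maps the direction of \<open>X\<close> to that of \<open>(1, u, a u\<^sup>3 + b u\<^sup>2 + c u + d)\<close>. Hence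
  \<open>\<theta> = (\<xi>\<^sub>1 + \<xi>\<^sub>2 w) / (\<tau>\<^sub>1 + \<tau>\<^sub>2 w)\<close> with \<open>\<phi> = (\<tau>, \<xi>)\<close> and \<open>w = X\<^sup>2 / X\<^sup>1\<close>; differentiating this along \<open>X\<close>
  gives \<open>w\<^sub>y \<noteq> 0\<close> and the cubic identity. Conversely \<open>(z, y) \<mapsto> (z, w)\<close> is the required bundle map.

  For part (2) the cubic expresses \<open>a, b, c, d\<close> through \<open>\<tau>\<close> and \<open>\<xi>\<close>: the characteristics of \<open>(B)\<close> are
  the geodesics of a projective connection that \<open>\<phi>\<close> straightens. Such a \<open>\<phi>\<close> is a quotient
  \<open>(f/h, g/h)\<close> of solutions of a linear system for \<open>(f, f\<^sub>t, f\<^sub>x)\<close> whose integrability conditions are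
  exactly the two equations of the statement.
\<close>

section \<open>Calculus of C^k functions\<close>

text \<open>The hypotheses speak about solutions, the conclusions about coefficients, so there must
  be enough \<open>C^1\<close> solutions: through a given point the derivative transversal to the
  characteristic direction has to be arbitrary. An identity that is affine in this free derivative
  then splits into two. Such solutions come from flows that are differentiable in one curve
  parameter; solving the equation and its variational equation as a single system makes this
  differentiability a by-product of Picard iteration. The same construction, used twice, yields the
  Frobenius theorem behind the linear system of part (2).

  That system comes from projective geometry. If the characteristics of (B) can be straightened,
  then \<open>h\<close>, \<open>\<tau> h\<close>, \<open>\<xi> h\<close> are homogeneous coordinates
  for a suitable weight \<open>h\<close>, and second derivatives of homogeneous coordinates are
  combinations of values and first derivatives. Unparametrized curves determine the connection only
  up to two free functions; the weight absorbs them.\<close>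

lemma frechet_derivative_eq:
  "(f has_derivative f') (at x) \<Longrightarrow> frechet_derivative f (at x) = f'"
  by (rule frechet_derivative_at[symmetric])

lemma differentiable_cong_open:
  assumes "open S" "x \<in> S" "\<And>y. y \<in> S \<Longrightarrow> f y = g y"
  shows "f differentiable at x \<longleftrightarrow> g differentiable at x"
proof -
  have "\<And>f g. (\<And>y. y \<in> S \<Longrightarrow> f y = g y) \<Longrightarrow> f differentiable at x \<Longrightarrow> g differentiable at x"
    using assms(1,2) has_derivative_transform_within_open unfolding differentiable_def by blast
  from this[of f g] this[of g f] assms(3) show ?thesis by metis
qed

lemma frechet_derivative_cong_open:
  assumes "open S" "x \<in> S" "\<And>y. y \<in> S \<Longrightarrow> f y = g y"
  shows "frechet_derivative f (at x) = frechet_derivative g (at x)"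
proof -
  have "(f has_derivative f') (at x) \<longleftrightarrow> (g has_derivative f') (at x)" for f'
    using has_derivative_transform_within_open[OF _ assms(1,2)] assms(3) by metis
  then show ?thesis by (simp add: frechet_derivative_def)
qed

lemma Ck_on_cong:
  assumes "open S" "\<And>y. y \<in> S \<Longrightarrow> f y = g y"
  shows "Ck_on k S f \<longleftrightarrow> Ck_on k S g"
  using assms(2)
proof (induction k arbitrary: f g)
  case 0
  then show ?case by (simp cong: continuous_on_cong)
next
  case (Suc k)
  have "Ck_on k S (\<lambda>x. frechet_derivative f (at x) h) = Ck_on k S (\<lambda>x. frechet_derivative g (at x) h)" for h
    by (rule Suc.IH) (simp add: frechet_derivative_cong_open[OF assms(1) _ Suc.prems])
  then show ?case using differentiable_cong_open[OF assms(1) _ Suc.prems] by auto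
qed

lemma Ck_on_subset: "Ck_on k S f \<Longrightarrow> T \<subseteq> S \<Longrightarrow> Ck_on k T f"
  by (induction k arbitrary: f) (auto intro: continuous_on_subset)

lemma Ck_on_SucD: "Ck_on (Suc k) S f \<Longrightarrow> Ck_on k S f"
proof (induction k arbitrary: f)
  case 0
  then show ?case by (auto intro!: differentiable_imp_continuous_on
        simp: differentiable_on_def differentiable_at_withinI)
next
  case (Suc k)
  show ?case using Suc.prems Suc.IH by (metis Ck_on.simps(2))
qed

lemma Ck_on_Suc_frechet: "Ck_on (Suc k) S f \<Longrightarrow> Ck_on k S (\<lambda>x. frechet_derivative f (at x) h)"
  by simp

lemma Ck_on_Suc_has_derivative:
  "Ck_on (Suc k) S f \<Longrightarrow> x \<in> S \<Longrightarrow> (f has_derivative frechet_derivative f (at x)) (at x)"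
  by (simp add: frechet_derivative_works)

text \<open>Only derivatives in fixed directions enter \<open>Ck_on\<close>, so a family
  \<open>F\<close> of derivatives may be supplied in closed form; uniqueness of derivatives
  identifies it with \<open>frechet_derivative\<close> on the open set.\<close>

lemma Ck_on_SucI:
  assumes "open S" "\<And>x. x \<in> S \<Longrightarrow> (f has_derivative F x) (at x)" "\<And>h. Ck_on k S (\<lambda>x. F x h)"
  shows "Ck_on (Suc k) S f"
proof -
  have "Ck_on k S (\<lambda>x. frechet_derivative f (at x) h)" for h
    using assms(3)[of h] Ck_on_cong[OF assms(1), of "\<lambda>x. frechet_derivative f (at x) h" "\<lambda>x. F x h"]
    by (simp add: frechet_derivative_eq[OF assms(2)])
  then show ?thesis using assms(2) by (auto simp: differentiable_def)
qed

lemma Ck_on_const [simp]: "Ck_on k S (\<lambda>x. c)"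
proof (induction k arbitrary: c)
  case (Suc k)
  have "frechet_derivative (\<lambda>x. c) (at x) = (\<lambda>_. 0)" for x :: 'a
    by (rule frechet_derivative_eq) simp
  then show ?case using Suc by simp
qed simp

declare Ck_on.simps(2) [simp del]

lemma Ck_on_le: "j \<le> k \<Longrightarrow> Ck_on k S f \<Longrightarrow> Ck_on j S f"
  by (induction rule: inc_induct) (auto dest: Ck_on_SucD)

lemma Ck_on_continuous: "Ck_on k S f \<Longrightarrow> continuous_on S f"
  using Ck_on_le[of 0 k S f] by simp

lemma Ck_on_linear: "open S \<Longrightarrow> bounded_linear f \<Longrightarrow> Ck_on k S f"
proof (cases k)
  case 0
  then show "bounded_linear f \<Longrightarrow> ?thesis" by (simp add: linear_continuous_on)
next
  case (Suc k)
  assume "open S" "bounded_linear f"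
  then show ?thesis unfolding Suc
    by (intro Ck_on_SucI[where F = "\<lambda>_. f"]) (auto intro: bounded_linear_imp_has_derivative)
qed

lemma Ck_on_linear_compose:
  assumes "open S" "bounded_linear L" "Ck_on k S f"
  shows "Ck_on k S (\<lambda>x. L (f x))"
  using assms(3)
proof (induction k arbitrary: f)
  case 0
  then show ?case using assms(2) by (simp add: linear_continuous_on_compose bounded_linear.linear
     bounded_linear.continuous_on)
next
  case (Suc k)
  show ?case
    by (rule Ck_on_SucI[OF assms(1) bounded_linear.has_derivative[OF assms(2) Ck_on_Suc_has_derivative[OF Suc.prems]]])
      (auto intro!: Suc.IH Ck_on_Suc_frechet Suc.prems)
qed

lemma Ck_on_Pair:
  assumes "open S" "Ck_on k S f" "Ck_on k S g"
  shows "Ck_on k S (\<lambda>x. (f x, g x))"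
  using assms(2,3)
proof (induction k arbitrary: f g)
  case 0
  then show ?case by (simp add: continuous_on_Pair)
next
  case (Suc k)
  show ?case
    by (rule Ck_on_SucI[OF assms(1) has_derivative_Pair[OF Suc.prems[THEN Ck_on_Suc_has_derivative]]])
      (auto intro!: Suc.IH Ck_on_Suc_frechet Suc.prems)
qed

lemma Ck_on_add:
  assumes "open S" "Ck_on k S f" "Ck_on k S g"
  shows "Ck_on k S (\<lambda>x. f x + g x)"
  using Ck_on_linear_compose[OF assms(1) bounded_linear_add[OF bounded_linear_fst bounded_linear_snd]
      Ck_on_Pair[OF assms]] by simp

lemma Ck_on_minus: "open S \<Longrightarrow> Ck_on k S f \<Longrightarrow> Ck_on k S (\<lambda>x. - f x)"
  by (rule Ck_on_linear_compose[OF _ bounded_linear_minus[OF bounded_linear_ident]])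

lemma Ck_on_diff:
  assumes "open S" "Ck_on k S f" "Ck_on k S g"
  shows "Ck_on k S (\<lambda>x. f x - g x)"
  using Ck_on_add[OF assms(1,2) Ck_on_minus[OF assms(1,3)]] by simp

lemma Ck_on_sum:
  "open S \<Longrightarrow> (\<And>i. i \<in> I \<Longrightarrow> Ck_on k S (f i)) \<Longrightarrow> Ck_on k S (\<lambda>x. \<Sum>i\<in>I. f i x)"
  by (induction I rule: infinite_finite_induct) (auto intro: Ck_on_add)

lemma Ck_on_bilinear:
  assumes "bounded_bilinear p" "open S" "Ck_on k S f" "Ck_on k S g"
  shows "Ck_on k S (\<lambda>x. p (f x) (g x))"
  using assms(3,4)
proof (induction k arbitrary: f g)
  case 0
  then show ?case using bounded_bilinear.continuous_on[OF assms(1)] by auto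
next
  case (Suc k)
  show ?case
    by (rule Ck_on_SucI[OF assms(2) bounded_bilinear.FDERIV[OF assms(1) Suc.prems[THEN Ck_on_Suc_has_derivative]]])
      (auto intro!: Ck_on_add[OF assms(2)] Suc.IH Ck_on_Suc_frechet Suc.prems Suc.prems[THEN Ck_on_SucD])
qed

lemmas Ck_on_mult = Ck_on_bilinear[OF bounded_bilinear_mult]
lemmas Ck_on_scaleR = Ck_on_bilinear[OF bounded_bilinear_scaleR]

lemma Ck_on_power: "open S \<Longrightarrow> Ck_on k S f \<Longrightarrow> Ck_on k S (\<lambda>x. f x ^ n :: real)"
  by (induction n) (auto intro: Ck_on_mult)

text \<open>The derivative of \<open>1/f\<close> is again built from \<open>1/f\<close> and the
  derivative of \<open>f\<close>, so the induction hypothesis applies to it at one order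
  less.\<close>

lemma Ck_on_inverse:
  fixes f :: "'a::euclidean_space \<Rightarrow> real"
  assumes "open S" "Ck_on k S f" "\<And>x. x \<in> S \<Longrightarrow> f x \<noteq> 0"
  shows "Ck_on k S (\<lambda>x. inverse (f x))"
  using assms(2)
proof (induction k)
  case 0
  then show ?case using assms(3) by (auto intro: continuous_intros)
next
  case (Suc k)
  show ?case
  proof (rule Ck_on_SucI[OF assms(1)])
    show "((\<lambda>x. inverse (f x)) has_derivative
       (\<lambda>h. - (inverse (f x) * frechet_derivative f (at x) h * inverse (f x)))) (at x)" if "x \<in> S" for x
      using Ck_on_Suc_has_derivative[OF Suc.prems that] assms(3)[OF that] by (auto intro: has_derivative_inverse)
    show "Ck_on k S (\<lambda>x. - (inverse (f x) * frechet_derivative f (at x) h * inverse (f x)))" for h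
      by (intro Ck_on_minus Ck_on_mult assms(1) Suc.IH Ck_on_Suc_frechet Suc.prems Ck_on_SucD[OF Suc.prems])
  qed
qed

lemma Ck_on_divide:
  fixes f :: "'a::euclidean_space \<Rightarrow> real"
  assumes "open S" "Ck_on k S f" "Ck_on k S g" "\<And>x. x \<in> S \<Longrightarrow> g x \<noteq> 0"
  shows "Ck_on k S (\<lambda>x. f x / g x)"
  using Ck_on_mult[OF assms(1,2) Ck_on_inverse[OF assms(1,3,4)]] by (simp add: divide_inverse)

lemma Ck_on_compose:
  fixes f :: "'b::euclidean_space \<Rightarrow> 'c::real_normed_vector" and g :: "'a::euclidean_space \<Rightarrow> 'b"
  assumes "open S" "open T" "Ck_on k T f" "Ck_on k S g" "g ` S \<subseteq> T"
  shows "Ck_on k S (\<lambda>x. f (g x))"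
  using assms(3,4)
proof (induction k arbitrary: f)
  case 0
  then show ?case using assms(5) by (auto intro: continuous_on_compose2)
next
  case (Suc k)
  let ?F = "\<lambda>x h. frechet_derivative f (at (g x)) (frechet_derivative g (at x) h)"
  show ?case
  proof (rule Ck_on_SucI[OF assms(1)])
    fix x assume x: "x \<in> S"
    then have "(f has_derivative frechet_derivative f (at (g x))) (at (g x))"
      using assms(5) Suc.prems(1) by (intro Ck_on_Suc_has_derivative) auto
    then show "((\<lambda>x. f (g x)) has_derivative ?F x) (at x)"
      by (rule has_derivative_compose[OF Ck_on_Suc_has_derivative[OF Suc.prems(2) x]])
  next
    fix h
    \<comment> \<open>\<open>Ck_on\<close> speaks about the derivative of \<open>f\<close> in fixed
      directions, while the chain rule evaluates it in a direction that moves with \<open>x\<close>.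
      Expanding that direction in the standard basis leaves fixed directions with scalar
      coefficients.\<close>
    have eq: "?F x h = (\<Sum>b\<in>Basis. (frechet_derivative g (at x) h \<bullet> b) *\<^sub>R frechet_derivative f (at (g x)) b)"
      if "x \<in> S" for x
    proof -
      have lin: "linear (frechet_derivative f (at (g x)))"
        using that assms(5) Suc.prems(1) by (intro linear_frechet_derivative) (auto simp: Ck_on.simps(2))
      have "?F x h = frechet_derivative f (at (g x)) (\<Sum>b\<in>Basis. (frechet_derivative g (at x) h \<bullet> b) *\<^sub>R b)"
        by (simp add: euclidean_representation)
      then show ?thesis by (simp add: linear_sum[OF lin] linear_scale[OF lin])
    qed
    have "Ck_on k S (\<lambda>x. \<Sum>b\<in>Basis. (frechet_derivative g (at x) h \<bullet> b) *\<^sub>R frechet_derivative f (at (g x)) b)"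
      by (intro Ck_on_sum Ck_on_scaleR assms(1) Suc.IH Ck_on_Suc_frechet Suc.prems
        Ck_on_linear_compose[OF _ bounded_linear_inner_left] Ck_on_SucD[OF Suc.prems(2)])
    moreover have "Ck_on k S (\<lambda>x. ?F x h) \<longleftrightarrow> Ck_on k S (\<lambda>x. \<Sum>b\<in>Basis. (frechet_derivative g (at x) h \<bullet> b) *\<^sub>R frechet_derivative f (at (g x)) b)"
      by (rule Ck_on_cong[OF assms(1)]) (rule eq)
    ultimately show "Ck_on k S (\<lambda>x. ?F x h)" by simp
  qed
qed

text \<open>The derivative of \<open>g\<close> is a \<open>C^k\<close> expression in
  \<open>(x, g x)\<close>, so regularity of \<open>g\<close> feeds back into its derivative until
  the order \<open>k\<close> is reached. Such a relation is available for inverse functions and for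
  solutions of total differential equations.\<close>

lemma Ck_on_bootstrap:
  fixes g :: "'a::euclidean_space \<Rightarrow> 'b::euclidean_space" and K :: "'a \<times> 'b \<Rightarrow> 'a \<Rightarrow> 'b"
  assumes "open S" "open T"
    and "\<And>x. x \<in> S \<Longrightarrow> (x, g x) \<in> T \<and> (g has_derivative K (x, g x)) (at x)"
    and "\<And>h. Ck_on k T (\<lambda>y. K y h)"
  shows "Ck_on (Suc k) S g"
  using assms(4)
proof (induction k)
  case 0
  have "continuous_on S g"
    using assms(3) has_derivative_continuous by (blast intro: continuous_at_imp_continuous_on)
  then have "Ck_on 0 S (\<lambda>x. K (x, g x) h)" for h
    using 0 assms(3) by (auto intro!: continuous_on_compose2[of T "\<lambda>y. K y h" S] continuous_intros)
  then show ?case using assms(1,3) by (intro Ck_on_SucI[of S g "\<lambda>x. K (x, g x)"]) auto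
next
  case (Suc k)
  have "Ck_on (Suc k) S g" using Suc by (metis Ck_on_SucD)
  then have "Ck_on (Suc k) S (\<lambda>x. (x, g x))"
    by (rule Ck_on_Pair[OF assms(1) Ck_on_linear[OF assms(1) bounded_linear_ident]])
  then have "Ck_on (Suc k) S (\<lambda>x. K (x, g x) h)" for h
    using assms(3) by (intro Ck_on_compose[OF assms(1,2) Suc.prems]) auto
  then show ?case using assms(1,3) by (intro Ck_on_SucI[of S g "\<lambda>x. K (x, g x)"]) auto
qed

section \<open>Smooth functions\<close>

lemma smooth_on_Ck: "smooth_on S f \<Longrightarrow> Ck_on k S f"
  by (simp add: smooth_on_def)

lemma smooth_on_subset: "smooth_on S f \<Longrightarrow> T \<subseteq> S \<Longrightarrow> smooth_on T f"
  by (auto simp: smooth_on_def intro: Ck_on_subset)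

lemma smooth_on_cong: "open S \<Longrightarrow> (\<And>y. y \<in> S \<Longrightarrow> f y = g y) \<Longrightarrow> smooth_on S f \<longleftrightarrow> smooth_on S g"
  unfolding smooth_on_def by (intro all_cong1 Ck_on_cong)

lemma smooth_on_const [simp]: "smooth_on S (\<lambda>x. c)"
  by (simp add: smooth_on_def)

lemma smooth_on_linear: "open S \<Longrightarrow> bounded_linear f \<Longrightarrow> smooth_on S f"
  unfolding smooth_on_def by (blast intro: Ck_on_linear[of S f])

lemma smooth_on_linear_compose: "open S \<Longrightarrow> bounded_linear L \<Longrightarrow> smooth_on S f \<Longrightarrow> smooth_on S (\<lambda>x. L (f x))"
  unfolding smooth_on_def by (blast intro: Ck_on_linear_compose[of S L _ f])

lemma smooth_on_frechet: "smooth_on S f \<Longrightarrow> smooth_on S (\<lambda>x. frechet_derivative f (at x) h)"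
  unfolding smooth_on_def by (blast intro: Ck_on_Suc_frechet[of _ S f])

lemma smooth_on_has_derivative:
  "smooth_on S f \<Longrightarrow> x \<in> S \<Longrightarrow> (f has_derivative frechet_derivative f (at x)) (at x)"
  by (rule Ck_on_Suc_has_derivative[of 0]) (simp_all add: smooth_on_def)

lemma smooth_on_differentiable: "smooth_on S f \<Longrightarrow> x \<in> S \<Longrightarrow> f differentiable at x"
  by (rule differentiableI[OF smooth_on_has_derivative])

lemma smooth_on_continuous: "smooth_on S f \<Longrightarrow> continuous_on S f"
  by (rule Ck_on_continuous[of 0]) (simp add: smooth_on_def)

lemma smooth_on_pd1: "smooth_on S f \<Longrightarrow> smooth_on S (pd1 f)"
  using smooth_on_frechet[of S f "(1, 0)"] by (simp add: pd1_def[abs_def])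

lemma smooth_on_pd2: "smooth_on S f \<Longrightarrow> smooth_on S (pd2 f)"
  using smooth_on_frechet[of S f "(0, 1)"] by (simp add: pd2_def[abs_def])

lemma smooth_on_pdz1: "smooth_on S f \<Longrightarrow> smooth_on S (pdz1 f)"
  using smooth_on_frechet[of S f "((1, 0), 0)"] by (simp add: pdz1_def[abs_def])

lemma smooth_on_pdz2: "smooth_on S f \<Longrightarrow> smooth_on S (pdz2 f)"
  using smooth_on_frechet[of S f "((0, 1), 0)"] by (simp add: pdz2_def[abs_def])

lemma smooth_on_pdy: "smooth_on S f \<Longrightarrow> smooth_on S (pdy f)"
  using smooth_on_frechet[of S f "((0, 0), 1)"] by (simp add: pdy_def[abs_def])


lemma smooth_on_Pair: "open S \<Longrightarrow> smooth_on S f \<Longrightarrow> smooth_on S g \<Longrightarrow> smooth_on S (\<lambda>x. (f x, g x))"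
  by (simp add: smooth_on_def Ck_on_Pair)

lemma smooth_on_add: "open S \<Longrightarrow> smooth_on S f \<Longrightarrow> smooth_on S g \<Longrightarrow> smooth_on S (\<lambda>x. f x + g x)"
  by (simp add: smooth_on_def Ck_on_add)

lemma smooth_on_diff: "open S \<Longrightarrow> smooth_on S f \<Longrightarrow> smooth_on S g \<Longrightarrow> smooth_on S (\<lambda>x. f x - g x)"
  by (simp add: smooth_on_def Ck_on_diff)

lemma smooth_on_minus: "open S \<Longrightarrow> smooth_on S f \<Longrightarrow> smooth_on S (\<lambda>x. - f x)"
  by (simp add: smooth_on_def Ck_on_minus)

lemma smooth_on_mult:
  fixes f g :: "'a::euclidean_space \<Rightarrow> real"
  shows "open S \<Longrightarrow> smooth_on S f \<Longrightarrow> smooth_on S g \<Longrightarrow> smooth_on S (\<lambda>x. f x * g x)"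
  by (simp add: smooth_on_def Ck_on_mult)

lemma smooth_on_power:
  fixes f :: "'a::euclidean_space \<Rightarrow> real"
  shows "open S \<Longrightarrow> smooth_on S f \<Longrightarrow> smooth_on S (\<lambda>x. f x ^ n)"
  by (simp add: smooth_on_def Ck_on_power)

lemma smooth_on_divide:
  fixes f g :: "'a::euclidean_space \<Rightarrow> real"
  shows "open S \<Longrightarrow> smooth_on S f \<Longrightarrow> smooth_on S g \<Longrightarrow> (\<And>x. x \<in> S \<Longrightarrow> g x \<noteq> 0) \<Longrightarrow> smooth_on S (\<lambda>x. f x / g x)"
  by (simp add: smooth_on_def Ck_on_divide)

lemma smooth_on_compose:
  fixes f :: "'b::euclidean_space \<Rightarrow> 'c::real_normed_vector" and g :: "'a::euclidean_space \<Rightarrow> 'b"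
  shows "open S \<Longrightarrow> open T \<Longrightarrow> smooth_on T f \<Longrightarrow> smooth_on S g \<Longrightarrow> g ` S \<subseteq> T \<Longrightarrow> smooth_on S (\<lambda>x. f (g x))"
  unfolding smooth_on_def by (blast intro: Ck_on_compose[of S T _ f g])

lemma smooth_on_fst: "open S \<Longrightarrow> smooth_on S f \<Longrightarrow> smooth_on S (\<lambda>x. fst (f x))"
  by (rule smooth_on_linear_compose[OF _ bounded_linear_fst])

lemma smooth_on_snd: "open S \<Longrightarrow> smooth_on S f \<Longrightarrow> smooth_on S (\<lambda>x. snd (f x))"
  by (rule smooth_on_linear_compose[OF _ bounded_linear_snd])

lemma smooth_on_ident: "open S \<Longrightarrow> smooth_on S (\<lambda>x. x)"
  by (rule smooth_on_linear[OF _ bounded_linear_ident])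

lemmas smooth_intros = smooth_on_const smooth_on_Pair smooth_on_add smooth_on_diff smooth_on_minus
  smooth_on_mult smooth_on_power smooth_on_divide smooth_on_fst smooth_on_snd smooth_on_ident
  smooth_on_pd1 smooth_on_pd2 smooth_on_pdz1 smooth_on_pdz2 smooth_on_pdy

section \<open>Partial derivatives\<close>

lemma has_derivative_pd:
  assumes "f differentiable at z"
  shows "(f has_derivative (\<lambda>h. fst h * pd1 f z + snd h * pd2 f z)) (at z)"
proof -
  have "linear (frechet_derivative f (at z))" by (rule linear_frechet_derivative[OF assms])
  then have "frechet_derivative f (at z) h = fst h * pd1 f z + snd h * pd2 f z" for h
    using linear_add[of "frechet_derivative f (at z)" "fst h *\<^sub>R (1, 0)" "snd h *\<^sub>R (0, 1)"]
      linear_scale[of "frechet_derivative f (at z)"]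
    by (simp add: pd1_def pd2_def del: scaleR_Pair) simp
  then show ?thesis using assms frechet_derivative_works by (metis (no_types, lifting) ext)
qed

lemma has_derivative_pdz:
  assumes "f differentiable at p"
  shows "(f has_derivative (\<lambda>h. fst (fst h) * pdz1 f p + snd (fst h) * pdz2 f p + snd h * pdy f p)) (at p)"
proof -
  have "linear (frechet_derivative f (at p))" by (rule linear_frechet_derivative[OF assms])
  then have "frechet_derivative f (at p) h = fst (fst h) * pdz1 f p + snd (fst h) * pdz2 f p + snd h * pdy f p" for h
    using linear_add[of "frechet_derivative f (at p)" "fst (fst h) *\<^sub>R ((1, 0), 0) + snd (fst h) *\<^sub>R ((0, 1), 0)" "snd h *\<^sub>R ((0, 0), 1)"]
      linear_add[of "frechet_derivative f (at p)" "fst (fst h) *\<^sub>R ((1, 0), 0)" "snd (fst h) *\<^sub>R ((0, 1), 0)"]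
      linear_scale[of "frechet_derivative f (at p)"]
    by (simp add: pdz1_def pdz2_def pdy_def del: scaleR_Pair) (simp add: zero_prod_def[symmetric])
  then show ?thesis using assms frechet_derivative_works by (metis (no_types, lifting) ext)
qed

lemma
  assumes "(f has_derivative f') (at z)"
  shows pd1_eq: "pd1 f z = f' (1, 0)" and pd2_eq: "pd2 f z = f' (0, 1)"
  using frechet_derivative_eq[OF assms] by (auto simp: pd1_def pd2_def)

lemma
  assumes "(f has_derivative f') (at p)"
  shows pdz1_eq: "pdz1 f p = f' ((1, 0), 0)" and pdz2_eq: "pdz2 f p = f' ((0, 1), 0)"
    and pdy_eq: "pdy f p = f' ((0, 0), 1)"
  using frechet_derivative_eq[OF assms] by (auto simp: pdz1_def pdz2_def pdy_def)

lemma
  assumes "open S" "z \<in> S" "\<And>y. y \<in> S \<Longrightarrow> f y = g y"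
  shows pd1_cong: "pd1 f z = pd1 g z" and pd2_cong: "pd2 f z = pd2 g z"
  using frechet_derivative_cong_open[OF assms] by (auto simp: pd1_def pd2_def)

lemma pd_const [simp]: "pd1 (\<lambda>z. c) z = 0" "pd2 (\<lambda>z. c) z = 0"
  using pd1_eq[OF has_derivative_const] pd2_eq[OF has_derivative_const] by auto

lemma
  assumes "f differentiable at z" "g differentiable at z"
  shows pd1_add: "pd1 (\<lambda>z. f z + g z) z = pd1 f z + pd1 g z"
    and pd2_add: "pd2 (\<lambda>z. f z + g z) z = pd2 f z + pd2 g z"
    and pd1_diff: "pd1 (\<lambda>z. f z - g z) z = pd1 f z - pd1 g z"
    and pd2_diff: "pd2 (\<lambda>z. f z - g z) z = pd2 f z - pd2 g z"
    and pd1_mult: "pd1 (\<lambda>z. f z * g z) z = f z * pd1 g z + pd1 f z * g z"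
    and pd2_mult: "pd2 (\<lambda>z. f z * g z) z = f z * pd2 g z + pd2 f z * g z"
    and pd1_divide: "g z \<noteq> 0 \<Longrightarrow> pd1 (\<lambda>z. f z / g z) z = (pd1 f z * g z - f z * pd1 g z) / (g z)^2"
    and pd2_divide: "g z \<noteq> 0 \<Longrightarrow> pd2 (\<lambda>z. f z / g z) z = (pd2 f z * g z - f z * pd2 g z) / (g z)^2"
  using pd1_eq[OF has_derivative_add[OF assms[THEN has_derivative_pd]]]
    pd2_eq[OF has_derivative_add[OF assms[THEN has_derivative_pd]]]
    pd1_eq[OF has_derivative_diff[OF assms[THEN has_derivative_pd]]]
    pd2_eq[OF has_derivative_diff[OF assms[THEN has_derivative_pd]]]
    pd1_eq[OF has_derivative_mult[OF assms[THEN has_derivative_pd]]]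
    pd2_eq[OF has_derivative_mult[OF assms[THEN has_derivative_pd]]]
    pd1_eq[OF has_derivative_divide[OF assms[THEN has_derivative_pd]]]
    pd2_eq[OF has_derivative_divide[OF assms[THEN has_derivative_pd]]]
  by (auto simp: field_simps power2_eq_square)

lemma
  assumes "f differentiable at z"
  shows pd1_cmult: "pd1 (\<lambda>z. c * f z) z = c * pd1 f z" and pd2_cmult: "pd2 (\<lambda>z. c * f z) z = c * pd2 f z"
  using pd1_mult[OF differentiable_const assms, of c] pd2_mult[OF differentiable_const assms, of c] by auto

text \<open>The mean value theorem is used in the first variable and then in the second. The second
  difference itself is symmetric in the variables, so the roles can be exchanged.\<close>

lemma mixed_difference_mvt:
  fixes F F1 F12 :: "real \<Rightarrow> real \<Rightarrow> real"
  assumes "h > 0"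
    and F1: "\<And>t x. t \<in> {a..a+h} \<Longrightarrow> x \<in> {b..b+h} \<Longrightarrow> ((\<lambda>t. F t x) has_real_derivative F1 t x) (at t)"
    and F12: "\<And>t x. t \<in> {a..a+h} \<Longrightarrow> x \<in> {b..b+h} \<Longrightarrow> ((\<lambda>x. F1 t x) has_real_derivative F12 t x) (at x)"
  shows "\<exists>t\<in>{a..a+h}. \<exists>x\<in>{b..b+h}. F (a+h) (b+h) - F (a+h) b - F a (b+h) + F a b = h * h * F12 t x"
proof -
  have "((\<lambda>t. F t (b+h) - F t b) has_real_derivative F1 t (b+h) - F1 t b) (at t)" if "a \<le> t" "t \<le> a+h" for t
    using that \<open>h > 0\<close> by (intro DERIV_diff F1) auto
  with MVT2[of a "a+h" "\<lambda>t. F t (b+h) - F t b" "\<lambda>t. F1 t (b+h) - F1 t b"] \<open>h > 0\<close>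
  obtain t where t: "a < t" "t < a+h"
    "F (a+h) (b+h) - F (a+h) b - (F a (b+h) - F a b) = h * (F1 t (b+h) - F1 t b)" by auto
  with MVT2[of b "b+h" "\<lambda>x. F1 t x" "\<lambda>x. F12 t x"] F12[of t] \<open>h > 0\<close>
  obtain x where "b < x" "x < b+h" "F1 t (b+h) - F1 t b = h * F12 t x" by auto
  with t show ?thesis by (intro bexI[of _ t] bexI[of _ x]) auto
qed

lemma DERIV_pd1:
  assumes "f differentiable at (t, x)"
  shows "((\<lambda>t. f (t, x)) has_real_derivative pd1 f (t, x)) (at t)"
proof -
  have "((\<lambda>t. (t, x)) has_derivative (\<lambda>h. (h, 0))) (at t)" by (auto intro!: derivative_eq_intros)
  from has_derivative_compose[OF this has_derivative_pd[OF assms]]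
  show ?thesis by (simp add: has_field_derivative_def mult_commute_abs)
qed

lemma DERIV_pd2:
  assumes "f differentiable at (t, x)"
  shows "((\<lambda>x. f (t, x)) has_real_derivative pd2 f (t, x)) (at x)"
proof -
  have "((\<lambda>x. (t, x)) has_derivative (\<lambda>h. (0, h))) (at x)" by (intro has_derivative_Pair has_derivative_const has_derivative_ident)
  from has_derivative_compose[OF this has_derivative_pd[OF assms]]
  show ?thesis by (simp add: has_field_derivative_def mult_commute_abs)
qed

text \<open>One and the same second difference equals \<open>h * h\<close> times either mixed
  derivative at some point of a small square; continuity of both at \<open>z\<close> rules out
  different values there.\<close>

lemma pd_commute:
  assumes "open S" "smooth_on S f" "z \<in> S"
  shows "pd1 (pd2 f) z = pd2 (pd1 f) z"
proof (rule ccontr)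
  obtain a b where z: "z = (a, b)" by force
  define e where "e = \<bar>pd1 (pd2 f) z - pd2 (pd1 f) z\<bar> / 2"
  assume "pd1 (pd2 f) z \<noteq> pd2 (pd1 f) z"
  then have "e > 0" by (simp add: e_def)
  have c: "isCont (pd1 (pd2 f)) z" "isCont (pd2 (pd1 f)) z"
    using assms by (auto intro!: continuous_on_interior smooth_on_continuous smooth_on_pd1 smooth_on_pd2
        simp: interior_open)
  obtain d1 where d1: "d1 > 0" "\<And>p. dist p z < d1 \<Longrightarrow> dist (pd1 (pd2 f) p) (pd1 (pd2 f) z) < e"
    using c(1) \<open>e > 0\<close> unfolding continuous_at_eps_delta by blast
  obtain d2 where d2: "d2 > 0" "\<And>p. dist p z < d2 \<Longrightarrow> dist (pd2 (pd1 f) p) (pd2 (pd1 f) z) < e"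
    using c(2) \<open>e > 0\<close> unfolding continuous_at_eps_delta by blast
  obtain d3 where d3: "d3 > 0" "ball z d3 \<subseteq> S" using assms open_contains_ball by blast
  \<comment> \<open>Points of the square with corner \<open>z\<close> and side \<open>h\<close> have
    distance at most \<open>2 * h < 3 * h\<close> from \<open>z\<close>, hence lie within all three
    radii.\<close>
  define h where "h = min d1 (min d2 d3) / 3"
  have h: "h > 0" "3 * h \<le> d1" "3 * h \<le> d2" "3 * h \<le> d3" using d1 d2 d3 by (auto simp: h_def)
  have near: "dist (t, x) z < 3 * h" if "t \<in> {a..a+h}" "x \<in> {b..b+h}" for t x
  proof -
    have "dist (t, x) z \<le> \<bar>t - a\<bar> + \<bar>x - b\<bar>"
      unfolding z dist_Pair_Pair dist_real_def by (rule sqrt_sum_squares_le_sum_abs[THEN order_trans]) simp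
    then show ?thesis using that h(1) by auto
  qed
  then have S: "(t, x) \<in> S" if "t \<in> {a..a+h}" "x \<in> {b..b+h}" for t x
    using d3(2) h(4) that by (force simp: dist_commute)
  note sm = smooth_on_differentiable[OF assms(2)] smooth_on_differentiable[OF smooth_on_pd1[OF assms(2)]]
    smooth_on_differentiable[OF smooth_on_pd2[OF assms(2)]]
  obtain t x where p: "t \<in> {a..a+h}" "x \<in> {b..b+h}"
    "f (a+h, b+h) - f (a+h, b) - f (a, b+h) + f (a, b) = h * h * pd2 (pd1 f) (t, x)"
    using mixed_difference_mvt[of h a b "\<lambda>t x. f (t, x)" "\<lambda>t x. pd1 f (t, x)" "\<lambda>t x. pd2 (pd1 f) (t, x)"]
      DERIV_pd1 DERIV_pd2 sm S h(1) by blast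
  obtain t' x' where q: "t' \<in> {a..a+h}" "x' \<in> {b..b+h}"
    "f (a+h, b+h) - f (a, b+h) - f (a+h, b) + f (a, b) = h * h * pd1 (pd2 f) (t', x')"
    using mixed_difference_mvt[of h b a "\<lambda>x t. f (t, x)" "\<lambda>x t. pd2 f (t, x)" "\<lambda>x t. pd1 (pd2 f) (t, x)"]
      DERIV_pd1 DERIV_pd2 sm S h(1) by blast
  have "h * h * pd2 (pd1 f) (t, x) = h * h * pd1 (pd2 f) (t', x')" using p(3) q(3) by linarith
  then have "pd2 (pd1 f) (t, x) = pd1 (pd2 f) (t', x')" using h(1) by simp
  moreover have "dist (pd2 (pd1 f) (t, x)) (pd2 (pd1 f) z) < e" "dist (pd1 (pd2 f) (t', x')) (pd1 (pd2 f) z) < e"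
    using near[OF p(1,2)] near[OF q(1,2)] h d1(2) d2(2) by auto
  moreover have "2 * e \<le> dist (pd2 (pd1 f) (t, x)) (pd2 (pd1 f) z) + dist (pd2 (pd1 f) (t, x)) (pd1 (pd2 f) z)"
    unfolding e_def dist_real_def by simp
  ultimately show False by simp
qed

section \<open>Inverse functions\<close>

text \<open>The pointwise inverse \<open>K\<close> of the derivative is a parameter so that its
  regularity can be read off from an explicit formula at each use. The derivative of the inverse map
  is \<open>K\<close> at the preimage, a relation to which the bootstrap applies. The neighbourhood
  \<open>U\<close> is fixed before \<open>k\<close>, so that smoothness follows on one and the same
  set.\<close>

lemma inverse_function_Ck:
  fixes f :: "'a::euclidean_space \<Rightarrow> 'a" and K :: "'a \<Rightarrow> 'a \<Rightarrow> 'a"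
  assumes "open S" "x0 \<in> S" "Ck_on 1 S f"
    and K1: "\<And>x h. x \<in> S \<Longrightarrow> frechet_derivative f (at x) (K x h) = h"
    and K2: "\<And>x h. x \<in> S \<Longrightarrow> K x (frechet_derivative f (at x) h) = h"
  obtains U where "open U" "x0 \<in> U" "U \<subseteq> S" "inj_on f U" "open (f ` U)"
    "\<And>k. (\<And>h. Ck_on k S (\<lambda>x. K x h)) \<Longrightarrow> Ck_on (Suc k) (f ` U) (inv_into U f)"
proof -
  let ?f' = "\<lambda>x. Blinfun (frechet_derivative f (at x))"
  have hd: "(f has_derivative frechet_derivative f (at x)) (at x)" if "x \<in> S" for x
    using Ck_on_Suc_has_derivative[of 0] assms(3) that by simp
  then have bl: "bounded_linear (frechet_derivative f (at x))" if "x \<in> S" for x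
    using that has_derivative_bounded_linear by blast
  have ap: "blinfun_apply (?f' x) = frechet_derivative f (at x)" if "x \<in> S" for x
    by (rule bounded_linear_Blinfun_apply[OF bl[OF that]])
  have "linear (K x0)"
  proof (rule linearI)
    fix u v c
    interpret L: bounded_linear "frechet_derivative f (at x0)" by (rule bl[OF assms(2)])
    show "K x0 (u + v) = K x0 u + K x0 v"
      by (metis K1 K2 L.add assms(2))
    show "K x0 (c *\<^sub>R u) = c *\<^sub>R K x0 u"
      by (metis K1 K2 L.scaleR assms(2))
  qed
  then have "bounded_linear (K x0)" by (rule linear_conv_bounded_linear[THEN iffD1])
  then have inv: "Blinfun (K x0) o\<^sub>L ?f' x0 = id_blinfun"
    by (intro blinfun_eqI) (simp add: bounded_linear_Blinfun_apply ap assms(2) K2)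
  have "continuous_on S ?f'"
  proof (rule continuous_on_blinfun_componentwise)
    fix i :: 'a
    have "continuous_on S (\<lambda>x. frechet_derivative f (at x) i)"
      using Ck_on_Suc_frechet[of 0 S f i] assms(3) by simp
    then show "continuous_on S (\<lambda>x. blinfun_apply (?f' x) i)"
      by (simp add: ap cong: continuous_on_cong)
  qed
  from inverse_function_theorem[OF assms(1) _ this assms(2) inv, of f]
  obtain U V g g' where U: "open U" "U \<subseteq> S" "x0 \<in> U" "open V" "homeomorphism U V f g"
    and g: "\<And>y. y \<in> V \<Longrightarrow> (g has_derivative g' y) (at y)"
      "\<And>y. y \<in> V \<Longrightarrow> g' y = inv (blinfun_apply (?f' (g y)))"
    using hd ap by metis
  have V: "f ` U = V" and inj: "inj_on f U" and gU: "g ` V = U"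
    using U(5) unfolding homeomorphism_def by (auto intro: inj_on_inverseI)
  have ig: "inv_into U f y = g y" if "y \<in> V" for y
    using U(5) that inj unfolding homeomorphism_def by (metis imageI inv_into_f_f)
  show thesis
  proof (rule that[OF U(1,3,2) inj])
    show "open (f ` U)" using U V by simp
    fix k assume k: "\<And>h. Ck_on k S (\<lambda>x. K x h)"
    have "Ck_on (Suc k) V g"
    proof (rule Ck_on_bootstrap[of V "UNIV \<times> S" g "\<lambda>p. K (snd p)"])
      fix y assume y: "y \<in> V"
      then have gS: "g y \<in> S" using gU U by auto
      have "g' y = K (g y)" unfolding g(2)[OF y] ap[OF gS]
        by (rule inv_unique_comp) (auto simp: K1 K2 gS)
      then show "(y, g y) \<in> UNIV \<times> S \<and> (g has_derivative K (snd (y, g y))) (at y)" using g(1)[OF y] gS by simp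
    next
      show "Ck_on k (UNIV \<times> S) (\<lambda>p. K (snd p) h)" for h
        by (intro Ck_on_compose[OF _ assms(1) k Ck_on_linear[OF _ bounded_linear_snd]] open_Times open_UNIV assms(1)) auto
    qed (auto intro: U assms open_Times)
    then show "Ck_on (Suc k) (f ` U) (inv_into U f)"
      using Ck_on_cong[OF \<open>open V\<close> ig] V by simp
  qed
qed

lemma plane_inverse_function:
  fixes p q :: "plane \<Rightarrow> real"
  defines "F \<equiv> \<lambda>z. (p z, q z)"
  assumes "open S" "z0 \<in> S" "Ck_on 1 S p" "Ck_on 1 S q"
    and J: "pd1 p z0 * pd2 q z0 - pd2 p z0 * pd1 q z0 \<noteq> 0"
  obtains U where "open U" "z0 \<in> U" "U \<subseteq> S" "inj_on F U" "open (F ` U)"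
    "\<And>z. z \<in> U \<Longrightarrow> pd1 p z * pd2 q z - pd2 p z * pd1 q z \<noteq> 0"
    "\<And>k. Ck_on (Suc k) S p \<Longrightarrow> Ck_on (Suc k) S q \<Longrightarrow> Ck_on (Suc k) (F ` U) (inv_into U F)"
proof -
  define j where "j = (\<lambda>z. pd1 p z * pd2 q z - pd2 p z * pd1 q z)"
  define T where "T = {z \<in> S. j z \<noteq> 0}"
  have pdC: "Ck_on k S (pd1 f) \<and> Ck_on k S (pd2 f)" if "Ck_on (Suc k) S f" for k f
    using Ck_on_Suc_frechet[OF that] unfolding pd1_def[abs_def] pd2_def[abs_def] by auto
  have jC: "Ck_on k S j" if "Ck_on (Suc k) S p" "Ck_on (Suc k) S q" for k
    using pdC[OF that(1)] pdC[OF that(2)] unfolding j_def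
    by (intro Ck_on_diff Ck_on_mult \<open>open S\<close>) auto
  have "open T"
    unfolding T_def using continuous_open_preimage[OF Ck_on_continuous[OF jC, of 0] \<open>open S\<close>, of "- {0}"] assms
    by (auto simp: vimage_def Int_def)
  have T: "T \<subseteq> S" "z0 \<in> T" using assms by (auto simp: T_def j_def)
  \<comment> \<open>Cramer's rule for the Jacobian matrix of \<open>(p, q)\<close>.\<close>
  define K where "K = (\<lambda>z (h :: plane). ((pd2 q z * fst h - pd2 p z * snd h) / j z, (pd1 p z * snd h - pd1 q z * fst h) / j z))"
  have diff: "p differentiable at z" "q differentiable at z" if "z \<in> T" for z
    using that T(1) assms(4,5) by (auto simp: Ck_on.simps(2))
  have DF: "frechet_derivative F (at z) = (\<lambda>h. (fst h * pd1 p z + snd h * pd2 p z, fst h * pd1 q z + snd h * pd2 q z))"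
    if "z \<in> T" for z
    unfolding F_def using diff[OF that] by (intro frechet_derivative_eq has_derivative_Pair has_derivative_pd)
  have "Ck_on 1 T F" unfolding F_def using assms T \<open>open T\<close> by (intro Ck_on_Pair) (auto intro: Ck_on_subset)
  moreover have "frechet_derivative F (at z) (K z h) = h" "K z (frechet_derivative F (at z) h) = h" if "z \<in> T" for z h
    using that unfolding DF[OF that] K_def T_def
    by (cases h; simp add: divide_simps j_def; simp add: algebra_simps)+
  ultimately obtain U where U: "open U" "z0 \<in> U" "U \<subseteq> T" "inj_on F U" "open (F ` U)"
    "\<And>k. (\<And>h. Ck_on k T (\<lambda>x. K x h)) \<Longrightarrow> Ck_on (Suc k) (F ` U) (inv_into U F)"
    using inverse_function_Ck[OF \<open>open T\<close> T(2), of F K] by metis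
  show thesis
  proof (rule that[OF U(1,2) _ U(4,5)])
    show "U \<subseteq> S" using U T by auto
    show "pd1 p z * pd2 q z - pd2 p z * pd1 q z \<noteq> 0" if "z \<in> U" for z
      using that U(3) by (auto simp: T_def j_def)
    fix k assume k: "Ck_on (Suc k) S p" "Ck_on (Suc k) S q"
    have "Ck_on k T (\<lambda>x. K x h)" for h
      unfolding K_def using pdC[OF k(1)] pdC[OF k(2)] jC[OF k] T(1)
      by (intro Ck_on_Pair Ck_on_divide Ck_on_diff Ck_on_mult \<open>open T\<close> Ck_on_const) (auto simp: T_def intro: Ck_on_subset)
    then show "Ck_on (Suc k) (F ` U) (inv_into U F)" by (rule U(6))
  qed
qed

section \<open>Bundle maps\<close>

lemma diffeo_on_inverse_derivative:
  assumes "diffeo_on U f" "z \<in> U"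
  shows "frechet_derivative (inv_into U f) (at (f z)) (frechet_derivative f (at z) h) = h"
    and "frechet_derivative f (at z) (frechet_derivative (inv_into U f) (at (f z)) h) = h"
proof -
  let ?g = "inv_into U f"
  have U: "open U" "inj_on f U" "open (f ` U)" "smooth_on U f" "smooth_on (f ` U) ?g"
    using assms(1) by (auto simp: diffeo_on_def)
  have df: "(f has_derivative frechet_derivative f (at z)) (at z)"
    and dg: "(?g has_derivative frechet_derivative ?g (at (f z))) (at (f z))"
    using U assms(2) by (auto intro!: smooth_on_has_derivative)
  have gf: "?g (f z) = z" using U(2) assms(2) by simp
  have "((\<lambda>x. ?g (f x)) has_derivative (\<lambda>h. h)) (at z)"
    by (rule has_derivative_transform_within_open[OF has_derivative_ident U(1) assms(2)]) (simp add: U(2))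
  from has_derivative_unique[OF has_derivative_compose[OF df dg] this]
  show "frechet_derivative ?g (at (f z)) (frechet_derivative f (at z) h) = h" by metis
  have "((\<lambda>x. f (?g x)) has_derivative (\<lambda>h. h)) (at (f z))"
    by (rule has_derivative_transform_within_open[OF has_derivative_ident U(3) imageI[OF assms(2)]]) (simp add: f_inv_into_f)
  from has_derivative_unique[OF has_derivative_compose[OF dg, of f "frechet_derivative f (at z)"] this] df gf
  show "frechet_derivative f (at z) (frechet_derivative ?g (at (f z)) h) = h" by metis
qed

lemma frechet_derivative_plane_map:
  fixes \<phi> :: "plane \<Rightarrow> plane"
  assumes "\<phi> differentiable at z"
  shows "frechet_derivative \<phi> (at z) h =
    (fst h * pd1 (\<lambda>z. fst (\<phi> z)) z + snd h * pd2 (\<lambda>z. fst (\<phi> z)) z,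
     fst h * pd1 (\<lambda>z. snd (\<phi> z)) z + snd h * pd2 (\<lambda>z. snd (\<phi> z)) z)"
proof -
  have d: "(\<phi> has_derivative frechet_derivative \<phi> (at z)) (at z)"
    using assms frechet_derivative_works by blast
  note e = frechet_derivative_eq[OF has_derivative_fst[OF d]] frechet_derivative_eq[OF has_derivative_snd[OF d]]
  have "(\<lambda>z. fst (\<phi> z)) differentiable at z" "(\<lambda>z. snd (\<phi> z)) differentiable at z"
    using has_derivative_fst[OF d] has_derivative_snd[OF d] differentiableI by blast+
  from this[THEN has_derivative_pd, THEN frechet_derivative_eq] show ?thesis
    unfolding e by (metis prod.collapse)
qed

lemma diffeo_on_jacobian:
  fixes \<phi> :: "plane \<Rightarrow> plane"
  assumes "diffeo_on U \<phi>" "z \<in> U"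
  shows "pd1 (\<lambda>z. fst (\<phi> z)) z * pd2 (\<lambda>z. snd (\<phi> z)) z - pd2 (\<lambda>z. fst (\<phi> z)) z * pd1 (\<lambda>z. snd (\<phi> z)) z \<noteq> 0"
    (is "?p1 * ?q2 - ?p2 * ?q1 \<noteq> 0")
proof
  assume *: "?p1 * ?q2 - ?p2 * ?q1 = 0"
  have "\<phi> differentiable at z"
    using assms by (auto simp: diffeo_on_def intro: smooth_on_differentiable)
  note D = frechet_derivative_plane_map[OF this]
  have "(fst h * ?p1 + snd h * ?p2, fst h * ?q1 + snd h * ?q2) = 0 \<Longrightarrow> h = 0" for h
    using diffeo_on_inverse_derivative(1)[OF assms, of h] diffeo_on_inverse_derivative(1)[OF assms, of 0] D[of h] D[of 0]
    by (metis add.right_neutral fst_zero mult_zero_left snd_zero zero_prod_def)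
  \<comment> \<open>With vanishing determinant both \<open>(?p2, - ?p1)\<close> and
    \<open>(?q2, - ?q1)\<close> lie in the kernel, so all entries of the matrix vanish; then
    \<open>(1, 0)\<close> lies in the kernel as well.\<close>
  from this[of "(?p2, - ?p1)"] this[of "(?q2, - ?q1)"] this[of "(1, 0)"] * show False
    by (auto simp: zero_prod_def algebra_simps)
qed

text \<open>The vertical unit vector has image \<open>(0, pdy \<theta> p)\<close> under the
  derivative of the total map, so injectivity of that derivative forces
  \<open>pdy \<theta> p \<noteq> 0\<close>. The other facts unpack the definition.\<close>

lemma bundle_mapD:
  assumes "bundle_map \<phi> \<theta> U W"
  shows "open W" "W \<subseteq> U \<times> UNIV" "smooth_on W \<theta>" "p \<in> W \<Longrightarrow> pdy \<theta> p \<noteq> 0"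
    and "open U" "inj_on \<phi> U" "open (\<phi> ` U)" "smooth_on U \<phi>" "smooth_on (\<phi> ` U) (inv_into U \<phi>)"
proof -
  let ?F = "\<lambda>(z, y). (\<phi> z, \<theta> (z, y))"
  have F: "diffeo_on W ?F" and \<phi>: "diffeo_on U \<phi>" and sub: "W \<subseteq> U \<times> UNIV"
    using assms by (auto simp: bundle_map_def)
  show W: "open W" "W \<subseteq> U \<times> UNIV" using F sub by (auto simp: diffeo_on_def)
  show U: "open U" "inj_on \<phi> U" "open (\<phi> ` U)" "smooth_on U \<phi>" "smooth_on (\<phi> ` U) (inv_into U \<phi>)"
    using \<phi> by (auto simp: diffeo_on_def)
  have "smooth_on W (\<lambda>p. snd (?F p))"
    using F by (auto simp: diffeo_on_def intro!: smooth_on_snd)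
  then show \<theta>: "smooth_on W \<theta>" by (simp add: case_prod_beta)
  show "pdy \<theta> p \<noteq> 0" if p: "p \<in> W"
  proof
    assume "pdy \<theta> p = 0"
    then have 1: "frechet_derivative \<theta> (at p) (0, 1) = 0" by (simp add: pdy_def zero_prod_def)
    have "((\<lambda>p. (\<phi> (fst p), \<theta> p)) has_derivative (\<lambda>h. (frechet_derivative \<phi> (at (fst p)) (fst h), frechet_derivative \<theta> (at p) h))) (at p)"
      using p sub by (intro has_derivative_Pair smooth_on_has_derivative[OF \<theta>]
        has_derivative_compose[OF has_derivative_fst[OF has_derivative_ident]] smooth_on_has_derivative[OF U(4)]) auto
    then have D: "frechet_derivative ?F (at p) h = (frechet_derivative \<phi> (at (fst p)) (fst h), frechet_derivative \<theta> (at p) h)" for h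
      by (simp add: frechet_derivative_eq case_prod_unfold)
    have "linear (frechet_derivative \<phi> (at (fst p)))" "linear (frechet_derivative \<theta> (at p))"
      using p sub smooth_on_differentiable[OF U(4)] smooth_on_differentiable[OF \<theta>] by (auto intro!: linear_frechet_derivative)
    then have eq: "frechet_derivative ?F (at p) (0, 1) = frechet_derivative ?F (at p) 0"
      unfolding D by (simp add: 1 linear_0)
    note inv = diffeo_on_inverse_derivative(1)[OF F p]
    have "((0::plane), 1::real) = 0"
      using trans[OF sym[OF inv[of "(0, 1)", unfolded eq]] inv[of 0]] .
    then show False by (simp add: zero_prod_def)
  qed
qed

text \<open>Over a diffeomorphism of the base the total derivative is block triangular, so it is
  invertible as soon as its vertical entry \<open>pdy \<theta>\<close> is nonzero.\<close>

lemma bundle_map_exists: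
  assumes \<phi>: "diffeo_on U \<phi>" and "open S" "S \<subseteq> U \<times> UNIV" and \<theta>: "smooth_on S \<theta>"
    and "p0 \<in> S" and \<theta>y: "\<And>p. p \<in> S \<Longrightarrow> pdy \<theta> p \<noteq> 0"
  obtains W where "W \<subseteq> S" "p0 \<in> W" "bundle_map \<phi> \<theta> U W"
proof -
  let ?\<psi> = "inv_into U \<phi>"
  let ?F = "\<lambda>p. (\<phi> (fst p), \<theta> p)"
  define V where "V = (\<lambda>(p :: plane \<times> real) h. frechet_derivative ?\<psi> (at (\<phi> (fst p))) h)"
  \<comment> \<open>Inverse of the block triangular derivative: the base vector is recovered through
    \<open>V\<close>, its contribution to the fiber component is subtracted, and the rest is divided
    by \<open>pdy \<theta>\<close>.\<close>
  define K where "K = (\<lambda>p h. (V p (fst h), (snd h - (fst (V p (fst h)) * pdz1 \<theta> p + snd (V p (fst h)) * pdz2 \<theta> p)) / pdy \<theta> p))"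
  have U: "open U" "inj_on \<phi> U" "open (\<phi> ` U)" "smooth_on U \<phi>" "smooth_on (\<phi> ` U) ?\<psi>"
    using \<phi> by (auto simp: diffeo_on_def)
  have \<phi>S: "smooth_on S (\<lambda>p. \<phi> (fst p))"
    using assms(2,3) by (intro smooth_on_compose[OF _ U(1,4)] smooth_intros) auto
  then have F: "smooth_on S ?F" by (intro smooth_on_Pair \<theta> assms)
  have DF: "frechet_derivative ?F (at p) h = (frechet_derivative \<phi> (at (fst p)) (fst h),
      fst (fst h) * pdz1 \<theta> p + snd (fst h) * pdz2 \<theta> p + snd h * pdy \<theta> p)" if p: "p \<in> S" for p h
    by (subst frechet_derivative_eq[where f' = "\<lambda>h. (frechet_derivative \<phi> (at (fst p)) (fst h),
      fst (fst h) * pdz1 \<theta> p + snd (fst h) * pdz2 \<theta> p + snd h * pdy \<theta> p)"])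
      (use p assms(3) in \<open>auto intro!: has_derivative_Pair has_derivative_pdz smooth_on_differentiable[OF \<theta>]
        has_derivative_compose[OF has_derivative_fst[OF has_derivative_ident]] smooth_on_has_derivative[OF U(4)]\<close>)
  have V: "frechet_derivative \<phi> (at (fst p)) (V p k) = k" "V p (frechet_derivative \<phi> (at (fst p)) k) = k" if "p \<in> S" for p k
  proof -
    have "fst p \<in> U" using that assms(3) by auto
    then show "frechet_derivative \<phi> (at (fst p)) (V p k) = k" "V p (frechet_derivative \<phi> (at (fst p)) k) = k"
      unfolding V_def by (rule diffeo_on_inverse_derivative[OF \<phi>])+
  qed
  have VS: "smooth_on S (\<lambda>p. V p k)" for k
    unfolding V_def using assms(3) by (intro smooth_on_compose[OF assms(2) U(3) smooth_on_frechet[OF U(5)] \<phi>S]) auto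
  have KS: "smooth_on S (\<lambda>p. K p h)" for h
    unfolding K_def by (intro smooth_intros assms VS)
  obtain W where W: "open W" "p0 \<in> W" "W \<subseteq> S" "inj_on ?F W" "open (?F ` W)"
    "\<And>k. (\<And>h. Ck_on k S (\<lambda>x. K x h)) \<Longrightarrow> Ck_on (Suc k) (?F ` W) (inv_into W ?F)"
  proof (rule inverse_function_Ck[OF assms(2,5) smooth_on_Ck[OF F], of K])
    show "frechet_derivative ?F (at p) (K p h) = h" if "p \<in> S" for p h
      unfolding DF[OF that] using \<theta>y[OF that] V[OF that] by (auto simp: K_def)
    show "K p (frechet_derivative ?F (at p) h) = h" if "p \<in> S" for p h
      unfolding DF[OF that] using \<theta>y[OF that] V[OF that] by (auto simp: K_def prod_eq_iff)
  qed blast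
  have "Ck_on (Suc k) (?F ` W) (inv_into W ?F)" for k
    by (rule W(6)) (rule smooth_on_Ck[OF KS])
  then have "smooth_on (?F ` W) (inv_into W ?F)"
    unfolding smooth_on_def using Ck_on_SucD by fast
  with W have "diffeo_on W ?F" using smooth_on_subset[OF F] by (auto simp: diffeo_on_def)
  then have "bundle_map \<phi> \<theta> U W"
    using \<phi> W(3) assms(3) by (auto simp: bundle_map_def case_prod_unfold)
  then show thesis using that W by blast
qed

section \<open>Picard iteration with a parameter\<close>

text \<open>The lower limit of integration is \<open>-e\<close> instead of \<open>0\<close> because integrals over
  \<open>{0..t}\<close> vanish for negative \<open>t\<close>.\<close>

definition primitive :: "real \<Rightarrow> (real \<Rightarrow> 'b::euclidean_space) \<Rightarrow> real \<Rightarrow> 'b" where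
  "primitive e f t = integral {-e..t} f - integral {-e..0} f"

lemma primitive_0 [simp]: "primitive e f 0 = 0"
  by (simp add: primitive_def)

lemma primitive_has_vector_derivative:
  assumes "continuous_on {-e..e} f" "t \<in> {-e..e}"
  shows "(primitive e f has_vector_derivative f t) (at t within {-e..e})"
  unfolding primitive_def[abs_def]
  using has_vector_derivative_diff[OF integral_has_vector_derivative[OF assms] has_vector_derivative_const] by simp

lemma primitive_lipschitz:
  assumes "continuous_on {-e..e} f" "\<And>\<tau>. \<tau> \<in> {-e..e} \<Longrightarrow> norm (f \<tau>) \<le> B" "t \<in> {-e..e}" "t' \<in> {-e..e}"
  shows "norm (primitive e f t - primitive e f t') \<le> B * \<bar>t - t'\<bar>"
  unfolding real_norm_def[symmetric]
proof (rule differentiable_bound[of "{-e..e}" _ "\<lambda>t h. h *\<^sub>R f t"])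
  show "(primitive e f has_derivative (\<lambda>h. h *\<^sub>R f x)) (at x within {-e..e})" if "x \<in> {-e..e}" for x
    using primitive_has_vector_derivative[OF assms(1) that] by (simp add: has_vector_derivative_def)
  show "onorm (\<lambda>h. h *\<^sub>R f x) \<le> B" if "x \<in> {-e..e}" for x
    using assms(2)[OF that] by (intro onorm_le) (use mult_left_mono[OF assms(2)[OF that] abs_ge_zero] in \<open>simp add: mult.commute\<close>)
qed (use assms in auto)

lemma primitive_bound:
  assumes "continuous_on {-e..e} f" "\<And>\<tau>. \<tau> \<in> {-e..e} \<Longrightarrow> norm (f \<tau>) \<le> B" "t \<in> {-e..e}" "B \<ge> 0"
  shows "norm (primitive e f t) \<le> B * e"
proof -
  have "norm (primitive e f t) \<le> B * \<bar>t\<bar>" using primitive_lipschitz[OF assms(1,2,3), of 0] assms(3) by simp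
  also have "\<dots> \<le> B * e" using assms by (intro mult_left_mono) auto
  finally show ?thesis .
qed

lemma primitive_diff:
  assumes "continuous_on {-e..e} f" "continuous_on {-e..e} g" "t \<in> {-e..e}"
  shows "primitive e f t - primitive e g t = primitive e (\<lambda>\<tau>. f \<tau> - g \<tau>) t"
proof -
  have i: "h integrable_on {-e..r}" if "r \<in> {-e..e}" "continuous_on {-e..e} h" for h :: "real \<Rightarrow> 'a" and r
    using that(1) by (intro integrable_continuous_real continuous_on_subset[OF that(2)]) auto
  have "0 \<in> {-e..e}" using assms(3) by auto
  then show ?thesis
    using assms(3) unfolding primitive_def by (simp add: integral_diff[OF i i] assms(1,2))
qed

lemma primitive_linear:
  assumes "continuous_on {-e..e} f" "bounded_linear L" "t \<in> {-e..e}"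
  shows "L (primitive e f t) = primitive e (\<lambda>\<tau>. L (f \<tau>)) t"
proof -
  have i: "f integrable_on {-e..r}" if "r \<in> {-e..e}" for r
    using that by (intro integrable_continuous_real continuous_on_subset[OF assms(1)]) auto
  have "0 \<in> {-e..e}" using assms(3) by auto
  then show ?thesis
    using integral_linear[OF i assms(2)] assms(3)
    unfolding primitive_def by (simp add: o_def linear_diff[OF bounded_linear.linear[OF assms(2)]])
qed

lemma continuous_on_slice:
  assumes "continuous_on (S \<times> T) (\<lambda>p. f (fst p) (snd p))" "s \<in> T"
  shows "continuous_on S (\<lambda>t. f t s)"
proof -
  have "continuous_on S (\<lambda>t. (t, s))" by (intro continuous_intros)
  then have "continuous_on S (\<lambda>t. f (fst (t, s)) (snd (t, s)))"
    by (rule continuous_on_compose2[OF assms(1)]) (use assms(2) in auto)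
  then show ?thesis by simp
qed

text \<open>In time the primitive is Lipschitz with constant \<open>B\<close>, uniformly in the
  parameter; at a fixed time it is continuous in the parameter as a parameter integral. Together
  these give joint continuity.\<close>

lemma primitive_continuous:
  fixes f :: "real \<Rightarrow> real \<Rightarrow> 'b::euclidean_space"
  assumes c: "continuous_on ({-e..e} \<times> {-e..e}) (\<lambda>p. f (fst p) (snd p))"
    and B: "\<And>\<tau> s. \<tau> \<in> {-e..e} \<Longrightarrow> s \<in> {-e..e} \<Longrightarrow> norm (f \<tau> s) \<le> B"
  shows "continuous_on ({-e..e} \<times> {-e..e}) (\<lambda>p. primitive e (\<lambda>\<tau>. f \<tau> (snd p)) (fst p))"
  unfolding continuous_on_def
proof
  let ?E = "{-e..e}"
  fix p0 assume p0: "p0 \<in> ?E \<times> ?E"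
  let ?g = "\<lambda>p. primitive e (\<lambda>\<tau>. f \<tau> (snd p)) (fst p)"
  let ?h = "\<lambda>s. primitive e (\<lambda>\<tau>. f \<tau> s) (fst p0)"
  have "continuous_on ?E (\<lambda>s. integral (cbox (-e) r) (\<lambda>\<tau>. f \<tau> s))" if "r \<in> ?E" for r
  proof (rule integral_continuous_on_param)
    show "continuous_on (?E \<times> cbox (- e) r) (\<lambda>(s, \<tau>). f \<tau> s)"
      using that continuous_on_compose2[OF c, of "?E \<times> cbox (- e) r" prod.swap]
      by (force simp: case_prod_beta prod.swap_def intro!: continuous_intros)
  qed
  from this[of "fst p0"] this[of 0] have "continuous_on ?E ?h"
    using p0 unfolding primitive_def by (force intro!: continuous_intros)
  then have "continuous_on (?E \<times> ?E) (\<lambda>p. ?h (snd p))"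
    by (rule continuous_on_compose2) (auto intro!: continuous_intros)
  then have 1: "((\<lambda>p. ?h (snd p)) \<longlongrightarrow> ?g p0) (at p0 within ?E \<times> ?E)"
    using p0 by (auto simp: continuous_on_def)
  have "((\<lambda>p. ?g p - ?h (snd p)) \<longlongrightarrow> 0) (at p0 within ?E \<times> ?E)"
  proof (rule Lim_null_comparison)
    show "\<forall>\<^sub>F p in at p0 within ?E \<times> ?E. norm (?g p - ?h (snd p)) \<le> B * \<bar>fst p - fst p0\<bar>"
      unfolding eventually_at_filter
      using p0 by (intro always_eventually allI impI primitive_lipschitz continuous_on_slice[OF c] B) auto
    have "((\<lambda>p. B * \<bar>fst p - fst p0\<bar>) \<longlongrightarrow> B * \<bar>fst p0 - fst p0\<bar>) (at p0 within ?E \<times> ?E)"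
      by (intro tendsto_intros)
    then show "((\<lambda>p. B * \<bar>fst p - fst p0\<bar>) \<longlongrightarrow> 0) (at p0 within ?E \<times> ?E)" by simp
  qed
  from tendsto_add[OF this 1] show "(?g \<longlongrightarrow> ?g p0) (at p0 within ?E \<times> ?E)" by simp
qed

text \<open>The curve \<open>\<Gamma>\<close> of initial values makes the parameter \<open>s\<close>
  part of the problem, so that all iterates live on one square and converge uniformly in
  \<open>s\<close>. Initial values stay in the ball of half the radius because the other half, at
  least \<open>M * e\<close>, is left for the motion; \<open>L * e \<le> 1/2\<close> is the
  contraction ratio.\<close>

locale picard =
  fixes H :: "'b::euclidean_space \<Rightarrow> 'b" and \<Gamma> :: "real \<Rightarrow> 'b" and P :: 'b and e R M L :: real
  assumes e: "e > 0" and M0: "M \<ge> 0" and L0: "L \<ge> 0"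
    and \<Gamma>: "continuous_on {-e..e} \<Gamma>" "\<And>s. s \<in> {-e..e} \<Longrightarrow> \<Gamma> s \<in> cball P (R/2)"
    and lip: "\<And>x y. x \<in> cball P R \<Longrightarrow> y \<in> cball P R \<Longrightarrow> norm (H x - H y) \<le> L * norm (x - y)"
    and bound: "\<And>x. x \<in> cball P R \<Longrightarrow> norm (H x) \<le> M"
    and small: "M * e \<le> R / 2" "L * e \<le> 1 / 2"
begin

abbreviation "E \<equiv> {-e..e}"

primrec iter :: "nat \<Rightarrow> real \<Rightarrow> real \<Rightarrow> 'b" where
  "iter 0 t s = \<Gamma> s"
| "iter (Suc n) t s = \<Gamma> s + primitive e (\<lambda>\<tau>. H (iter n \<tau> s)) t"

lemma H_cont: "continuous_on (cball P R) H"
proof (rule continuous_on_iff[THEN iffD2], intro ballI allI impI)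
  fix x and d :: real assume x: "x \<in> cball P R" and d: "0 < d"
  have "dist (H x') (H x) < d" if "x' \<in> cball P R" "dist x' x < d / (L + 1)" for x'
  proof -
    have "dist (H x') (H x) \<le> L * dist x' x" using lip[OF that(1) x] by (simp add: dist_norm)
    also have "\<dots> \<le> (L + 1) * dist x' x" by (simp add: mult_right_mono)
    also have "\<dots> < d" using that(2) L0 by (simp add: pos_less_divide_eq mult.commute)
    finally show ?thesis .
  qed
  then show "\<exists>da>0. \<forall>x'\<in>cball P R. dist x' x < da \<longrightarrow> dist (H x') (H x) < d"
    using d L0 by (intro exI[of _ "d / (L + 1)"]) auto
qed

lemma step_in_ball:
  assumes "continuous_on E (\<lambda>\<tau>. y \<tau>)" "\<And>\<tau>. \<tau> \<in> E \<Longrightarrow> y \<tau> \<in> cball P R" "t \<in> E" "s \<in> E"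
  shows "\<Gamma> s + primitive e (\<lambda>\<tau>. H (y \<tau>)) t \<in> cball P R"
proof -
  have "continuous_on E (\<lambda>\<tau>. H (y \<tau>))"
    using assms by (intro continuous_on_compose2[OF H_cont]) auto
  then have "norm (primitive e (\<lambda>\<tau>. H (y \<tau>)) t) \<le> M * e"
    using assms bound M0 by (intro primitive_bound) auto
  moreover have "norm (\<Gamma> s - P) \<le> R / 2" using \<Gamma>(2)[OF assms(4)] by (simp add: dist_norm norm_minus_commute)
  ultimately have "norm ((\<Gamma> s - P) + primitive e (\<lambda>\<tau>. H (y \<tau>)) t) \<le> R"
    using small by (intro norm_triangle_le) linarith
  then show ?thesis by (simp add: dist_norm norm_minus_commute algebra_simps)
qed

lemma iter_props:
  "continuous_on (E \<times> E) (\<lambda>p. iter n (fst p) (snd p)) \<and> (\<forall>t\<in>E. \<forall>s\<in>E. iter n t s \<in> cball P R)"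
proof (induction n)
  case 0
  have "R / 2 \<le> R" using small(1) M0 e by (smt (verit) field_sum_of_halves mult_nonneg_nonneg)
  then show ?case using \<Gamma> by (force intro!: continuous_on_compose2[OF \<Gamma>(1)] continuous_intros)
next
  case (Suc n)
  have c: "continuous_on (E \<times> E) (\<lambda>p. H (iter n (fst p) (snd p)))"
    using Suc by (intro continuous_on_compose2[OF H_cont]) auto
  have "continuous_on (E \<times> E) (\<lambda>p. \<Gamma> (snd p) + primitive e (\<lambda>\<tau>. H (iter n \<tau> (snd p))) (fst p))"
    using Suc bound by (intro continuous_on_add primitive_continuous[of e "\<lambda>\<tau> s. H (iter n \<tau> s)", OF c, of M]
      continuous_on_compose2[OF \<Gamma>(1)] continuous_intros) auto
  moreover have "\<Gamma> s + primitive e (\<lambda>\<tau>. H (iter n \<tau> s)) t \<in> cball P R" if "t \<in> E" "s \<in> E" for t s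
    using Suc that by (intro step_in_ball continuous_on_slice[of _ _ "iter n"]) auto
  ultimately show ?case by simp
qed

lemmas iter_cont = iter_props[THEN conjunct1]

lemma iter_ball: "t \<in> E \<Longrightarrow> s \<in> E \<Longrightarrow> iter n t s \<in> cball P R"
  by (rule iter_props[THEN conjunct2, THEN bspec, THEN bspec])

lemma H_cont_compose:
  assumes "continuous_on (E \<times> E) (\<lambda>p. y (fst p) (snd p))" "\<And>t s. t \<in> E \<Longrightarrow> s \<in> E \<Longrightarrow> y t s \<in> cball P R" "s \<in> E"
  shows "continuous_on E (\<lambda>\<tau>. H (y \<tau> s))"
proof (rule continuous_on_compose2[OF H_cont])
  show "continuous_on E (\<lambda>\<tau>. y \<tau> s)" by (rule continuous_on_slice[OF assms(1,3)])
  show "(\<lambda>\<tau>. y \<tau> s) ` E \<subseteq> cball P R" by (rule image_subsetI) (rule assms(2)[OF _ assms(3)])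
qed

lemma H_iter_cont: "s \<in> E \<Longrightarrow> continuous_on E (\<lambda>\<tau>. H (iter n \<tau> s))"
  by (rule H_cont_compose[of "iter n", OF iter_cont iter_ball])

text \<open>The first step is at most \<open>M * e \<le> R/2\<close>; each further integration
  multiplies the bound by \<open>L * e \<le> 1/2\<close>.\<close>

lemma iter_diff: "t \<in> E \<Longrightarrow> s \<in> E \<Longrightarrow> norm (iter (Suc n) t s - iter n t s) \<le> R / 2 * (1/2) ^ n"
proof (induction n arbitrary: t)
  case 0
  have "norm (primitive e (\<lambda>\<tau>. H (iter 0 \<tau> s)) t) \<le> M * e"
    using 0 by (intro primitive_bound H_iter_cont bound iter_ball M0)
  then show ?case using small by simp
next
  case (Suc n)
  have R: "R \<ge> 0" using small(1) M0 e by (smt (verit) field_sum_of_halves mult_nonneg_nonneg)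
  have "norm (H (iter (Suc n) \<tau> s) - H (iter n \<tau> s)) \<le> L * (R / 2 * (1/2) ^ n)" if "\<tau> \<in> E" for \<tau>
    using lip[OF iter_ball[OF that Suc.prems(2)] iter_ball[OF that Suc.prems(2)]]
      mult_left_mono[OF Suc.IH[OF that Suc.prems(2)] L0] by (rule order_trans)
  then have "norm (primitive e (\<lambda>\<tau>. H (iter (Suc n) \<tau> s) - H (iter n \<tau> s)) t) \<le> L * (R / 2 * (1/2) ^ n) * e"
    using Suc.prems R L0 by (intro primitive_bound continuous_on_diff H_iter_cont) auto
  also have "\<dots> = (L * e) * (R / 2 * (1/2) ^ n)" by simp
  also have "\<dots> \<le> 1/2 * (R / 2 * (1/2) ^ n)" using small R by (intro mult_right_mono) auto
  finally have "norm (primitive e (\<lambda>\<tau>. H (iter (Suc n) \<tau> s)) t - primitive e (\<lambda>\<tau>. H (iter n \<tau> s)) t) \<le> R / 2 * (1/2) ^ Suc n"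
    using Suc.prems by (subst primitive_diff) (auto intro!: H_iter_cont simp del: iter.simps)
  then show ?case unfolding iter.simps(2)[of "Suc n"] iter.simps(2)[of n t s] by (simp del: iter.simps)
qed

definition "sol t s = lim (\<lambda>n. iter n t s)"

text \<open>Up to the initial value the iterates are partial sums of their differences, which the
  geometric bound dominates uniformly on the square (Weierstrass test).\<close>

lemma iter_uniform_limit: "uniform_limit (E \<times> E) (\<lambda>n p. iter n (fst p) (snd p)) (\<lambda>p. sol (fst p) (snd p)) sequentially"
proof -
  let ?d = "\<lambda>n p. iter (Suc n) (fst p) (snd p) - iter n (fst p) (snd p)"
  have "uniform_limit (E \<times> E) (\<lambda>n p. \<Sum>i<n. ?d i p) (\<lambda>p. suminf (\<lambda>i. ?d i p)) sequentially"
    by (rule Weierstrass_m_test[where M = "\<lambda>n. R / 2 * (1/2) ^ n"])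
      (rule iter_diff, auto intro!: summable_mult summable_geometric)
  moreover have "(\<Sum>i<n. ?d i p) = iter n (fst p) (snd p) - \<Gamma> (snd p)" for n p
    using sum_lessThan_telescope[of "\<lambda>n. iter n (fst p) (snd p)" n] by (simp del: iter.simps(2))
  ultimately have "uniform_limit (E \<times> E) (\<lambda>n p. iter n (fst p) (snd p) - \<Gamma> (snd p)) (\<lambda>p. suminf (\<lambda>i. ?d i p)) sequentially"
    by (simp del: iter.simps)
  from uniform_limit_add[OF this uniform_limit_const, of "\<lambda>p. \<Gamma> (snd p)"]
  have *: "uniform_limit (E \<times> E) (\<lambda>n p. iter n (fst p) (snd p)) (\<lambda>p. suminf (\<lambda>i. ?d i p) + \<Gamma> (snd p)) sequentially"
    by (simp del: iter.simps)
  have "sol (fst p) (snd p) = suminf (\<lambda>i. ?d i p) + \<Gamma> (snd p)" if "p \<in> E \<times> E" for p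
    unfolding sol_def by (rule limI) (rule tendsto_uniform_limitI[OF * that])
  then show ?thesis using * by (simp cong: uniform_limit_cong')
qed

lemma sol_lim: "t \<in> E \<Longrightarrow> s \<in> E \<Longrightarrow> (\<lambda>n. iter n t s) \<longlonglongrightarrow> sol t s"
  using tendsto_uniform_limitI[OF iter_uniform_limit, of "(t, s)"] by (simp only: fst_conv snd_conv mem_Times_iff simp_thms)

lemma sol_cont: "continuous_on (E \<times> E) (\<lambda>p. sol (fst p) (snd p))"
proof (rule uniform_limit_theorem)
  show "\<forall>\<^sub>F n in sequentially. continuous_on (E \<times> E) (\<lambda>p. iter n (fst p) (snd p))"
    by (rule always_eventually) (rule allI, rule iter_cont)
  show "uniform_limit (E \<times> E) (\<lambda>n p. iter n (fst p) (snd p)) (\<lambda>p. sol (fst p) (snd p)) sequentially"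
    by (rule iter_uniform_limit)
qed simp

lemma sol_ball:
  assumes "t \<in> E" "s \<in> E"
  shows "sol t s \<in> cball P R"
proof (rule closed_sequentially)
  show "iter n t s \<in> cball P R" for n by (rule iter_ball[OF assms])
  show "(\<lambda>n. iter n t s) \<longlonglongrightarrow> sol t s" by (rule sol_lim[OF assms])
qed simp

lemma H_sol_cont: "s \<in> E \<Longrightarrow> continuous_on E (\<lambda>\<tau>. H (sol \<tau> s))"
  by (rule H_cont_compose[of sol, OF sol_cont sol_ball])

lemma sol_eq:
  assumes "t \<in> E" "s \<in> E"
  shows "sol t s = \<Gamma> s + primitive e (\<lambda>\<tau>. H (sol \<tau> s)) t"
proof -
  have "(\<lambda>n. primitive e (\<lambda>\<tau>. H (iter n \<tau> s)) t) \<longlonglongrightarrow> primitive e (\<lambda>\<tau>. H (sol \<tau> s)) t"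
  proof (rule metric_LIMSEQ_I)
    fix r :: real assume "r > 0"
    with uniform_limitD[OF iter_uniform_limit, of r]
    obtain N where N: "\<And>n p. n \<ge> N \<Longrightarrow> p \<in> E \<times> E \<Longrightarrow> dist (iter n (fst p) (snd p)) (sol (fst p) (snd p)) < r"
      unfolding eventually_sequentially by blast
    have "dist (primitive e (\<lambda>\<tau>. H (iter n \<tau> s)) t) (primitive e (\<lambda>\<tau>. H (sol \<tau> s)) t) < r" if "n \<ge> N" for n
    proof -
      have "norm (H (iter n \<tau> s) - H (sol \<tau> s)) \<le> L * r" if "\<tau> \<in> E" for \<tau>
      proof -
        have "norm (iter n \<tau> s - sol \<tau> s) \<le> r" using N[OF \<open>n \<ge> N\<close>, of "(\<tau>, s)"] that assms by (simp add: dist_norm)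
        from mult_left_mono[OF this L0] show ?thesis
          using lip[OF iter_ball[OF that assms(2)] sol_ball[OF that assms(2)]] by (meson order_trans)
      qed
      then have "norm (primitive e (\<lambda>\<tau>. H (iter n \<tau> s) - H (sol \<tau> s)) t) \<le> L * r * e"
        using assms \<open>r > 0\<close> L0 by (intro primitive_bound continuous_on_diff H_iter_cont H_sol_cont) auto
      also have "\<dots> = L * e * r" by simp
      also have "\<dots> \<le> 1/2 * r" using small \<open>r > 0\<close> by (intro mult_right_mono) auto
      also have "\<dots> < r" using \<open>r > 0\<close> by simp
      finally show ?thesis using assms by (simp add: dist_norm primitive_diff H_iter_cont H_sol_cont del: iter.simps)
    qed
    then show "\<exists>N. \<forall>n\<ge>N. dist (primitive e (\<lambda>\<tau>. H (iter n \<tau> s)) t) (primitive e (\<lambda>\<tau>. H (sol \<tau> s)) t) < r" by blast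
  qed
  then have "(\<lambda>n. iter (Suc n) t s) \<longlonglongrightarrow> \<Gamma> s + primitive e (\<lambda>\<tau>. H (sol \<tau> s)) t"
    by (simp add: tendsto_add)
  with LIMSEQ_Suc[OF sol_lim[OF assms]] show ?thesis by (rule LIMSEQ_unique)
qed

lemma sol_derivative:
  assumes "t \<in> E" "s \<in> E"
  shows "((\<lambda>t. sol t s) has_vector_derivative H (sol t s)) (at t within E)"
proof -
  have "((\<lambda>t. \<Gamma> s + primitive e (\<lambda>\<tau>. H (sol \<tau> s)) t) has_vector_derivative H (sol t s)) (at t within E)"
    using has_vector_derivative_add[OF has_vector_derivative_const[of "\<Gamma> s"]
        primitive_has_vector_derivative[OF H_sol_cont[OF assms(2)] assms(1)]] by (simp only: add_0_left)
  then show ?thesis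
    by (rule has_vector_derivative_transform[where f = "\<lambda>t. \<Gamma> s + primitive e (\<lambda>\<tau>. H (sol \<tau> s)) t", OF assms(1), rotated])
      (rule sol_eq[OF _ assms(2)])
qed

end

section \<open>Flowing a curve along a vector field\<close>

text \<open>The class \<open>C^1\<close> bounds the derivative separately in each basis direction;
  the sum of these bounds controls the operator norm, and convexity of the ball turns this into a
  Lipschitz constant.\<close>

lemma Ck_on_1_lipschitz:
  fixes f :: "'a::euclidean_space \<Rightarrow> 'b::real_normed_vector"
  assumes "Ck_on 1 S f" "cball p r \<subseteq> S"
  shows "\<exists>L\<ge>0. \<forall>x\<in>cball p r. \<forall>y\<in>cball p r. norm (f x - f y) \<le> L * norm (x - y)"
proof -
  have "bounded ((\<lambda>x. frechet_derivative f (at x) b) ` cball p r)" for b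
    using Ck_on_Suc_frechet[of 0 S f b] assms
    by (intro compact_imp_bounded compact_continuous_image) (auto intro: continuous_on_subset)
  then have "\<exists>B. \<forall>x\<in>cball p r. norm (frechet_derivative f (at x) b) \<le> B" for b
    unfolding bounded_iff by blast
  then obtain B where B: "\<And>b x. x \<in> cball p r \<Longrightarrow> norm (frechet_derivative f (at x) b) \<le> B b" by metis
  define L where "L = (\<Sum>b\<in>Basis. \<bar>B b\<bar>)"
  have *: "norm (f x - f y) \<le> L * norm (x - y)" if xy: "x \<in> cball p r" "y \<in> cball p r" for x y
  proof (rule differentiable_bound[of "cball p r" f "\<lambda>x. frechet_derivative f (at x)"])
    fix x assume x: "x \<in> cball p r"
    then have "x \<in> S" using assms(2) by blast
    then have d: "(f has_derivative frechet_derivative f (at x)) (at x)"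
      using Ck_on_Suc_has_derivative[of 0 S f x] assms(1) by simp
    then show "(f has_derivative frechet_derivative f (at x)) (at x within cball p r)"
      by (rule has_derivative_at_withinI)
    have lin: "linear (frechet_derivative f (at x))"
      using d has_derivative_bounded_linear bounded_linear.linear by blast
    show "onorm (frechet_derivative f (at x)) \<le> L"
    proof (rule onorm_le)
      fix h
      have "frechet_derivative f (at x) h = frechet_derivative f (at x) (\<Sum>b\<in>Basis. (h \<bullet> b) *\<^sub>R b)"
        by (simp add: euclidean_representation)
      also have "norm \<dots> \<le> (\<Sum>b\<in>Basis. \<bar>h \<bullet> b\<bar> * norm (frechet_derivative f (at x) b))"
        by (simp add: linear_sum[OF lin] linear_scale[OF lin] sum_norm_le)
      also have "\<dots> \<le> (\<Sum>b\<in>Basis. norm h * \<bar>B b\<bar>)"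
        using B[OF x] by (intro sum_mono mult_mono Basis_le_norm) (auto intro: order_trans[OF _ abs_ge_self])
      also have "\<dots> = L * norm h" by (simp add: L_def sum_distrib_left mult.commute)
      finally show "norm (frechet_derivative f (at x) h) \<le> L * norm h" .
    qed
  qed (use xy in auto)
  have "0 \<le> L" unfolding L_def by (intro sum_nonneg) auto
  with * show ?thesis by blast
qed

text \<open>Besides the flow \<open>Z\<close> of the curve \<open>\<gamma>\<close> along
  \<open>G\<close>, its variation \<open>V\<close> in the curve parameter is wanted. The pair solves
  the autonomous system \<open>(z, v)' = (G z, DG(z) v)\<close> with initial value
  \<open>(\<gamma>, \<gamma>')\<close>. For \<open>G\<close> of class \<open>C^2\<close> the
  right-hand side is \<open>C^1\<close>, hence locally Lipschitz, and Picard iteration applies to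
  the pair. Differentiability of \<open>Z\<close> in the parameter is inherited from the
  iterates.\<close>

lemma flow_out:
  fixes G :: "'a::euclidean_space \<Rightarrow> 'a" and \<gamma> :: "real \<Rightarrow> 'a"
  assumes S: "open S" and G: "Ck_on 2 S G" and \<gamma>0: "\<gamma> 0 \<in> S" and a: "a > 0"
    and \<gamma>: "\<And>s. \<bar>s\<bar> < a \<Longrightarrow> (\<gamma> has_vector_derivative \<gamma>' s) (at s)" and \<gamma>': "continuous_on {-a<..<a} \<gamma>'"
  obtains e Z V where "e > 0" "e < a"
    "\<And>p. p \<in> {-e<..<e} \<times> {-e<..<e} \<Longrightarrow> Z p \<in> S"
    "\<And>s. \<bar>s\<bar> < e \<Longrightarrow> Z (0, s) = \<gamma> s" "\<And>s. \<bar>s\<bar> < e \<Longrightarrow> V (0, s) = \<gamma>' s"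
    "\<And>p. p \<in> {-e<..<e} \<times> {-e<..<e} \<Longrightarrow>
      (Z has_derivative (\<lambda>h. fst h *\<^sub>R G (Z p) + snd h *\<^sub>R V p)) (at p)"
    "\<And>t s. \<bar>t\<bar> < e \<Longrightarrow> \<bar>s\<bar> < e \<Longrightarrow>
      ((\<lambda>t. V (t, s)) has_vector_derivative frechet_derivative G (at (Z (t, s))) (V (t, s))) (at t)"
    "continuous_on ({-e<..<e} \<times> {-e<..<e}) V"
proof -
  define DG where "DG = (\<lambda>x. frechet_derivative G (at x))"
  define H where "H = (\<lambda>p. (G (fst p), DG (fst p) (snd p)))"
  define \<Gamma> where "\<Gamma> = (\<lambda>s. (\<gamma> s, \<gamma>' s))"
  have Hsel: "fst (H p) = G (fst p)" "snd (H p) = DG (fst p) (snd p)" for p by (simp_all add: H_def)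
  have \<Gamma>sel: "fst (\<Gamma> s) = \<gamma> s" "snd (\<Gamma> s) = \<gamma>' s" for s by (simp_all add: \<Gamma>_def)
  let ?S = "S \<times> (UNIV :: 'a set)"
  have oS: "open ?S" using S by (intro open_Times) auto
  have G1: "Ck_on (Suc 1) S G" using G by (simp add: numeral_2_eq_2)
  have DGb: "(G has_derivative DG x) (at x)" if "x \<in> S" for x
    unfolding DG_def by (rule Ck_on_Suc_has_derivative[OF G1 that])
  have H1: "Ck_on 1 ?S H"
  proof -
    have fst1: "Ck_on 1 ?S (\<lambda>p. f (fst p))" if "Ck_on 1 S f" for f :: "'a \<Rightarrow> 'a"
      by (rule Ck_on_compose[OF oS S that Ck_on_linear[OF oS bounded_linear_fst]]) auto
    have *: "Ck_on 1 ?S (\<lambda>p. \<Sum>b\<in>Basis. (snd p \<bullet> b) *\<^sub>R DG (fst p) b)"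
      unfolding DG_def
      by (intro Ck_on_sum[OF oS] Ck_on_scaleR[OF oS Ck_on_linear[OF oS]] fst1[OF Ck_on_Suc_frechet[OF G1]]
        bounded_linear_compose[OF bounded_linear_inner_left bounded_linear_snd])
    have eq: "DG (fst p) (snd p) = (\<Sum>b\<in>Basis. (snd p \<bullet> b) *\<^sub>R DG (fst p) b)" if "p \<in> ?S" for p :: "'a \<times> 'a"
    proof -
      have lin: "linear (DG (fst p))" using DGb[of "fst p"] that by (auto dest: has_derivative_linear)
      have "DG (fst p) (snd p) = DG (fst p) (\<Sum>b\<in>Basis. (snd p \<bullet> b) *\<^sub>R b)" by (simp add: euclidean_representation)
      then show ?thesis by (simp add: linear_sum[OF lin] linear_scale[OF lin])
    qed
    have "Ck_on 1 ?S (\<lambda>p. DG (fst p) (snd p)) \<longleftrightarrow> Ck_on 1 ?S (\<lambda>p. \<Sum>b\<in>Basis. (snd p \<bullet> b) *\<^sub>R DG (fst p) b)"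
      by (rule Ck_on_cong[OF oS]) (rule eq)
    then have "Ck_on 1 ?S (\<lambda>p. DG (fst p) (snd p))" using * by simp
    then show ?thesis unfolding H_def by (intro Ck_on_Pair[OF oS] fst1 Ck_on_SucD[OF G1])
  qed
  have "\<Gamma> 0 \<in> ?S" using \<gamma>0 by (simp add: \<Gamma>_def)
  from open_contains_cball[THEN iffD1, OF oS, rule_format, OF this]
  obtain R where R: "R > 0" "cball (\<Gamma> 0) R \<subseteq> ?S" by (elim exE conjE)
  obtain L where L: "L \<ge> 0" "\<And>x y. x \<in> cball (\<Gamma> 0) R \<Longrightarrow> y \<in> cball (\<Gamma> 0) R \<Longrightarrow> norm (H x - H y) \<le> L * norm (x - y)"
    using Ck_on_1_lipschitz[OF H1 R(2)] by (elim exE conjE) (simp del: mem_cball)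
  have "bounded (H ` cball (\<Gamma> 0) R)"
    using R(2) by (intro compact_imp_bounded compact_continuous_image continuous_on_subset[OF Ck_on_continuous[OF H1]]) auto
  then obtain M where M: "M > 0" "\<And>x. x \<in> cball (\<Gamma> 0) R \<Longrightarrow> norm (H x) \<le> M"
    unfolding bounded_pos by (auto simp del: mem_cball)
  have \<Gamma>c: "continuous_on {-a<..<a} \<Gamma>"
    unfolding \<Gamma>_def using has_vector_derivative_continuous[OF \<gamma>]
    by (intro continuous_on_Pair \<gamma>' continuous_at_imp_continuous_on) auto
  then have "isCont \<Gamma> 0" using a by (intro continuous_on_interior) auto
  then obtain d where d: "d > 0" "\<And>s. \<bar>s\<bar> < d \<Longrightarrow> dist (\<Gamma> s) (\<Gamma> 0) < R / 2"
    using R(1) unfolding continuous_at_eps_delta by (auto simp: dist_real_def dest: spec[of _ "R / 2"])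
  \<comment> \<open>\<open>a/2\<close> keeps the parameter inside the domain of
    \<open>\<gamma>\<close>, \<open>d/2\<close> keeps the initial values in the half ball, and the
    last two bounds give \<open>M * e \<le> R/2\<close> and \<open>L * e \<le> 1/2\<close>;
    \<open>L + 1\<close> replaces \<open>L\<close>, which may be zero.\<close>
  define e where "e = min (min (a/2) (d/2)) (min (R / (2 * M)) (1 / (2 * (L + 1))))"
  have eps: "e > 0" "e < a" "e < d" "e \<le> R / (2 * M)" "e \<le> 1 / (2 * (L + 1))"
    using a d R M L by (auto simp: e_def)
  have Le: "L * e \<le> 1/2"
  proof -
    have "L * e \<le> (L + 1) * e" using eps by simp
    also have "\<dots> \<le> 1/2" using eps(5) L(1) by (simp add: field_simps)
    finally show ?thesis .
  qed
  have Me: "M * e \<le> R / 2" using eps(4) M(1) by (simp add: field_simps)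
  have \<Gamma>e: "continuous_on {-e..e} \<Gamma>" using eps by (intro continuous_on_subset[OF \<Gamma>c]) auto
  interpret picard H \<Gamma> "\<Gamma> 0" e R M L
    using eps L M Le Me \<Gamma>e d(2) by unfold_locales (auto simp: dist_commute less_imp_le)
  have iterS: "iter n t s \<in> ?S" if "t \<in> E" "s \<in> E" for n t s
    using iter_ball[OF that] R(2) by blast
  \<comment> \<open>In every iterate the second component is the \<open>s\<close>-derivative of the
    first. This holds for the initial curve, and differentiation under the integral sign carries it
    through one step, because \<open>DG\<close> applied to the second component is the
    \<open>s\<close>-derivative of \<open>G\<close> at the first.\<close>
  have tangent: "((\<lambda>s. fst (iter n t s)) has_vector_derivative snd (iter n t s)) (at s within E)" if "t \<in> E" "s \<in> E" for n t s
    using that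
  proof (induction n arbitrary: t s)
    case 0
    then show ?case using \<gamma>[of s] eps by (auto simp: \<Gamma>sel abs_less_iff intro: has_vector_derivative_at_within)
  next
    case (Suc n)
    let ?f = "\<lambda>s \<tau>. G (fst (iter n \<tau> s))" and ?df = "\<lambda>s \<tau>. DG (fst (iter n \<tau> s)) (snd (iter n \<tau> s))"
    have der: "((\<lambda>s. ?f s \<tau>) has_vector_derivative ?df s \<tau>) (at s within E)" if "\<tau> \<in> E" "s \<in> E" for \<tau> s
    proof -
      have z: "fst (iter n \<tau> s) \<in> S" using iterS[OF that] by (simp add: mem_Times_iff)
      from has_derivative_compose[OF Suc.IH[OF that, unfolded has_vector_derivative_def] DGb[OF z]]
      show ?thesis
        unfolding has_vector_derivative_def by (simp add: linear_scale[OF has_derivative_linear[OF DGb[OF z]]])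
    qed
    have Hc: "continuous_on (E \<times> E) (\<lambda>p. H (iter n (fst p) (snd p)))"
      by (rule continuous_on_compose2[OF H_cont iter_cont]) (auto intro!: iter_ball simp del: mem_cball)
    have dfc: "continuous_on (E \<times> cbox (-e) r) (\<lambda>(s, \<tau>). ?df s \<tau>)" if "r \<in> E" for r
    proof -
      have "continuous_on (E \<times> cbox (-e) r) (\<lambda>q. H (iter n (fst (snd q, fst q)) (snd (snd q, fst q))))"
        by (rule continuous_on_compose2[OF Hc]) (use that in \<open>auto intro!: continuous_intros\<close>)
      from continuous_on_snd[OF this]
      show ?thesis by (simp add: Hsel case_prod_unfold)
    qed
    have fint: "?f s integrable_on cbox (-e) r" if "r \<in> E" "s \<in> E" for r s
    proof -
      have "continuous_on E (\<lambda>\<tau>. fst (H (iter n \<tau> s)))" by (rule continuous_on_fst[OF H_iter_cont[OF that(2)]])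
      then have "continuous_on {-e..r} (?f s)" using that(1) by (auto simp: Hsel elim: continuous_on_subset)
      then show ?thesis by (simp add: integrable_continuous_real)
    qed
    have leib: "((\<lambda>s. integral (cbox (-e) r) (?f s)) has_vector_derivative integral (cbox (-e) r) (?df s)) (at s within E)" if "r \<in> E" for r
      by (rule leibniz_rule_vector_derivative) (use that der fint dfc Suc.prems in auto)
    have "0 \<in> E" using eps by simp
    have D: "((\<lambda>s. \<gamma> s + primitive e (?f s) t) has_vector_derivative \<gamma>' s + primitive e (?df s) t) (at s within E)"
      unfolding primitive_def
      using leib[OF \<open>t \<in> E\<close>] leib[OF \<open>0 \<in> E\<close>] \<gamma>[of s] Suc.prems eps
      by (intro has_vector_derivative_add has_vector_derivative_diff) (auto intro: has_vector_derivative_at_within)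
    have E1: "fst (iter (Suc n) t s) = \<gamma> s + primitive e (?f s) t" if "s \<in> E" for s
      using primitive_linear[OF H_iter_cont[OF that, of n] bounded_linear_fst \<open>t \<in> E\<close>] by (simp add: \<Gamma>sel Hsel)
    have E2: "snd (iter (Suc n) t s) = \<gamma>' s + primitive e (?df s) t"
      using primitive_linear[OF H_iter_cont[OF Suc.prems(2), of n] bounded_linear_snd \<open>t \<in> E\<close>] by (simp add: \<Gamma>sel Hsel)
    show ?case
      unfolding E2
      by (rule has_vector_derivative_transform[where g = "\<lambda>s. fst (iter (Suc n) t s)", OF Suc.prems(2) E1 D])
  qed
  \<comment> \<open>Uniform convergence of the second components allows passing to the limit in the
    derivatives of the first.\<close>
  have sol_tangent: "((\<lambda>s. fst (sol t s)) has_vector_derivative snd (sol t s)) (at s within E)" if ts: "t \<in> E" "s \<in> E" for t s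
  proof -
    have "\<exists>g. \<forall>s\<in>E. (\<lambda>n. fst (iter n t s)) \<longlonglongrightarrow> g s \<and> (g has_derivative (\<lambda>h. h *\<^sub>R snd (sol t s))) (at s within E)"
    proof (rule has_derivative_sequence[where f' = "\<lambda>n s h. h *\<^sub>R snd (iter n t s)"])
      show "((\<lambda>s. fst (iter n t s)) has_derivative (\<lambda>h. h *\<^sub>R snd (iter n t s))) (at s within E)" if "s \<in> E" for n s
        using tangent[OF ts(1) that] by (simp add: has_vector_derivative_def)
      show "\<forall>\<^sub>F n in sequentially. \<forall>s\<in>E. \<forall>h. norm (h *\<^sub>R snd (iter n t s) - h *\<^sub>R snd (sol t s)) \<le> r * norm h" if "r > 0" for r
      proof -
        from uniform_limitD[OF iter_uniform_limit that] show ?thesis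
        proof eventually_elim
          case (elim n)
          show ?case
          proof (intro ballI allI)
            fix s h assume "s \<in> E"
            then have "dist (iter n t s) (sol t s) < r" using elim ts(1) by (auto dest: bspec[of _ _ "(t, s)"])
            then have "norm (snd (iter n t s) - snd (sol t s)) \<le> r"
              using dist_snd_le[of "iter n t s" "sol t s"] by (simp add: dist_norm)
            then show "norm (h *\<^sub>R snd (iter n t s) - h *\<^sub>R snd (sol t s)) \<le> r * norm h"
              unfolding scaleR_diff_right[symmetric] norm_scaleR real_norm_def
              by (subst mult.commute) (rule mult_right_mono, auto)
          qed
        qed
      qed
      show "(\<lambda>n. fst (iter n t s)) \<longlonglongrightarrow> fst (sol t s)" by (rule tendsto_fst[OF sol_lim[OF ts]])
    qed (use ts in auto)
    then obtain g where g: "\<And>s. s \<in> E \<Longrightarrow> (\<lambda>n. fst (iter n t s)) \<longlonglongrightarrow> g s"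
      "\<And>s. s \<in> E \<Longrightarrow> (g has_derivative (\<lambda>h. h *\<^sub>R snd (sol t s))) (at s within E)" by blast
    have eq: "fst (sol t s) = g s" if "s \<in> E" for s
      by (rule LIMSEQ_unique[OF tendsto_fst[OF sol_lim[OF ts(1) that]] g(1)[OF that]])
    show ?thesis
      unfolding has_vector_derivative_def
      by (rule has_derivative_transform[where g = "\<lambda>s. fst (sol t s)", OF ts(2) eq g(2)[OF ts(2)]])
  qed
  define I where "I = {-e<..<e}"
  have IE: "open I" "I \<subseteq> E" "convex I" by (auto simp: I_def)
  have inE: "x \<in> E" if "x \<in> I" for x using that by (simp add: I_def)
  have at_I: "at x within E = at x" if "x \<in> I" for x
    using that by (intro at_within_interior) (simp add: I_def)
  define Z where "Z = (\<lambda>p. fst (sol (fst p) (snd p)))"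
  define V where "V = (\<lambda>p. snd (sol (fst p) (snd p)))"
  have Vc: "continuous_on (I \<times> I) V"
    unfolding V_def using IE by (intro continuous_on_snd continuous_on_subset[OF sol_cont]) auto
  have HZV: "H (sol t s) = (G (Z (t, s)), DG (Z (t, s)) (V (t, s)))" for t s
    by (simp add: prod_eq_iff Hsel Z_def V_def)
  have solD: "((\<lambda>t. sol t s) has_vector_derivative (G (Z (t, s)), DG (Z (t, s)) (V (t, s)))) (at t)" if "t \<in> I" "s \<in> I" for t s
    using sol_derivative[OF inE[OF that(1)] inE[OF that(2)]] by (simp only: HZV at_I[OF that(1)])
  have ZD: "((\<lambda>t. Z (t, s)) has_vector_derivative G (Z (t, s))) (at t)" if "t \<in> I" "s \<in> I" for t s
    using has_derivative_fst[OF solD[OF that, unfolded has_vector_derivative_def]]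
    unfolding has_vector_derivative_def by (simp add: Z_def)
  have VD: "((\<lambda>t. V (t, s)) has_vector_derivative DG (Z (t, s)) (V (t, s))) (at t)" if "t \<in> I" "s \<in> I" for t s
    using has_derivative_snd[OF solD[OF that, unfolded has_vector_derivative_def]]
    unfolding has_vector_derivative_def by (simp add: V_def)
  have ZV: "((\<lambda>s. Z (t, s)) has_derivative (\<lambda>h. h *\<^sub>R V (t, s))) (at s)" if "t \<in> I" "s \<in> I" for t s
    using sol_tangent[OF inE[OF that(1)] inE[OF that(2)]]
    unfolding has_vector_derivative_def by (simp add: at_I[OF that(2)] Z_def V_def)
  \<comment> \<open>Both partial derivatives exist and the one in \<open>s\<close> is jointly
    continuous; this already gives total differentiability.\<close>
  have Z_der: "(Z has_derivative (\<lambda>h. fst h *\<^sub>R G (Z p) + snd h *\<^sub>R V p)) (at p)" if "p \<in> I \<times> I" for p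
  proof -
    obtain t s where p: "p = (t, s)" "t \<in> I" "s \<in> I" using \<open>p \<in> I \<times> I\<close> by auto
    have "((\<lambda>(t, s). Z (t, s)) has_derivative (\<lambda>(h, k). h *\<^sub>R G (Z (t, s)) + blinfun_scaleR_left (V (t, s)) k)) (at (t, s) within I \<times> I)"
    proof (rule has_derivative_partialsI[where fy = "\<lambda>t s. blinfun_scaleR_left (V (t, s))"])
      show "((\<lambda>t. Z (t, s)) has_derivative (\<lambda>h. h *\<^sub>R G (Z (t, s)))) (at t within I)"
        using ZD[OF p(2,3)] has_derivative_at_withinI unfolding has_vector_derivative_def by blast
      show "((\<lambda>s. Z (t, s)) has_derivative blinfun_apply (blinfun_scaleR_left (V (t, s)))) (at s within I)" if "t \<in> I" "s \<in> I" for t s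
        using ZV[OF that] has_derivative_at_withinI by (simp add: blinfun_scaleR_left.rep_eq) blast
      have "continuous_on (I \<times> I) (\<lambda>p. blinfun_scaleR_left (V p))"
        by (intro continuous_on_blinfun_componentwise) (auto intro!: continuous_intros Vc)
      then show "continuous (at (t, s) within I \<times> I) (\<lambda>(t, s). blinfun_scaleR_left (V (t, s)))"
        using p by (auto simp: continuous_on_eq_continuous_within case_prod_unfold)
    qed (use p IE in auto)
    moreover have "at (t, s) within I \<times> I = at (t, s)"
      using p IE by (intro at_within_open open_Times) auto
    ultimately show ?thesis by (simp add: p case_prod_unfold)
  qed
  show thesis
  proof (rule that[of e Z V])
    show "Z p \<in> S" if "p \<in> {-e<..<e} \<times> {-e<..<e}" for p
    proof -
      have "sol (fst p) (snd p) \<in> cball (\<Gamma> 0) R" using that by (intro sol_ball) auto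
      then show ?thesis using R(2) by (auto simp: Z_def mem_Times_iff)
    qed
    have "0 \<in> E" using eps by simp
    have "sol 0 s = \<Gamma> s" if "\<bar>s\<bar> < e" for s
      using sol_eq[OF \<open>0 \<in> E\<close>, of s] that by (simp add: abs_less_iff)
    then show "Z (0, s) = \<gamma> s" "V (0, s) = \<gamma>' s" if "\<bar>s\<bar> < e" for s
      using that by (simp_all add: Z_def V_def \<Gamma>sel)
    show "(Z has_derivative (\<lambda>h. fst h *\<^sub>R G (Z p) + snd h *\<^sub>R V p)) (at p)"
      if "p \<in> {-e<..<e} \<times> {-e<..<e}" for p using Z_der that unfolding I_def .
    show "((\<lambda>t. V (t, s)) has_vector_derivative frechet_derivative G (at (Z (t, s))) (V (t, s))) (at t)"
      if "\<bar>t\<bar> < e" "\<bar>s\<bar> < e" for t s using VD[of t s] that by (simp add: I_def DG_def abs_less_iff)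
    show "continuous_on ({-e<..<e} \<times> {-e<..<e}) V" using Vc unfolding I_def .
  qed (use eps in auto)
qed

text \<open>Method of characteristics with a straight initial line, which runs in the base direction
  \<open>(e1, e2)\<close> with slope \<open>q\<close>, so that the derivative in this direction is
  prescribed. The determinant in the hypothesis is the Jacobian at the origin of the base projection
  of the flow-out; being nonzero, it makes the flow-out a graph.\<close>

lemma quasilinear_local_solution:
  assumes S: "open S" "(z, y) \<in> S" and X: "Ck_on 2 S X1" "Ck_on 2 S X2" "Ck_on 2 S X3"
    and e: "X1 (z, y) * e2 - X2 (z, y) * e1 \<noteq> 0"
  obtains D v where "z \<in> D" "graph_in S D v" "v z = y" "classical_solution (quasilinear_eq X1 X2 X3) D v"
    "e1 * pd1 v z + e2 * pd2 v z = q"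
proof -
  define G where "G = (\<lambda>p. ((X1 p, X2 p), X3 p))"
  define \<gamma> where "\<gamma> = (\<lambda>s. ((fst z + s * e1, snd z + s * e2), y + s * q))"
  have G2: "Ck_on 2 S G" unfolding G_def by (intro Ck_on_Pair S X)
  have \<gamma>0: "\<gamma> 0 = (z, y)" by (simp add: \<gamma>_def)
  have \<gamma>D: "(\<gamma> has_vector_derivative ((e1, e2), q)) (at s)" for s
    unfolding \<gamma>_def has_vector_derivative_def
    by (auto intro!: derivative_eq_intros)
  obtain \<epsilon> Z V where \<epsilon>: "\<epsilon> > 0" "\<epsilon> < 1"
    and ZS: "\<And>p. p \<in> {-\<epsilon><..<\<epsilon>} \<times> {-\<epsilon><..<\<epsilon>} \<Longrightarrow> Z p \<in> S"
    and Z0: "\<And>s. \<bar>s\<bar> < \<epsilon> \<Longrightarrow> Z (0, s) = \<gamma> s" "\<And>s. \<bar>s\<bar> < \<epsilon> \<Longrightarrow> V (0, s) = ((e1, e2), q)"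
    and ZD: "\<And>p. p \<in> {-\<epsilon><..<\<epsilon>} \<times> {-\<epsilon><..<\<epsilon>} \<Longrightarrow>
      (Z has_derivative (\<lambda>h. fst h *\<^sub>R G (Z p) + snd h *\<^sub>R V p)) (at p)"
    and Vc: "continuous_on ({-\<epsilon><..<\<epsilon>} \<times> {-\<epsilon><..<\<epsilon>}) V"
    by (rule flow_out[of S G \<gamma> 1 "\<lambda>_. ((e1, e2), q)", OF S(1) G2 _ zero_less_one \<gamma>D continuous_on_const])
      (use S(2) \<gamma>0 in simp, rule that)
  define B where "B = {-\<epsilon><..<\<epsilon>} \<times> {-\<epsilon><..<\<epsilon>}"
  have B: "open B" "(0, 0) \<in> B" using \<epsilon> by (auto simp: B_def open_Times)
  note ZS = ZS[folded B_def] and ZD = ZD[folded B_def] and Vc = Vc[folded B_def]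
  have Zc: "continuous_on B Z"
    using has_derivative_continuous[OF ZD] by (intro continuous_at_imp_continuous_on ballI)
  have GZc: "continuous_on B (\<lambda>p. G (Z p))"
    using ZS by (intro continuous_on_compose2[OF Ck_on_continuous[OF G2] Zc]) auto
  have Z1: "Ck_on 1 B Z"
    unfolding One_nat_def using B Vc GZc by (intro Ck_on_SucI[OF _ ZD]) (auto intro!: continuous_intros)
  define P where "P = (\<lambda>p. fst (fst (Z p)))"
  define Q where "Q = (\<lambda>p. snd (fst (Z p)))"
  define Y where "Y = (\<lambda>p. snd (Z p))"
  have PQY1: "Ck_on 1 B P" "Ck_on 1 B Q" "Ck_on 1 B Y"
    unfolding P_def Q_def Y_def
    by (intro Ck_on_linear_compose[OF B(1) bounded_linear_fst] Ck_on_linear_compose[OF B(1) bounded_linear_snd] Z1)+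
  have PD: "(P has_derivative (\<lambda>h. fst h * X1 (Z p) + snd h * fst (fst (V p)))) (at p)"
    and QD: "(Q has_derivative (\<lambda>h. fst h * X2 (Z p) + snd h * snd (fst (V p)))) (at p)"
    and YD: "(Y has_derivative (\<lambda>h. fst h * X3 (Z p) + snd h * snd (V p))) (at p)" if "p \<in> B" for p
    using has_derivative_fst[OF has_derivative_fst[OF ZD[OF that]]] has_derivative_snd[OF has_derivative_fst[OF ZD[OF that]]]
      has_derivative_snd[OF ZD[OF that]] by (simp_all add: P_def Q_def Y_def G_def)
  have Z00: "Z (0, 0) = (z, y)" "V (0, 0) = ((e1, e2), q)" using Z0[of 0] \<gamma>0 \<epsilon> by auto
  have "pd1 P (0, 0) * pd2 Q (0, 0) - pd2 P (0, 0) * pd1 Q (0, 0) \<noteq> 0"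
    using e by (simp add: pd1_eq[OF PD[OF B(2)]] pd2_eq[OF PD[OF B(2)]] pd1_eq[OF QD[OF B(2)]] pd2_eq[OF QD[OF B(2)]] Z00 mult.commute)
  from B PQY1(1,2) this
  obtain U where U: "open U" "(0, 0) \<in> U" "U \<subseteq> B" "inj_on (\<lambda>p. (P p, Q p)) U" "open ((\<lambda>p. (P p, Q p)) ` U)"
    "\<And>k. Ck_on (Suc k) B P \<Longrightarrow> Ck_on (Suc k) B Q \<Longrightarrow>
      Ck_on (Suc k) ((\<lambda>p. (P p, Q p)) ` U) (inv_into U (\<lambda>p. (P p, Q p)))"
    by (rule plane_inverse_function) (rule that)
  define F where "F = (\<lambda>p. (P p, Q p))"
  note U = U(1-5)[folded F_def] U(6)[of 0, unfolded One_nat_def[symmetric], OF PQY1(1,2), folded F_def]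
  define v where "v = (\<lambda>z. Y (inv_into U F z))"
  have vF: "v (F p) = Y p" if "p \<in> U" for p using that U(4) by (simp add: v_def)
  have v1: "Ck_on 1 (F ` U) v"
    unfolding v_def by (rule Ck_on_compose[OF U(5) B(1) PQY1(3) U(6)]) (use U(3) in \<open>auto simp: inv_into_f_f[OF U(4)]\<close>)
  have ZF: "Z p = (F p, Y p)" for p by (simp add: F_def P_def Q_def Y_def)
  \<comment> \<open>The relation \<open>v (F p) = Y p\<close> is differentiated in both flow
    coordinates. The direction \<open>(1, 0)\<close> will yield the equation, the direction
    \<open>(0, 1)\<close> at the origin the prescribed derivative.\<close>
  have chain: "(fst h * X1 (Z p) + snd h * fst (fst (V p))) * pd1 v (F p) + (fst h * X2 (Z p) + snd h * snd (fst (V p))) * pd2 v (F p)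
      = fst h * X3 (Z p) + snd h * snd (V p)" if p: "p \<in> U" for p h
  proof -
    have pB: "p \<in> B" using p U(3) by blast
    have "v differentiable at (P p, Q p)" using v1 p by (simp add: Ck_on.simps(2) F_def)
    from has_derivative_compose[OF has_derivative_Pair[OF PD[OF pB] QD[OF pB]] has_derivative_pd[OF this]]
    have "((\<lambda>p. v (F p)) has_derivative (\<lambda>h. (fst h * X1 (Z p) + snd h * fst (fst (V p))) * pd1 v (F p)
        + (fst h * X2 (Z p) + snd h * snd (fst (V p))) * pd2 v (F p))) (at p)"
      by (simp add: F_def)
    moreover have "((\<lambda>p. v (F p)) has_derivative (\<lambda>h. fst h * X3 (Z p) + snd h * snd (V p))) (at p)"
      by (rule has_derivative_transform_within_open[OF YD[OF pB] U(1) p]) (simp add: vF)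
    ultimately have "(\<lambda>h. (fst h * X1 (Z p) + snd h * fst (fst (V p))) * pd1 v (F p)
        + (fst h * X2 (Z p) + snd h * snd (fst (V p))) * pd2 v (F p)) = (\<lambda>h. fst h * X3 (Z p) + snd h * snd (V p))"
      by (rule has_derivative_unique)
    from fun_cong[OF this, of h] show ?thesis .
  qed
  have F0: "F (0, 0) = z" "Y (0, 0) = y" using Z00(1) ZF[of "(0, 0)"] by auto
  show thesis
  proof (rule that[of "F ` U" v])
    show "z \<in> F ` U" using F0(1) U(2) by force
    show "v z = y" using vF[OF U(2)] F0 by simp
    show "graph_in S (F ` U) v"
      unfolding graph_in_def using vF ZF ZS U(3) by force
    show "classical_solution (quasilinear_eq X1 X2 X3) (F ` U) v"
      unfolding classical_solution_def quasilinear_eq_def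
    proof (intro conjI ballI)
      fix w assume "w \<in> F ` U"
      then obtain p where p: "p \<in> U" "w = F p" by blast
      show "X1 (w, v w) * pd1 v w + X2 (w, v w) * pd2 v w = X3 (w, v w)"
        using chain[OF p(1), of "(1, 0)"] vF[OF p(1)] by (simp add: p(2) ZF)
    qed (use U(5) v1 in auto)
    show "e1 * pd1 v z + e2 * pd2 v z = q"
      using chain[OF U(2), of "(0, 1)"] by (simp add: Z00 F0)
  qed
qed

section \<open>A local Frobenius theorem in the plane\<close>

text \<open>Gronwall's argument for the squared norm: with \<open>K \<le> C\<close> on the segment,
  the squared norm weighted by \<open>exp (- 2 * C * t)\<close> does not increase after time zero,
  and weighted by \<open>exp (2 * C * t)\<close> it does not decrease before time zero, where it
  vanishes.\<close>

lemma linear_differential_inequality_zero: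
  fixes w :: "real \<Rightarrow> 'a::real_inner"
  assumes w: "\<And>t. \<bar>t\<bar> < e \<Longrightarrow> (w has_vector_derivative w' t) (at t)"
    and K: "\<And>t. \<bar>t\<bar> < e \<Longrightarrow> norm (w' t) \<le> K t * norm (w t)" "continuous_on {-e<..<e} K"
    and w0: "w 0 = 0" and t: "\<bar>t\<bar> < e"
  shows "w t = 0"
proof -
  have "compact (K ` {-\<bar>t\<bar>..\<bar>t\<bar>})"
    using t by (intro compact_continuous_image continuous_on_subset[OF K(2)]) auto
  then obtain C where C: "\<And>s. \<bar>s\<bar> \<le> \<bar>t\<bar> \<Longrightarrow> K s \<le> C"
    using compact_imp_bounded bounded_imp_bdd_above unfolding bdd_above_def by (metis abs_le_iff atLeastAtMost_iff image_eqI minus_le_iff)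
  have u: "((\<lambda>s. w s \<bullet> w s) has_real_derivative 2 * (w s \<bullet> w' s)) (at s)" if "\<bar>s\<bar> < e" for s
    using bounded_bilinear.has_vector_derivative[OF bounded_bilinear_inner w[OF that] w[OF that]]
    by (simp add: has_real_derivative_iff_has_vector_derivative inner_commute)
  have b: "\<bar>w s \<bullet> w' s\<bar> \<le> C * (w s \<bullet> w s)" if "\<bar>s\<bar> \<le> \<bar>t\<bar>" for s
  proof -
    have "\<bar>w s \<bullet> w' s\<bar> \<le> norm (w s) * norm (w' s)" by (rule Cauchy_Schwarz_ineq2)
    also have "\<dots> \<le> norm (w s) * (C * norm (w s))"
      using order_trans[OF K(1)[of s] mult_right_mono[OF C[OF that] norm_ge_zero]] that t
      by (intro mult_left_mono) auto
    also have "\<dots> = C * (w s \<bullet> w s)" by (simp add: dot_square_norm power2_eq_square)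
    finally show ?thesis .
  qed
  have E: "((\<lambda>s. exp (k * s) * (w s \<bullet> w s)) has_real_derivative exp (k * s) * (k * (w s \<bullet> w s) + 2 * (w s \<bullet> w' s))) (at s)"
    if "\<bar>s\<bar> < e" for s k
    by (rule derivative_eq_intros u[OF that] refl)+ (simp add: algebra_simps)
  have "w t \<bullet> w t \<le> 0"
  proof (cases "t \<ge> 0")
    case True
    have "exp (- 2 * C * t) * (w t \<bullet> w t) \<le> exp (- 2 * C * 0) * (w 0 \<bullet> w 0)"
    proof (rule DERIV_nonpos_imp_nonincreasing[OF True])
      fix s assume s: "0 \<le> s" "s \<le> t"
      then have "- 2 * C * (w s \<bullet> w s) + 2 * (w s \<bullet> w' s) \<le> 0" using b[of s] by (simp add: abs_le_iff)
      then show "\<exists>y. ((\<lambda>s. exp (- 2 * C * s) * (w s \<bullet> w s)) has_real_derivative y) (at s) \<and> y \<le> 0"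
        using E[of s "- 2 * C"] s t by (intro exI conjI) (auto simp: mult_nonneg_nonpos)
    qed
    then show ?thesis using w0 by (simp add: mult_le_0_iff)
  next
    case False
    have "exp (2 * C * t) * (w t \<bullet> w t) \<le> exp (2 * C * 0) * (w 0 \<bullet> w 0)"
    proof (rule DERIV_nonneg_imp_nondecreasing[of t 0 "\<lambda>s. exp (2 * C * s) * (w s \<bullet> w s)"])
      show "t \<le> 0" using False by simp
      fix s assume s: "t \<le> s" "s \<le> 0"
      then have "\<bar>s\<bar> \<le> \<bar>t\<bar>" by arith
      from b[OF this] have "2 * C * (w s \<bullet> w s) + 2 * (w s \<bullet> w' s) \<ge> 0" by (simp add: abs_le_iff)
      then show "\<exists>y. ((\<lambda>s. exp (2 * C * s) * (w s \<bullet> w s)) has_real_derivative y) (at s) \<and> 0 \<le> y"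
      proof (intro exI conjI)
        show "((\<lambda>s. exp (2 * C * s) * (w s \<bullet> w s)) has_real_derivative
          exp (2 * C * s) * (2 * C * (w s \<bullet> w s) + 2 * (w s \<bullet> w' s))) (at s)"
          using s t False by (intro E) auto
      qed (use \<open>2 * C * (w s \<bullet> w s) + 2 * (w s \<bullet> w' s) \<ge> 0\<close> in simp)
    qed
    then show ?thesis using w0 by (simp add: mult_le_0_iff)
  qed
  then show ?thesis using inner_ge_zero[of "w t"] by (metis inner_eq_zero_iff order_antisym)
qed

lemma has_derivative_const_eq:
  fixes f :: "real \<Rightarrow> 'a::real_normed_vector"
  assumes "\<And>t. \<bar>t\<bar> < e \<Longrightarrow> (f has_vector_derivative c) (at t)" "\<bar>t\<bar> < e"
  shows "f t = f 0 + t *\<^sub>R c"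
proof -
  have "((\<lambda>t. f t - t *\<^sub>R c) has_derivative (\<lambda>h. 0)) (at s within {-e<..<e})" if "s \<in> {-e<..<e}" for s
  proof -
    have "\<bar>s\<bar> < e" using that by (simp add: abs_less_iff)
    from has_derivative_at_withinI[OF has_derivative_diff[OF assms(1)[OF this, unfolded has_vector_derivative_def]
        has_derivative_scaleR_left[OF has_derivative_ident]], of c]
    show ?thesis by simp
  qed
  then obtain k where "\<And>s. s \<in> {-e<..<e} \<Longrightarrow> f s - s *\<^sub>R c = k"
    using has_derivative_zero_constant[of "{-e<..<e}" "\<lambda>t. f t - t *\<^sub>R c"] by auto
  from this[of t] this[of 0] assms(2) show ?thesis by (simp add: abs_less_iff algebra_simps)
qed


text \<open>The graph of a solution has to be tangent to the fields \<open>A = (1, 0, a)\<close> and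
  \<open>B = (0, 1, b)\<close>, and \<open>compat\<close> says that these commute. The surface is
  swept out by flowing the \<open>A\<close>-orbit of the initial point along \<open>B\<close>:
  tangency to \<open>B\<close> is automatic, tangency to \<open>A\<close> has to be propagated from
  the orbit.\<close>

lemma frobenius_plane:
  fixes a b :: "plane \<times> 'v::euclidean_space \<Rightarrow> 'v"
  assumes N: "open N" "(z0, F0) \<in> N" and ab: "smooth_on N a" "smooth_on N b"
    and compat: "\<And>p. p \<in> N \<Longrightarrow>
      frechet_derivative a (at p) ((0, 1), b p) = frechet_derivative b (at p) ((1, 0), a p)"
  obtains D F where "open D" "z0 \<in> D" "F z0 = F0" "smooth_on D F"
    "\<And>z. z \<in> D \<Longrightarrow> (z, F z) \<in> N"
    "\<And>z. z \<in> D \<Longrightarrow> (F has_derivative (\<lambda>h. fst h *\<^sub>R a (z, F z) + snd h *\<^sub>R b (z, F z))) (at z)"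
proof -
  define A where "A = (\<lambda>p. ((1::real, 0::real), a p))"
  define B where "B = (\<lambda>p. ((0::real, 1::real), b p))"
  have A2: "Ck_on 2 N A" and B2: "Ck_on 2 N B"
    unfolding A_def B_def by (intro Ck_on_Pair N Ck_on_const smooth_on_Ck ab)+
  \<comment> \<open>Flowing a constant curve along \<open>A\<close> yields in particular the
    integral curve of \<open>A\<close> through the initial point.\<close>
  obtain e1 Z1 V1 where e1: "e1 > 0" "e1 < 1"
    and Z1N: "\<And>p. p \<in> {-e1<..<e1} \<times> {-e1<..<e1} \<Longrightarrow> Z1 p \<in> N"
    and Z10: "\<And>s. \<bar>s\<bar> < e1 \<Longrightarrow> Z1 (0, s) = (z0, F0)" "\<And>s. \<bar>s\<bar> < e1 \<Longrightarrow> V1 (0, s) = (0 :: plane \<times> 'v)"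
    and Z1D: "\<And>p. p \<in> {-e1<..<e1} \<times> {-e1<..<e1} \<Longrightarrow>
      (Z1 has_derivative (\<lambda>h. fst h *\<^sub>R A (Z1 p) + snd h *\<^sub>R V1 p)) (at p)"
    by (rule flow_out[of N A "\<lambda>_. (z0, F0)" 1 "\<lambda>_. 0", OF N(1) A2 N(2) zero_less_one has_vector_derivative_const continuous_on_const])
      (rule that)
  define c where "c = (\<lambda>t. Z1 (t, 0))"
  have c0: "c 0 = (z0, F0)" using Z10(1)[of 0] e1 by (simp add: c_def)
  have cN: "c t \<in> N" if "\<bar>t\<bar> < e1" for t
    unfolding c_def using e1 that by (intro Z1N) (auto simp: abs_less_iff)
  have cD: "(c has_vector_derivative A (c t)) (at t)" if "\<bar>t\<bar> < e1" for t
  proof -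
    have "(t, 0) \<in> {-e1<..<e1} \<times> {-e1<..<e1}" using e1 that by (auto simp: abs_less_iff)
    from has_derivative_compose[OF has_derivative_Pair[OF has_derivative_ident has_derivative_const] Z1D[OF this]]
    show ?thesis by (simp add: has_vector_derivative_def c_def)
  qed
  have Ac: "continuous_on {-e1<..<e1} (\<lambda>t. A (c t))"
  proof (rule continuous_on_compose2[OF Ck_on_continuous[OF A2]])
    show "continuous_on {-e1<..<e1} c"
      using has_vector_derivative_continuous[OF cD] by (intro continuous_at_imp_continuous_on) auto
  qed (use cN in \<open>auto simp: abs_less_iff\<close>)
  have fst_c: "fst (c t) = (fst z0 + t, snd z0)" if "\<bar>t\<bar> < e1" for t
  proof -
    have "((\<lambda>t. fst (c t)) has_vector_derivative (1, 0)) (at s)" if "\<bar>s\<bar> < e1" for s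
      using has_derivative_fst[OF cD[OF that, unfolded has_vector_derivative_def]]
      by (simp add: has_vector_derivative_def A_def)
    from has_derivative_const_eq[OF this that] show ?thesis by (simp add: c0 prod_eq_iff)
  qed
  have c0N: "c 0 \<in> N" using c0 N by simp
  obtain e Z V where e: "e > 0" "e < e1"
    and ZN: "\<And>p. p \<in> {-e<..<e} \<times> {-e<..<e} \<Longrightarrow> Z p \<in> N"
    and Z0: "\<And>s. \<bar>s\<bar> < e \<Longrightarrow> Z (0, s) = c s" "\<And>s. \<bar>s\<bar> < e \<Longrightarrow> V (0, s) = A (c s)"
    and ZD: "\<And>p. p \<in> {-e<..<e} \<times> {-e<..<e} \<Longrightarrow>
      (Z has_derivative (\<lambda>h. fst h *\<^sub>R B (Z p) + snd h *\<^sub>R V p)) (at p)"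
    and VD: "\<And>t s. \<bar>t\<bar> < e \<Longrightarrow> \<bar>s\<bar> < e \<Longrightarrow>
      ((\<lambda>t. V (t, s)) has_vector_derivative frechet_derivative B (at (Z (t, s))) (V (t, s))) (at t)"
    by (rule flow_out[of N B c e1 "\<lambda>t. A (c t)", OF N(1) B2 c0N e1(1) cD Ac]) (assumption, rule that)
  define I where "I = {-e<..<e}"
  have I: "open (I \<times> I)" "\<bar>t\<bar> < e \<longleftrightarrow> t \<in> I" for t by (auto simp: I_def open_Times abs_less_iff)
  note ZN = ZN[folded I_def] and ZD = ZD[folded I_def] and Z0 = Z0[unfolded I(2)] and VD = VD[unfolded I(2)]
  have slice: "((\<lambda>x. Z (x, s)) has_vector_derivative B (Z (x, s))) (at x)" if "x \<in> I" "s \<in> I" for x s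
    using has_derivative_compose[OF has_derivative_Pair[OF has_derivative_ident has_derivative_const] ZD, of x s] that
    by (simp add: has_vector_derivative_def)
  have fst_Z: "fst (Z (x, s)) = (fst z0 + s, snd z0 + x)" if "x \<in> I" "s \<in> I" for x s
  proof -
    have *: "((\<lambda>x. fst (Z (x, s))) has_vector_derivative (0, 1)) (at x)" if "\<bar>x\<bar> < e" for x
      using has_derivative_fst[OF slice[unfolded has_vector_derivative_def], of x s] that \<open>s \<in> I\<close> I(2)
      by (simp add: has_vector_derivative_def B_def)
    have "\<bar>x\<bar> < e" "\<bar>s\<bar> < e1" using that e(2) I(2)[of s] I(2)[of x] by auto
    with has_derivative_const_eq[OF * \<open>\<bar>x\<bar> < e\<close>] Z0(1)[OF that(2)] fst_c[of s]
    show ?thesis by (simp add: prod_eq_iff)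
  qed
  have fst_V: "fst (V p) = (1, 0)" if p: "p \<in> I \<times> I" for p
  proof -
    have "((\<lambda>p. fst (Z p)) has_derivative (\<lambda>h. (snd h, fst h))) (at p)"
    proof (rule has_derivative_transform_within_open[OF _ I(1) p])
      show "((\<lambda>p. (fst z0 + snd p, snd z0 + fst p)) has_derivative (\<lambda>h. (snd h, fst h))) (at p)"
        by (auto intro!: derivative_eq_intros)
    qed (use fst_Z in auto)
    from has_derivative_unique[OF this has_derivative_fst[OF ZD[OF p]]]
    have "(snd h, fst h) = fst (fst h *\<^sub>R B (Z p) + snd h *\<^sub>R V p)" for h by (rule fun_cong)
    from this[of "(0, 1)"] show ?thesis by simp
  qed
  have Da: "(a has_derivative frechet_derivative a (at p)) (at p)"
    and Db: "(b has_derivative frechet_derivative b (at p)) (at p)" if "p \<in> N" for p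
    using smooth_on_has_derivative ab that by blast+
  have DB: "frechet_derivative B (at p) h = ((0, 0), frechet_derivative b (at p) h)" if "p \<in> N" for p h
    unfolding B_def by (simp add: frechet_derivative_eq[OF has_derivative_Pair[OF has_derivative_const Db[OF that]]] zero_prod_def)
  \<comment> \<open>The defect of tangency to \<open>A\<close>, namely \<open>snd V - a\<close>
    along \<open>Z\<close>, vanishes on the initial orbit. By the compatibility condition it
    satisfies a homogeneous linear equation along \<open>B\<close>, whose coefficient is the
    derivative of \<open>b\<close> in fiber directions; hence it stays zero.\<close>
  have snd_V: "snd (V (x, s)) = a (Z (x, s))" if xs: "x \<in> I" "s \<in> I" for x s
  proof -
    let ?w = "\<lambda>x. snd (V (x, s)) - a (Z (x, s))"
    let ?L = "\<lambda>x w. frechet_derivative b (at (Z (x, s))) (0, w)"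
    let ?K = "\<lambda>x. \<Sum>i\<in>Basis. norm (?L x i)"
    have ZN': "Z (x, s) \<in> N" if "x \<in> I" for x using ZN that xs by auto
    have lin: "linear (frechet_derivative b (at (Z (x, s))))" if "x \<in> I" for x
      using Db[OF ZN'[OF that]] by (rule has_derivative_linear)
    have "?w x = 0"
    proof (rule linear_differential_inequality_zero[of e ?w "\<lambda>x. ?L x (?w x)" ?K x])
      fix x assume "\<bar>x\<bar> < e"
      then have x: "x \<in> I" using I(2) by blast
      have V_eq: "V (x, s) = ((1, 0), snd (V (x, s)))" using fst_V[of "(x, s)"] x xs by (simp add: prod_eq_iff)
      have d1: "((\<lambda>x. snd (V (x, s))) has_vector_derivative frechet_derivative b (at (Z (x, s))) (V (x, s))) (at x)"
        using has_derivative_snd[OF VD[OF x xs(2), unfolded has_vector_derivative_def]]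
        by (simp add: has_vector_derivative_def DB[OF ZN'[OF x]])
      have d2: "((\<lambda>x. a (Z (x, s))) has_vector_derivative frechet_derivative a (at (Z (x, s))) (B (Z (x, s)))) (at x)"
        using has_derivative_compose[OF slice[OF x xs(2), unfolded has_vector_derivative_def] Da[OF ZN'[OF x]]]
        by (simp add: has_vector_derivative_def linear_scale[OF has_derivative_linear[OF Da[OF ZN'[OF x]]]])
      have eq: "frechet_derivative b (at (Z (x, s))) (V (x, s)) - frechet_derivative a (at (Z (x, s))) (B (Z (x, s))) = ?L x (?w x)"
        unfolding B_def compat[OF ZN'[OF x]] linear_diff[OF lin[OF x], symmetric] by (subst V_eq) (simp add: zero_prod_def)
      show "(?w has_vector_derivative ?L x (?w x)) (at x)"
        using has_vector_derivative_diff[OF d1 d2] unfolding eq .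
      have "?L x (?w x) = ?L x (\<Sum>i\<in>Basis. (?w x \<bullet> i) *\<^sub>R i)" by (simp add: euclidean_representation)
      also have "\<dots> = (\<Sum>i\<in>Basis. (?w x \<bullet> i) *\<^sub>R ?L x i)"
      proof -
        have L: "linear (?L x)" using linear_compose[OF _ lin[OF x], of "\<lambda>w. (0, w)"] by (simp add: o_def linear_iff)
        show ?thesis by (simp add: linear_sum[OF L] linear_scale[OF L])
      qed
      also have "norm \<dots> \<le> (\<Sum>i\<in>Basis. norm (?w x) * norm (?L x i))"
        by (intro sum_norm_le) (auto intro!: mult_right_mono Basis_le_norm)
      finally show "norm (?L x (?w x)) \<le> ?K x * norm (?w x)" by (simp add: sum_distrib_left mult.commute)
    next
      have "continuous_on I (\<lambda>x. Z (x, s))"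
        using has_vector_derivative_continuous[OF slice] xs by (intro continuous_at_imp_continuous_on) auto
      then have "continuous_on I (\<lambda>x. ?L x i)" for i
        by (rule continuous_on_compose2[OF smooth_on_continuous[OF smooth_on_frechet[OF ab(2)]]]) (use ZN' in auto)
      then show "continuous_on {-e<..<e} ?K" unfolding I_def by (intro continuous_intros)
      show "?w 0 = 0" using Z0[OF xs(2)] by (simp add: A_def)
      show "\<bar>x\<bar> < e" using xs I(2) by blast
    qed
    then show ?thesis by simp
  qed
  \<comment> \<open>The first argument of \<open>Z\<close> is the time along \<open>B\<close>, that
    is, the displacement in the second base coordinate; therefore the coordinates appear
    exchanged.\<close>
  define D where "D = {z. (snd z - snd z0, fst z - fst z0) \<in> I \<times> I}"
  define F where "F = (\<lambda>z. snd (Z (snd z - snd z0, fst z - fst z0)))"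
  have "D = (\<lambda>z. (snd z - snd z0, fst z - fst z0)) -` (I \<times> I)" by (auto simp: D_def)
  then have oD: "open D" by (simp only:) (intro open_vimage I continuous_intros)
  have zD: "z0 \<in> D" using e(1) by (simp add: D_def I_def)
  have ZF: "Z (snd z - snd z0, fst z - fst z0) = (z, F z)" if "z \<in> D" for z
    using fst_Z[of "snd z - snd z0" "fst z - fst z0"] that by (simp add: D_def F_def prod_eq_iff)
  have FN: "(z, F z) \<in> N" if "z \<in> D" for z
    using ZN[of "(snd z - snd z0, fst z - fst z0)"] that ZF[OF that] by (simp add: D_def)
  have FD: "(F has_derivative (\<lambda>h. fst h *\<^sub>R a (z, F z) + snd h *\<^sub>R b (z, F z))) (at z)" if z: "z \<in> D" for z
  proof -
    let ?p = "(snd z - snd z0, fst z - fst z0)"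
    have p: "?p \<in> I \<times> I" using z by (simp add: D_def)
    have "((\<lambda>z. (snd z - snd z0, fst z - fst z0)) has_derivative (\<lambda>h. (snd h, fst h))) (at z)"
      by (auto intro!: derivative_eq_intros)
    from has_derivative_snd[OF has_derivative_compose[OF this ZD[OF p]]]
    show ?thesis using snd_V[of "fst ?p" "snd ?p"] p by (simp add: F_def[symmetric] ZF[OF z] B_def add.commute)
  qed
  show thesis
  proof (rule that[OF oD zD _ _ FN FD])
    show "F z0 = F0" using Z0(1)[of 0] c0 e(1) by (simp add: F_def I_def)
    have "Ck_on (Suc k) D F" for k
    proof (rule Ck_on_bootstrap[OF oD N(1)])
      show "(z, F z) \<in> N \<and> (F has_derivative (\<lambda>h. fst h *\<^sub>R a (z, F z) + snd h *\<^sub>R b (z, F z))) (at z)" if "z \<in> D" for z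
        using FN FD that by blast
      show "Ck_on k N (\<lambda>p. fst h *\<^sub>R a p + snd h *\<^sub>R b p)" for h
        by (intro Ck_on_add Ck_on_scaleR Ck_on_const N smooth_on_Ck ab)
    qed
    then show "smooth_on D F" unfolding smooth_on_def using Ck_on_SucD by fast
  qed
qed

section \<open>Bundle maps and characteristic directions\<close>

lemma burgers_eq_cubic: "burgers_eq = cubic_burgers_eq (\<lambda>_. 0) (\<lambda>_. 0) (\<lambda>_. 0) (\<lambda>_. 0)"
  by (simp add: burgers_eq_def cubic_burgers_eq_def fun_eq_iff)

lemma cubic_burgers_eq_quasilinear:
  "cubic_burgers_eq a b c d = quasilinear_eq (\<lambda>_. 1) snd
     (\<lambda>p. a (fst p) * snd p ^ 3 + b (fst p) * snd p ^ 2 + c (fst p) * snd p + d (fst p))"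
  by (simp add: cubic_burgers_eq_def quasilinear_eq_def fun_eq_iff)

lemma has_derivative_graph:
  assumes "f differentiable at (z, v z)" "v differentiable at z"
  shows "((\<lambda>z. f (z, v z)) has_derivative
    (\<lambda>h. fst h * (pdz1 f (z, v z) + pdy f (z, v z) * pd1 v z) + snd h * (pdz2 f (z, v z) + pdy f (z, v z) * pd2 v z))) (at z)"
  using has_derivative_compose[OF has_derivative_Pair[OF has_derivative_ident has_derivative_pd[OF assms(2)]] has_derivative_pdz[OF assms(1)]]
  by (simp add: algebra_simps)

lemma has_derivative_plane_compose:
  assumes "u differentiable at (\<phi> z)" "\<phi> differentiable at z"
  shows "((\<lambda>z. u (\<phi> z)) has_derivative
    (\<lambda>h. fst h * (pd1 (\<lambda>z. fst (\<phi> z)) z * pd1 u (\<phi> z) + pd1 (\<lambda>z. snd (\<phi> z)) z * pd2 u (\<phi> z))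
       + snd h * (pd2 (\<lambda>z. fst (\<phi> z)) z * pd1 u (\<phi> z) + pd2 (\<lambda>z. snd (\<phi> z)) z * pd2 u (\<phi> z)))) (at z)"
  using has_derivative_compose[OF assms(2)[THEN frechet_derivative_works[THEN iffD1]] has_derivative_pd[OF assms(1)]]
  by (simp add: frechet_derivative_plane_map[OF assms(2)] algebra_simps)

lemma classical_solution_differentiable:
  "classical_solution E D v \<Longrightarrow> z \<in> D \<Longrightarrow> v differentiable at z"
  by (simp add: classical_solution_def Ck_on.simps(2))

lemma push_apply: "inj_on \<phi> U \<Longrightarrow> z \<in> U \<Longrightarrow> push \<phi> \<theta> U u (\<phi> z) = \<theta> (z, u z)"
  by (simp add: push_def)

text \<open>The right-hand side is independent of the solution, so the direction \<open>k\<close> which \<open>\<phi>\<close> maps to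
  \<open>(1, \<theta>)\<close> is characteristic as soon as there are solutions with different tangent planes.\<close>

lemma transported_solution_derivative:
  assumes bm: "bundle_map \<phi> \<theta> U W" and maps: "maps_solutions E (cubic_burgers_eq a b c d) \<phi> \<theta> U W"
    and v: "classical_solution E D v" "graph_in W D v" "z \<in> D"
    and k: "k1 * pd1 (\<lambda>z. fst (\<phi> z)) z + k2 * pd2 (\<lambda>z. fst (\<phi> z)) z = 1"
      "k1 * pd1 (\<lambda>z. snd (\<phi> z)) z + k2 * pd2 (\<lambda>z. snd (\<phi> z)) z = \<theta> (z, v z)"
  shows "k1 * (pdz1 \<theta> (z, v z) + pdy \<theta> (z, v z) * pd1 v z) + k2 * (pdz2 \<theta> (z, v z) + pdy \<theta> (z, v z) * pd2 v z)
    = a (\<phi> z) * \<theta> (z, v z) ^ 3 + b (\<phi> z) * \<theta> (z, v z) ^ 2 + c (\<phi> z) * \<theta> (z, v z) + d (\<phi> z)"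
proof -
  note bm = bundle_mapD[OF bm]
  define u where "u = push \<phi> \<theta> U v"
  have D: "open D" "D \<subseteq> U" using v(1,2) bm(2) by (auto simp: classical_solution_def graph_in_def)
  have u: "classical_solution (cubic_burgers_eq a b c d) (\<phi> ` D) u"
    using maps v(1,2) by (auto simp: maps_solutions_def u_def)
  have u\<phi>: "u (\<phi> z) = \<theta> (z, v z)" if "z \<in> D" for z
    using push_apply[OF bm(6) subsetD[OF D(2) that]] by (simp add: u_def)
  have du: "u differentiable at (\<phi> z)" using u v(3) by (auto intro: classical_solution_differentiable)
  have "z \<in> U" using D v(3) by blast
  then have d\<phi>: "\<phi> differentiable at z" by (rule smooth_on_differentiable[OF bm(8)])
  have "(z, v z) \<in> W" using v by (auto simp: graph_in_def)
  then have d\<theta>: "\<theta> differentiable at (z, v z)" by (rule smooth_on_differentiable[OF bm(3)])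
  have "((\<lambda>z. u (\<phi> z)) has_derivative (\<lambda>h. fst h * (pdz1 \<theta> (z, v z) + pdy \<theta> (z, v z) * pd1 v z) +
      snd h * (pdz2 \<theta> (z, v z) + pdy \<theta> (z, v z) * pd2 v z))) (at z)"
    by (rule has_derivative_transform_within_open[OF has_derivative_graph[OF d\<theta> classical_solution_differentiable[OF v(1,3)]] D(1) v(3)])
      (simp add: u\<phi>)
  from fun_cong[OF has_derivative_unique[OF this has_derivative_plane_compose[OF du d\<phi>]], of "(k1, k2)"]
  have "k1 * (pdz1 \<theta> (z, v z) + pdy \<theta> (z, v z) * pd1 v z) + k2 * (pdz2 \<theta> (z, v z) + pdy \<theta> (z, v z) * pd2 v z)
    = (k1 * pd1 (\<lambda>z. fst (\<phi> z)) z + k2 * pd2 (\<lambda>z. fst (\<phi> z)) z) * pd1 u (\<phi> z)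
      + (k1 * pd1 (\<lambda>z. snd (\<phi> z)) z + k2 * pd2 (\<lambda>z. snd (\<phi> z)) z) * pd2 u (\<phi> z)"
    by (simp add: algebra_simps)
  also have "\<dots> = pd1 u (\<phi> z) + u (\<phi> z) * pd2 u (\<phi> z)" using k u\<phi>[OF v(3)] by simp
  also have "\<dots> = a (\<phi> z) * u (\<phi> z) ^ 3 + b (\<phi> z) * u (\<phi> z) ^ 2 + c (\<phi> z) * u (\<phi> z) + d (\<phi> z)"
    using u v(3) by (auto simp: classical_solution_def cubic_burgers_eq_def)
  finally show ?thesis by (simp add: u\<phi> v(3))
qed

text \<open>Let \<open>k\<close> be the direction that the derivative of \<open>\<phi>\<close> maps
  to \<open>(1, \<theta> p)\<close>. The derivative of \<open>\<theta>\<close> along the graph of a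
  solution in direction \<open>k\<close> is fixed by the target equation, whatever the free
  derivative \<open>q\<close> of the solution in the second base direction. So the coefficient of
  \<open>q\<close> vanishes, which makes \<open>k\<close> proportional to \<open>(1, w)\<close>;
  \<open>M\<close> and \<open>N\<close> are the components of the image of
  \<open>(1, w)\<close>.\<close>

lemma characteristic_direction:
  assumes bm: "bundle_map \<phi> \<theta> U W"
    and maps: "maps_solutions (quasilinear_eq X1 X2 X3) (cubic_burgers_eq a b c d) \<phi> \<theta> U W"
    and S: "open S" "S \<subseteq> W" "smooth_on S X1" "smooth_on S X2" "smooth_on S X3" "p \<in> S" "X1 p \<noteq> 0"
  defines "z \<equiv> fst p" and "w \<equiv> slope X1 X2 p"
  defines "M \<equiv> pd1 (\<lambda>z. fst (\<phi> z)) z + w * pd2 (\<lambda>z. fst (\<phi> z)) z"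
    and "N \<equiv> pd1 (\<lambda>z. snd (\<phi> z)) z + w * pd2 (\<lambda>z. snd (\<phi> z)) z"
  shows "M \<noteq> 0" "\<theta> p * M = N"
    "pdz1 \<theta> p + w * pdz2 \<theta> p + X3 p / X1 p * pdy \<theta> p
      = M * (a (\<phi> z) * \<theta> p ^ 3 + b (\<phi> z) * \<theta> p ^ 2 + c (\<phi> z) * \<theta> p + d (\<phi> z))"
proof -
  note bmD = bundle_mapD[OF bm]
  define P where "P = a (\<phi> z) * \<theta> p ^ 3 + b (\<phi> z) * \<theta> p ^ 2 + c (\<phi> z) * \<theta> p + d (\<phi> z)"
  have "z \<in> U" using S bmD(2) by (auto simp: z_def)
  define k where "k = frechet_derivative (inv_into U \<phi>) (at (\<phi> z)) (1, \<theta> p)"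
  have "diffeo_on U \<phi>" using bm by (simp add: bundle_map_def)
  from diffeo_on_inverse_derivative(2)[OF this \<open>z \<in> U\<close>, of "(1, \<theta> p)"]
  have k: "fst k * pd1 (\<lambda>z. fst (\<phi> z)) z + snd k * pd2 (\<lambda>z. fst (\<phi> z)) z = 1"
    "fst k * pd1 (\<lambda>z. snd (\<phi> z)) z + snd k * pd2 (\<lambda>z. snd (\<phi> z)) z = \<theta> p"
    by (simp_all add: k_def[symmetric] frechet_derivative_plane_map[OF smooth_on_differentiable[OF bmD(8) \<open>z \<in> U\<close>]])
  \<comment> \<open>The direction \<open>(0, 1)\<close> is transversal since
    \<open>X1 p \<noteq> 0\<close>. With the derivative \<open>q\<close> prescribed there, the
    equation determines the other partial derivative as \<open>X3 p / X1 p - w * q\<close>.\<close>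
  have *: "fst k * (pdz1 \<theta> p + pdy \<theta> p * (X3 p / X1 p - w * q)) + snd k * (pdz2 \<theta> p + pdy \<theta> p * q) = P" for q
  proof -
    have p: "p = (z, snd p)" by (simp add: z_def)
    have "(z, snd p) \<in> S" "X1 (z, snd p) * 1 - X2 (z, snd p) * 0 \<noteq> 0" using S(6,7) by (simp_all add: z_def)
    from S(1) this(1) smooth_on_Ck[OF S(3)] smooth_on_Ck[OF S(4)] smooth_on_Ck[OF S(5)] this(2)
    obtain D v where v: "z \<in> D" "graph_in S D v" "v z = snd p" "classical_solution (quasilinear_eq X1 X2 X3) D v"
      "0 * pd1 v z + 1 * pd2 v z = q"
      by (rule quasilinear_local_solution) (rule that)
    have "graph_in W D v" using v(2) S(2) by (auto simp: graph_in_def)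
    moreover have "X1 p * pd1 v z + X2 p * pd2 v z = X3 p"
      using v p by (auto simp: classical_solution_def quasilinear_eq_def)
    then have "pd1 v z = X3 p / X1 p - w * q"
      using v(5) S(7) by (simp add: w_def slope_def field_simps)
    ultimately show ?thesis
      using transported_solution_derivative[OF bm maps v(4) _ v(1), of "fst k" "snd k"] k v(3,5) p by (simp add: P_def)
  qed
  \<comment> \<open>Subtracting the cases \<open>q = 1\<close> and \<open>q = 0\<close> isolates the
    coefficient of \<open>q\<close>.\<close>
  have "pdy \<theta> p * (snd k - w * fst k)
      = (fst k * (pdz1 \<theta> p + pdy \<theta> p * (X3 p / X1 p - w * 1)) + snd k * (pdz2 \<theta> p + pdy \<theta> p * 1))
        - (fst k * (pdz1 \<theta> p + pdy \<theta> p * (X3 p / X1 p - w * 0)) + snd k * (pdz2 \<theta> p + pdy \<theta> p * 0))"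
    by (simp add: algebra_simps)
  also have "\<dots> = 0" unfolding * by simp
  finally have k2: "snd k = w * fst k" using bmD(4)[OF subsetD[OF S(2,6)]] by simp
  have kM: "fst k * M = 1" using k(1) by (simp add: k2 M_def algebra_simps)
  then show "M \<noteq> 0" by auto
  have "fst k * N = \<theta> p" using k(2) by (simp add: k2 N_def algebra_simps)
  then show "\<theta> p * M = N" using kM by (metis mult.assoc mult.commute mult.right_neutral)
  have "fst k * (pdz1 \<theta> p + w * pdz2 \<theta> p + X3 p / X1 p * pdy \<theta> p) = P"
    using *[of 0] by (simp add: k2 algebra_simps)
  then show "pdz1 \<theta> p + w * pdz2 \<theta> p + X3 p / X1 p * pdy \<theta> p = M * P"
    using kM by (metis mult.assoc mult.commute mult.left_neutral)
qed

lemma smooth_on_slope: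
  assumes "open S" "smooth_on S X1" "smooth_on S X2" "\<And>p. p \<in> S \<Longrightarrow> X1 p \<noteq> 0"
  shows "smooth_on S (slope X1 X2)"
  using assms unfolding slope_def by (intro smooth_intros)

text \<open>The relation \<open>\<theta> M = N\<close> holds on all of \<open>S\<close> and can be
  differentiated. In the vertical direction it shows that the slope depends on the fiber. In the
  direction of \<open>X / X1\<close> the derivative of \<open>\<theta>\<close> is known, and the
  derivative of \<open>w\<close> is the left-hand side of the cubic identity. One more
  multiplication by \<open>M\<close> replaces the powers of \<open>\<theta>\<close> by products of
  \<open>N\<close> and \<open>M\<close>, so that a cubic in \<open>w\<close> with coefficients
  depending on \<open>z\<close> remains.\<close>

lemma transformed_slope:
  assumes bm: "bundle_map \<phi> \<theta> U W"
    and maps: "maps_solutions (quasilinear_eq X1 X2 X3) (cubic_burgers_eq a b c d) \<phi> \<theta> U W"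
    and S: "open S" "S \<subseteq> W" "smooth_on S X1" "smooth_on S X2" "smooth_on S X3"
    and X1: "\<forall>p\<in>S. X1 p \<noteq> 0" and p: "p \<in> S"
  defines "w \<equiv> slope X1 X2" and "z \<equiv> fst p" and "\<tau> \<equiv> \<lambda>z. fst (\<phi> z)" and "\<xi> \<equiv> \<lambda>z. snd (\<phi> z)"
  defines "M \<equiv> pd1 \<tau> z + w p * pd2 \<tau> z" and "N \<equiv> pd1 \<xi> z + w p * pd2 \<xi> z"
  shows "pdy w p \<noteq> 0"
    "(pd1 \<tau> z * pd2 \<xi> z - pd2 \<tau> z * pd1 \<xi> z) * (pdz1 w p + w p * pdz2 w p + X3 p / X1 p * pdy w p)
      = a (\<phi> z) * N ^ 3 + b (\<phi> z) * N ^ 2 * M + c (\<phi> z) * N * M ^ 2 + d (\<phi> z) * M ^ 3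
        + N * (pd1 (pd1 \<tau>) z + 2 * w p * pd1 (pd2 \<tau>) z + w p ^ 2 * pd2 (pd2 \<tau>) z)
        - M * (pd1 (pd1 \<xi>) z + 2 * w p * pd1 (pd2 \<xi>) z + w p ^ 2 * pd2 (pd2 \<xi>) z)"
proof -
  note bmD = bundle_mapD[OF bm]
  have z: "z \<in> U" using p S bmD(2) by (auto simp: z_def)
  have \<tau>\<xi>: "smooth_on U \<tau>" "smooth_on U \<xi>"
    unfolding \<tau>_def \<xi>_def using bmD by (auto intro!: smooth_on_fst smooth_on_snd)
  have w: "smooth_on S w" unfolding w_def by (rule smooth_on_slope[OF S(1,3,4) X1[rule_format]])
  have \<theta>: "smooth_on S \<theta>" using bmD(3) S(2) by (rule smooth_on_subset)
  note cd = characteristic_direction[OF bm maps S, folded \<tau>_def \<xi>_def w_def]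
  note dw = has_derivative_pdz[OF smooth_on_differentiable[OF w p]]
    and d\<theta> = has_derivative_pdz[OF smooth_on_differentiable[OF \<theta> p]]
  have base: "((\<lambda>p. f (fst p)) has_derivative (\<lambda>h. fst (fst h) * pd1 f z + snd (fst h) * pd2 f z)) (at p)"
    if "smooth_on U f" for f
    using has_derivative_compose[OF has_derivative_fst[OF has_derivative_ident] has_derivative_pd[OF smooth_on_differentiable[OF that]], of p UNIV] z
    by (simp add: z_def)
  let ?dw = "\<lambda>h. fst (fst h) * pdz1 w p + snd (fst h) * pdz2 w p + snd h * pdy w p"
  let ?d\<theta> = "\<lambda>h. fst (fst h) * pdz1 \<theta> p + snd (fst h) * pdz2 \<theta> p + snd h * pdy \<theta> p"
  let ?d = "\<lambda>f h. fst (fst h) * pd1 (pd1 f) z + snd (fst h) * pd2 (pd1 f) z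
      + (w p * (fst (fst h) * pd1 (pd2 f) z + snd (fst h) * pd2 (pd2 f) z) + ?dw h * pd2 f z)"
  have line: "((\<lambda>p. pd1 f (fst p) + w p * pd2 f (fst p)) has_derivative ?d f) (at p)" if "smooth_on U f" for f
    using has_derivative_add[OF base[OF smooth_on_pd1[OF that]] has_derivative_mult[OF dw base[OF smooth_on_pd2[OF that]]]]
    by (simp add: z_def)
  have "((\<lambda>p. pd1 \<xi> (fst p) + w p * pd2 \<xi> (fst p)) has_derivative (\<lambda>h. \<theta> p * ?d \<tau> h + ?d\<theta> h * M)) (at p)"
  proof (rule has_derivative_transform_within_open[OF _ S(1) p])
    show "((\<lambda>p. \<theta> p * (pd1 \<tau> (fst p) + w p * pd2 \<tau> (fst p))) has_derivative (\<lambda>h. \<theta> p * ?d \<tau> h + ?d\<theta> h * M)) (at p)"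
      unfolding M_def z_def by (rule has_derivative_mult[OF d\<theta> line[OF \<tau>\<xi>(1), unfolded z_def]])
  qed (use cd(2) X1 in auto)
  from fun_cong[OF has_derivative_unique[OF line[OF \<tau>\<xi>(2)] this]]
  have D: "?d \<xi> h = \<theta> p * ?d \<tau> h + ?d\<theta> h * M" for h .
  have M0: "M \<noteq> 0" and \<theta>M: "\<theta> p * M = N"
    and \<delta>: "pdz1 \<theta> p + w p * pdz2 \<theta> p + X3 p / X1 p * pdy \<theta> p
      = M * (a (\<phi> z) * \<theta> p ^ 3 + b (\<phi> z) * \<theta> p ^ 2 + c (\<phi> z) * \<theta> p + d (\<phi> z))"
    using cd[OF p X1[rule_format, OF p]] by (simp_all add: M_def N_def z_def)
  show "pdy w p \<noteq> 0"
  proof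
    assume "pdy w p = 0"
    \<comment> \<open>If the vertical derivative of \<open>w\<close> vanished, those of
      \<open>M\<close> and \<open>N\<close> would vanish too, and only the derivative of
      \<open>\<theta>\<close> would be left in the relation.\<close>
    then have "pdy \<theta> p * M = 0" using D[of "((0, 0), 1)"] by simp
    then show False using M0 bmD(4)[OF subsetD[OF S(2) p]] by simp
  qed
  have sym: "pd2 (pd1 \<tau>) z = pd1 (pd2 \<tau>) z" "pd2 (pd1 \<xi>) z = pd1 (pd2 \<xi>) z"
    using pd_commute[OF bmD(5) _ z] \<tau>\<xi> by auto
  define C where "C = pdz1 w p + w p * pdz2 w p + X3 p / X1 p * pdy w p"
  define T where "T = pd1 (pd1 \<tau>) z + 2 * w p * pd1 (pd2 \<tau>) z + w p ^ 2 * pd2 (pd2 \<tau>) z"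
  define Q where "Q = pd1 (pd1 \<xi>) z + 2 * w p * pd1 (pd2 \<xi>) z + w p ^ 2 * pd2 (pd2 \<xi>) z"
  define P where "P = a (\<phi> z) * \<theta> p ^ 3 + b (\<phi> z) * \<theta> p ^ 2 + c (\<phi> z) * \<theta> p + d (\<phi> z)"
  have MP: "M ^ 3 * P = a (\<phi> z) * N ^ 3 + b (\<phi> z) * N ^ 2 * M + c (\<phi> z) * N * M ^ 2 + d (\<phi> z) * M ^ 3"
    unfolding P_def \<theta>M[symmetric] by (simp add: algebra_simps power3_eq_cube power2_eq_square)
  \<comment> \<open>Evaluation along \<open>X / X1\<close>, whose components are \<open>1\<close>,
    \<open>w\<close> and \<open>X3 / X1\<close>; \<open>T\<close> and \<open>Q\<close> collect the
    second derivatives of \<open>\<tau>\<close> and \<open>\<xi>\<close> along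
    \<open>(1, w)\<close>.\<close>
  have "Q + C * pd2 \<xi> z = \<theta> p * (T + C * pd2 \<tau> z) + (pdz1 \<theta> p + w p * pdz2 \<theta> p + X3 p / X1 p * pdy \<theta> p) * M"
    using D[of "((1, w p), X3 p / X1 p)"] unfolding sym C_def T_def Q_def
    by (simp add: algebra_simps power2_eq_square)
  then have e1: "Q + C * pd2 \<xi> z = \<theta> p * (T + C * pd2 \<tau> z) + (M * P) * M"
    unfolding \<delta> P_def .
  then have "(Q + C * pd2 \<xi> z) * M = (\<theta> p * M) * (T + C * pd2 \<tau> z) + M ^ 3 * P"
    by (simp add: algebra_simps power3_eq_cube)
  then have "(M * pd2 \<xi> z - N * pd2 \<tau> z) * C = M ^ 3 * P + N * T - M * Q"
    unfolding \<theta>M by (simp add: algebra_simps)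
  \<comment> \<open>The terms with \<open>w\<close> cancel, so the factor in front of
    \<open>C\<close> is the Jacobian of \<open>\<phi>\<close> and depends on the base point
    only.\<close>
  moreover have "M * pd2 \<xi> z - N * pd2 \<tau> z = pd1 \<tau> z * pd2 \<xi> z - pd2 \<tau> z * pd1 \<xi> z"
    by (simp add: M_def N_def algebra_simps)
  ultimately show "(pd1 \<tau> z * pd2 \<xi> z - pd2 \<tau> z * pd1 \<xi> z) * (pdz1 w p + w p * pdz2 w p + X3 p / X1 p * pdy w p)
      = a (\<phi> z) * N ^ 3 + b (\<phi> z) * N ^ 2 * M + c (\<phi> z) * N * M ^ 2 + d (\<phi> z) * M ^ 3
        + N * (pd1 (pd1 \<tau>) z + 2 * w p * pd1 (pd2 \<tau>) z + w p ^ 2 * pd2 (pd2 \<tau>) z)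
        - M * (pd1 (pd1 \<xi>) z + 2 * w p * pd1 (pd2 \<xi>) z + w p ^ 2 * pd2 (pd2 \<xi>) z)"
    unfolding MP by (simp add: C_def T_def Q_def)
qed

section \<open>Equations equivalent to a cubic Burgers equation\<close>

lemma classical_solution_cong:
  assumes "\<And>z. z \<in> D \<Longrightarrow> u z = v z"
  shows "classical_solution E D u \<longleftrightarrow> classical_solution E D v"
proof (cases "open D")
  case True
  have "Ck_on 1 D u \<longleftrightarrow> Ck_on 1 D v" by (rule Ck_on_cong[OF True assms])
  moreover have "pd1 u z = pd1 v z" "pd2 u z = pd2 v z" if "z \<in> D" for z
    using pd1_cong[OF True that assms] pd2_cong[OF True that assms] by auto
  ultimately show ?thesis using assms by (auto simp: classical_solution_def)
qed (simp add: classical_solution_def)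

lemma smooth_near_open:
  assumes "smooth_near p f" "open T" "p \<in> T"
  obtains S where "open S" "p \<in> S" "S \<subseteq> T" "smooth_on S f"
proof -
  obtain S where "open S" "p \<in> S" "smooth_on S f" using assms(1) by (auto simp: smooth_near_def)
  then show thesis using that[of "S \<inter> T"] assms smooth_on_subset[of S f "S \<inter> T"] by auto
qed

lemma eventually_nonzero:
  fixes f :: "'a::euclidean_space \<Rightarrow> real"
  assumes "open S" "p \<in> S" "continuous_on S f" "f p \<noteq> 0"
  obtains T where "open T" "p \<in> T" "T \<subseteq> S" "\<And>q. q \<in> T \<Longrightarrow> f q \<noteq> 0"
proof -
  have "open (S \<inter> f -` (- {0}))"
    by (rule continuous_open_preimage[OF assms(3,1)]) auto
  then show thesis using that[of "S \<inter> f -` (- {0})"] assms by auto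
qed

lemma smooth_coefficients_nonzero:
  fixes X1 X2 X3 :: "plane \<times> real \<Rightarrow> real"
  assumes "smooth_near p X1" "smooth_near p X2" "smooth_near p X3" "X1 p \<noteq> 0" "open T" "p \<in> T"
  obtains S where "open S" "p \<in> S" "S \<subseteq> T" "smooth_on S X1" "smooth_on S X2" "smooth_on S X3"
    "\<And>q. q \<in> S \<Longrightarrow> X1 q \<noteq> 0"
proof -
  obtain S1 where S1: "open S1" "p \<in> S1" "S1 \<subseteq> T" "smooth_on S1 X1"
    by (rule smooth_near_open[OF assms(1,5,6)])
  obtain S2 where S2: "open S2" "p \<in> S2" "S2 \<subseteq> S1" "smooth_on S2 X2"
    by (rule smooth_near_open[OF assms(2) S1(1,2)])
  obtain S3 where S3: "open S3" "p \<in> S3" "S3 \<subseteq> S2" "smooth_on S3 X3"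
    by (rule smooth_near_open[OF assms(3) S2(1,2)])
  have X1: "smooth_on S3 X1" and X2: "smooth_on S3 X2"
    using S1 S2 S3 by (auto intro: smooth_on_subset)
  obtain S where "open S" "p \<in> S" "S \<subseteq> S3" "\<And>q. q \<in> S \<Longrightarrow> X1 q \<noteq> 0"
    by (rule eventually_nonzero[OF S3(1,2) smooth_on_continuous[OF X1] assms(4)]) (rule that)
  then show thesis
    using that[of S] S1 S2 S3 smooth_on_subset[OF X1] smooth_on_subset[OF X2] smooth_on_subset[OF S3(4)] by auto
qed

section \<open>Sufficiency in (1): the slope as new fiber coordinate\<close>

text \<open>The conditions are given only eventually near a point; one fixed open set on which all
  of them hold makes them usable along whole graphs.\<close>

definition cubic_region ::
    "(plane \<times> real \<Rightarrow> real) \<Rightarrow> (plane \<times> real \<Rightarrow> real) \<Rightarrow> (plane \<times> real \<Rightarrow> real) \<Rightarrow>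
     (plane \<Rightarrow> real) \<Rightarrow> (plane \<Rightarrow> real) \<Rightarrow> (plane \<Rightarrow> real) \<Rightarrow> (plane \<Rightarrow> real) \<Rightarrow> (plane \<times> real) set \<Rightarrow> bool" where
  "cubic_region X1 X2 X3 a b c d S \<longleftrightarrow> open S \<and> smooth_on S X1 \<and> smooth_on S X2 \<and> smooth_on S X3 \<and>
     (\<forall>p\<in>S. X1 p \<noteq> 0 \<and> pdy (slope X1 X2) p \<noteq> 0 \<and>
        pdz1 (slope X1 X2) p + slope X1 X2 p * pdz2 (slope X1 X2) p + X3 p / X1 p * pdy (slope X1 X2) p
        = a (fst p) * slope X1 X2 p ^ 3 + b (fst p) * slope X1 X2 p ^ 2 + c (fst p) * slope X1 X2 p + d (fst p))"

lemma cubic_region_exists: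
  assumes "smooth_near p X1" "smooth_near p X2" "smooth_near p X3" "X1 p \<noteq> 0"
    and "slope_y_nonzero_near X1 X2 p" "cubic_identity_near X1 X2 X3 p a b c d"
  obtains S where "p \<in> S" "cubic_region X1 X2 X3 a b c d S"
proof -
  have "\<forall>\<^sub>F q in nhds p. pdy (slope X1 X2) q \<noteq> 0 \<and>
        pdz1 (slope X1 X2) q + slope X1 X2 q * pdz2 (slope X1 X2) q + X3 q / X1 q * pdy (slope X1 X2) q
        = a (fst q) * slope X1 X2 q ^ 3 + b (fst q) * slope X1 X2 q ^ 2 + c (fst q) * slope X1 X2 q + d (fst q)"
    using assms(5,6) unfolding slope_y_nonzero_near_def cubic_identity_near_def Let_def
    by (intro eventually_conj) (auto simp: case_prod_unfold)
  then obtain T where T: "open T" "p \<in> T"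
    "\<And>q. q \<in> T \<Longrightarrow> pdy (slope X1 X2) q \<noteq> 0 \<and>
        pdz1 (slope X1 X2) q + slope X1 X2 q * pdz2 (slope X1 X2) q + X3 q / X1 q * pdy (slope X1 X2) q
        = a (fst q) * slope X1 X2 q ^ 3 + b (fst q) * slope X1 X2 q ^ 2 + c (fst q) * slope X1 X2 q + d (fst q)"
    unfolding eventually_nhds by (elim exE conjE) (simp only: simp_thms)
  obtain S where S: "open S" "p \<in> S" "S \<subseteq> T" "smooth_on S X1" "smooth_on S X2" "smooth_on S X3"
    "\<And>q. q \<in> S \<Longrightarrow> X1 q \<noteq> 0"
    by (rule smooth_coefficients_nonzero[OF assms(1-4) T(1,2)]) (rule that)
  have "cubic_region X1 X2 X3 a b c d S"
    unfolding cubic_region_def using S(1,4-7) T(3)[OF subsetD[OF S(3)]] by simp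
  then show thesis by (rule that[OF S(2)])
qed

text \<open>By the chain rule and the cubic identity, the defect of (B) for the slope along
  \<open>v\<close> is \<open>pdy w\<close> times the defect of (A) for \<open>v\<close>, the latter
  divided by \<open>X1\<close>; neither factor vanishes on the region.\<close>

lemma slope_solution_iff:
  assumes S: "cubic_region X1 X2 X3 a b c d S"
    and v: "open D" "Ck_on 1 D v" "graph_in S D v"
  shows "classical_solution (quasilinear_eq X1 X2 X3) D v \<longleftrightarrow>
    classical_solution (cubic_burgers_eq a b c d) D (\<lambda>z. slope X1 X2 (z, v z))"
proof -
  let ?w = "slope X1 X2"
  have oS: "open S" and X1: "\<And>p. p \<in> S \<Longrightarrow> X1 p \<noteq> 0" and wy: "\<And>p. p \<in> S \<Longrightarrow> pdy ?w p \<noteq> 0"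
    and id: "\<And>p. p \<in> S \<Longrightarrow> pdz1 ?w p + ?w p * pdz2 ?w p + X3 p / X1 p * pdy ?w p
        = a (fst p) * ?w p ^ 3 + b (fst p) * ?w p ^ 2 + c (fst p) * ?w p + d (fst p)"
    using S by (auto simp: cubic_region_def)
  have w: "smooth_on S ?w"
    using S by (intro smooth_on_slope) (auto simp: cubic_region_def)
  have gS: "(z, v z) \<in> S" if "z \<in> D" for z using v(3) that by (auto simp: graph_in_def)
  have C1: "Ck_on 1 D (\<lambda>z. ?w (z, v z))"
    using gS by (intro Ck_on_compose[OF v(1) oS smooth_on_Ck[OF w] Ck_on_Pair[OF v(1) Ck_on_linear[OF v(1) bounded_linear_ident] v(2)]]) auto
  have "quasilinear_eq X1 X2 X3 z (v z) (pd1 v z) (pd2 v z) \<longleftrightarrow>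
      cubic_burgers_eq a b c d z (?w (z, v z)) (pd1 (\<lambda>z. ?w (z, v z)) z) (pd2 (\<lambda>z. ?w (z, v z)) z)" if z: "z \<in> D" for z
  proof -
    let ?p = "(z, v z)"
    have "v differentiable at z" using v(2) z by (simp add: Ck_on.simps(2))
    from has_derivative_graph[OF smooth_on_differentiable[OF w gS[OF z]] this]
    have 1: "pd1 (\<lambda>z. ?w (z, v z)) z = pdz1 ?w ?p + pdy ?w ?p * pd1 v z"
      and 2: "pd2 (\<lambda>z. ?w (z, v z)) z = pdz2 ?w ?p + pdy ?w ?p * pd2 v z"
      by (simp_all add: pd1_eq pd2_eq)
    have "cubic_burgers_eq a b c d z (?w ?p) (pd1 (\<lambda>z. ?w (z, v z)) z) (pd2 (\<lambda>z. ?w (z, v z)) z) \<longleftrightarrow>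
        pdz1 ?w ?p + pdy ?w ?p * pd1 v z + ?w ?p * (pdz2 ?w ?p + pdy ?w ?p * pd2 v z)
        = pdz1 ?w ?p + ?w ?p * pdz2 ?w ?p + X3 ?p / X1 ?p * pdy ?w ?p"
      using id[OF gS[OF z]] by (simp add: cubic_burgers_eq_def 1 2)
    also have "\<dots> \<longleftrightarrow> pdy ?w ?p * (pd1 v z + ?w ?p * pd2 v z) = pdy ?w ?p * (X3 ?p / X1 ?p)"
      by (simp add: algebra_simps)
    also have "\<dots> \<longleftrightarrow> pd1 v z + ?w ?p * pd2 v z = X3 ?p / X1 ?p"
      using wy[OF gS[OF z]] by (subst mult_cancel_left) simp
    also have "\<dots> \<longleftrightarrow> quasilinear_eq X1 X2 X3 z (v z) (pd1 v z) (pd2 v z)"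
      using X1[OF gS[OF z]] by (simp add: slope_def quasilinear_eq_def field_simps)
    finally show ?thesis by simp
  qed
  then show ?thesis using v(1,2) C1 by (simp add: classical_solution_def)
qed

lemma bundle_map_recover:
  assumes "bundle_map \<phi> \<theta> U W"
  defines "F \<equiv> \<lambda>(z, y). (\<phi> z, \<theta> (z, y))"
  shows "open (F ` W)" "inj_on F W" "smooth_on (F ` W) (inv_into W F)"
    and "p \<in> F ` W \<Longrightarrow> fst p \<in> \<phi> ` U \<and> fst (inv_into W F p) = inv_into U \<phi> (fst p)
      \<and> \<theta> (inv_into W F p) = snd p \<and> inv_into W F p \<in> W"
proof -
  have F: "diffeo_on W F" using assms by (simp add: bundle_map_def)
  then show *: "open (F ` W)" "inj_on F W" "smooth_on (F ` W) (inv_into W F)" by (auto simp: diffeo_on_def)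
  assume "p \<in> F ` W"
  then obtain z y where p: "(z, y) \<in> W" "p = (\<phi> z, \<theta> (z, y))" by (auto simp: F_def)
  have "inv_into W F p = (z, y)" using inv_into_f_f[OF *(2) p(1)] p(2) by (simp add: F_def)
  moreover have "z \<in> U" "inj_on \<phi> U" using bundle_mapD[OF assms(1)] p(1) by auto
  ultimately show "fst p \<in> \<phi> ` U \<and> fst (inv_into W F p) = inv_into U \<phi> (fst p)
      \<and> \<theta> (inv_into W F p) = snd p \<and> inv_into W F p \<in> W"
    using p by simp
qed

lemma diffeo_on_ident: "diffeo_on UNIV (\<lambda>z. z)"
proof -
  have "inv_into UNIV (\<lambda>z :: 'a. z) = (\<lambda>z. z)" using inv_id by (simp add: id_def)
  then show ?thesis by (simp add: diffeo_on_def smooth_on_ident)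
qed

text \<open>The bundle map is the identity on the base with the slope as fiber coordinate, so the
  coefficients of the cubic are kept. The exchange of solutions is asserted for functions
  \<open>v\<close> of unknown regularity, which has to be recovered from that of the transformed
  function.\<close>

lemma cubic_region_equivalent:
  assumes S: "cubic_region X1 X2 X3 a b c d S" "p \<in> S"
    and sm: "smooth_near (fst p) a" "smooth_near (fst p) b" "smooth_near (fst p) c" "smooth_near (fst p) d"
  shows "equivalent_to_cubic_burgers (quasilinear_eq X1 X2 X3) p"
proof -
  let ?w = "slope X1 X2" and ?id = "\<lambda>z :: plane. z"
  have w: "smooth_on S ?w" and oS: "open S"
    using S(1) by (auto simp: cubic_region_def intro!: smooth_on_slope)
  have id: "inv_into UNIV ?id = ?id" using inv_id by (simp add: id_def)
  obtain W where W: "W \<subseteq> S" "p \<in> W" "bundle_map ?id ?w UNIV W"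
    by (rule bundle_map_exists[OF diffeo_on_ident oS _ w S(2)]) (use S(1) in \<open>auto simp: cubic_region_def\<close>)
  let ?F = "\<lambda>(z, y). (z, ?w (z, y))"
  note rec = bundle_map_recover[OF W(3)]
  have push: "push ?id ?w UNIV v = (\<lambda>z. ?w (z, v z))" for v by (simp add: push_def id)
  have "exchanges_solutions (quasilinear_eq X1 X2 X3) (cubic_burgers_eq a b c d) ?id ?w UNIV W"
    unfolding exchanges_solutions_def
  proof (intro allI impI)
    fix D v assume D: "open D \<and> graph_in W D v"
    let ?u = "\<lambda>z. ?w (z, v z)"
    have gW: "(z, v z) \<in> W" if "z \<in> D" for z using D that by (auto simp: graph_in_def)
    have iff: "classical_solution (quasilinear_eq X1 X2 X3) D v \<longleftrightarrow> classical_solution (cubic_burgers_eq a b c d) D ?u"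
      if "Ck_on 1 D v"
      using D W(1) by (intro slope_solution_iff[OF S(1) _ that]) (auto simp: graph_in_def)
    have "Ck_on 1 D v" if "classical_solution (cubic_burgers_eq a b c d) D ?u"
    proof -
      have u1: "Ck_on 1 D ?u" using that by (simp add: classical_solution_def)
      \<comment> \<open>\<open>v\<close> is the fiber component of the smooth inverse of the total
        map, applied to the graph of the transformed function.\<close>
      have "Ck_on 1 D (\<lambda>z. inv_into W ?F (z, ?u z))"
        using gW D by (intro Ck_on_compose[OF _ rec(1) smooth_on_Ck[OF rec(3)] Ck_on_Pair[OF _ Ck_on_linear[OF _ bounded_linear_ident] u1]])
          (auto intro!: rev_image_eqI)
      from Ck_on_linear_compose[OF _ bounded_linear_snd this] have *: "Ck_on 1 D (\<lambda>z. snd (inv_into W ?F (z, ?u z)))"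
        using D by simp
      have "snd (inv_into W ?F (z, ?u z)) = v z" if "z \<in> D" for z
        using inv_into_f_f[OF rec(2) gW[OF that]] by simp
      then show ?thesis using * Ck_on_cong[of D "\<lambda>z. snd (inv_into W ?F (z, ?u z))" v 1] D by blast
    qed
    then show "classical_solution (quasilinear_eq X1 X2 X3) D v \<longleftrightarrow>
        classical_solution (cubic_burgers_eq a b c d) (?id ` D) (push ?id ?w UNIV v)"
      unfolding push image_ident using iff by (auto simp: classical_solution_def)
  qed
  then show ?thesis
    unfolding equivalent_to_cubic_burgers_def using W sm by blast
qed

lemma exchanges_imp_maps:
  assumes "exchanges_solutions E F \<phi> \<theta> U W"
  shows "maps_solutions E F \<phi> \<theta> U W"
  unfolding maps_solutions_def
proof (intro allI impI)
  fix D u assume "graph_in W D u \<and> classical_solution E D u"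
  then show "classical_solution F (\<phi> ` D) (push \<phi> \<theta> U u)"
    using assms[unfolded exchanges_solutions_def, rule_format, of D u] by (simp add: classical_solution_def[of E])
qed

lemma equivalent_imp_transformable:
  assumes "equivalent_to_cubic_burgers E p"
  shows "transformable_to_cubic_burgers E p"
  using assms unfolding equivalent_to_cubic_burgers_def transformable_to_cubic_burgers_def
  by (elim exE conjE) (intro exI conjI exchanges_imp_maps; assumption)

section \<open>Necessity in (1): transformation law of the cubic\<close>

text \<open>Sorting by powers of \<open>w\<close>, with the partial derivatives of
  \<open>\<tau>\<close> and \<open>\<xi>\<close> replaced by independent numbers \<open>t1\<close>,
  \<open>x1\<close> and so on. In part (1) these coefficients yield the new right-hand side; in part
  (2) they are compared with the given one.\<close>

lemma cubic_expansion:
  fixes a b c d t1 t2 t11 t12 t22 x1 x2 x11 x12 x22 w :: real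
  defines "N \<equiv> x1 + w * x2" and "M \<equiv> t1 + w * t2"
  shows "a * N ^ 3 + b * N ^ 2 * M + c * N * M ^ 2 + d * M ^ 3
      + N * (t11 + 2 * w * t12 + w ^ 2 * t22) - M * (x11 + 2 * w * x12 + w ^ 2 * x22)
    = (a * x2 ^ 3 + b * x2 ^ 2 * t2 + c * x2 * t2 ^ 2 + d * t2 ^ 3 + x2 * t22 - t2 * x22) * w ^ 3
    + (3 * a * x1 * x2 ^ 2 + b * (x2 ^ 2 * t1 + 2 * x1 * x2 * t2) + c * (2 * x2 * t1 * t2 + x1 * t2 ^ 2) + 3 * d * t1 * t2 ^ 2
        + x1 * t22 + 2 * x2 * t12 - t1 * x22 - 2 * t2 * x12) * w ^ 2
    + (3 * a * x1 ^ 2 * x2 + b * (2 * x1 * x2 * t1 + x1 ^ 2 * t2) + c * (x2 * t1 ^ 2 + 2 * x1 * t1 * t2) + 3 * d * t1 ^ 2 * t2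
        + 2 * x1 * t12 + x2 * t11 - 2 * t1 * x12 - t2 * x11) * w
    + (a * x1 ^ 3 + b * x1 ^ 2 * t1 + c * x1 * t1 ^ 2 + d * t1 ^ 3 + x1 * t11 - t1 * x11)"
  unfolding N_def M_def by (simp add: algebra_simps power2_eq_square power3_eq_cube)

text \<open>The coefficients of the expanded cubic depend on the base point only; divided by the
  Jacobian of \<open>\<phi>\<close> they are the functions of the cubic identity. They are smooth
  where \<open>\<phi>\<close> takes values in a common domain of smoothness of the coefficients of
  the target equation.\<close>

lemma transformable_conditions:
  assumes sm: "smooth_near p X1" "smooth_near p X2" "smooth_near p X3" "X1 p \<noteq> 0"
    and "transformable_to_cubic_burgers (quasilinear_eq X1 X2 X3) p"
  shows "slope_y_nonzero_near X1 X2 p \<and> (\<exists>a b c d. cubic_identity_near X1 X2 X3 p a b c d)"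
proof -
  obtain \<phi> \<theta> U W a b c d where bm: "bundle_map \<phi> \<theta> U W" and pW: "p \<in> W"
    and smn: "smooth_near (\<phi> (fst p)) a" "smooth_near (\<phi> (fst p)) b" "smooth_near (\<phi> (fst p)) c" "smooth_near (\<phi> (fst p)) d"
    and maps: "maps_solutions (quasilinear_eq X1 X2 X3) (cubic_burgers_eq a b c d) \<phi> \<theta> U W"
    using assms(5) unfolding transformable_to_cubic_burgers_def by (elim exE conjE)
  note bmD = bundle_mapD[OF bm]
  obtain S where S: "open S" "p \<in> S" "S \<subseteq> W" "smooth_on S X1" "smooth_on S X2" "smooth_on S X3"
    "\<And>q. q \<in> S \<Longrightarrow> X1 q \<noteq> 0"
    by (rule smooth_coefficients_nonzero[OF sm bmD(1) pW]) (rule that)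
  have "\<forall>q\<in>S. X1 q \<noteq> 0" using S(7) by blast
  note ts = transformed_slope[OF bm maps S(1,3-6) this]
  obtain Na where Na: "open Na" "\<phi> (fst p) \<in> Na" "smooth_on Na a" using smn(1) by (auto simp: smooth_near_def)
  obtain Nb where Nb: "open Nb" "\<phi> (fst p) \<in> Nb" "Nb \<subseteq> Na" "smooth_on Nb b" by (rule smooth_near_open[OF smn(2) Na(1,2)])
  obtain Nc where Nc: "open Nc" "\<phi> (fst p) \<in> Nc" "Nc \<subseteq> Nb" "smooth_on Nc c" by (rule smooth_near_open[OF smn(3) Nb(1,2)])
  obtain Nd where Nd: "open Nd" "\<phi> (fst p) \<in> Nd" "Nd \<subseteq> Nc" "smooth_on Nd d" by (rule smooth_near_open[OF smn(4) Nc(1,2)])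
  define T where "T = U \<inter> \<phi> -` Nd"
  have oT: "open T" unfolding T_def
    by (rule continuous_open_preimage[OF smooth_on_continuous[OF bmD(8)] bmD(5) Nd(1)])
  have pT: "fst p \<in> T" using pW bmD(2) Nd(2) by (auto simp: T_def)
  have "smooth_on T \<phi>" using bmD(8) by (rule smooth_on_subset) (auto simp: T_def)
  then have comp: "smooth_on T (\<lambda>z. f (\<phi> z))" if "smooth_on Nd f" for f :: "plane \<Rightarrow> real"
    using smooth_on_compose[OF oT Nd(1) that] by (auto simp: T_def)
  have abcd: "smooth_on T (\<lambda>z. a (\<phi> z))" "smooth_on T (\<lambda>z. b (\<phi> z))" "smooth_on T (\<lambda>z. c (\<phi> z))" "smooth_on T (\<lambda>z. d (\<phi> z))"
    by (rule comp, rule smooth_on_subset, (rule Na(3) Nb(4) Nc(4) Nd(4)), use Nb(3) Nc(3) Nd(3) in blast)+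
  define \<tau> where "\<tau> = (\<lambda>z. fst (\<phi> z))"
  define \<xi> where "\<xi> = (\<lambda>z. snd (\<phi> z))"
  have \<tau>\<xi>: "smooth_on T \<tau>" "smooth_on T \<xi>"
    unfolding \<tau>_def \<xi>_def using \<open>smooth_on T \<phi>\<close> oT by (auto intro!: smooth_on_fst smooth_on_snd)
  define J where "J = (\<lambda>z. pd1 \<tau> z * pd2 \<xi> z - pd2 \<tau> z * pd1 \<xi> z)"
  have J0: "J z \<noteq> 0" if "z \<in> U" for z
    using diffeo_on_jacobian[of U \<phi> z] bm that by (simp add: bundle_map_def J_def \<tau>_def \<xi>_def)
  have J: "smooth_on T J" "\<And>z. z \<in> T \<Longrightarrow> J z \<noteq> 0"
  proof -
    show "smooth_on T J" unfolding J_def by (intro smooth_intros \<tau>\<xi> oT)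
    show "J z \<noteq> 0" if "z \<in> T" for z using that by (intro J0) (simp add: T_def)
  qed
  let ?t1 = "\<lambda>z. pd1 \<tau> z" and ?t2 = "\<lambda>z. pd2 \<tau> z" and ?x1 = "\<lambda>z. pd1 \<xi> z" and ?x2 = "\<lambda>z. pd2 \<xi> z"
  let ?t11 = "\<lambda>z. pd1 (pd1 \<tau>) z" and ?t12 = "\<lambda>z. pd1 (pd2 \<tau>) z" and ?t22 = "\<lambda>z. pd2 (pd2 \<tau>) z"
  let ?x11 = "\<lambda>z. pd1 (pd1 \<xi>) z" and ?x12 = "\<lambda>z. pd1 (pd2 \<xi>) z" and ?x22 = "\<lambda>z. pd2 (pd2 \<xi>) z"
  let ?a = "\<lambda>z. a (\<phi> z)" and ?b = "\<lambda>z. b (\<phi> z)" and ?c = "\<lambda>z. c (\<phi> z)" and ?d = "\<lambda>z. d (\<phi> z)"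
  define A where "A = (\<lambda>z. (?a z * ?x2 z ^ 3 + ?b z * ?x2 z ^ 2 * ?t2 z + ?c z * ?x2 z * ?t2 z ^ 2 + ?d z * ?t2 z ^ 3
    + ?x2 z * ?t22 z - ?t2 z * ?x22 z) / J z)"
  define B where "B = (\<lambda>z. (3 * ?a z * ?x1 z * ?x2 z ^ 2 + ?b z * (?x2 z ^ 2 * ?t1 z + 2 * ?x1 z * ?x2 z * ?t2 z)
    + ?c z * (2 * ?x2 z * ?t1 z * ?t2 z + ?x1 z * ?t2 z ^ 2) + 3 * ?d z * ?t1 z * ?t2 z ^ 2
    + ?x1 z * ?t22 z + 2 * ?x2 z * ?t12 z - ?t1 z * ?x22 z - 2 * ?t2 z * ?x12 z) / J z)"
  define C where "C = (\<lambda>z. (3 * ?a z * ?x1 z ^ 2 * ?x2 z + ?b z * (2 * ?x1 z * ?x2 z * ?t1 z + ?x1 z ^ 2 * ?t2 z)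
    + ?c z * (?x2 z * ?t1 z ^ 2 + 2 * ?x1 z * ?t1 z * ?t2 z) + 3 * ?d z * ?t1 z ^ 2 * ?t2 z
    + 2 * ?x1 z * ?t12 z + ?x2 z * ?t11 z - 2 * ?t1 z * ?x12 z - ?t2 z * ?x11 z) / J z)"
  define D where "D = (\<lambda>z. (?a z * ?x1 z ^ 3 + ?b z * ?x1 z ^ 2 * ?t1 z + ?c z * ?x1 z * ?t1 z ^ 2 + ?d z * ?t1 z ^ 3
    + ?x1 z * ?t11 z - ?t1 z * ?x11 z) / J z)"
  have A: "smooth_on T A" unfolding A_def by (intro smooth_intros oT \<tau>\<xi> J(1) abcd) (rule J(2))
  have B: "smooth_on T B" unfolding B_def by (intro smooth_intros oT \<tau>\<xi> J(1) abcd) (rule J(2))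
  have C: "smooth_on T C" unfolding C_def by (intro smooth_intros oT \<tau>\<xi> J(1) abcd) (rule J(2))
  have D: "smooth_on T D" unfolding D_def by (intro smooth_intros oT \<tau>\<xi> J(1) abcd) (rule J(2))
  have id: "pdz1 (slope X1 X2) q + slope X1 X2 q * pdz2 (slope X1 X2) q + X3 q / X1 q * pdy (slope X1 X2) q
      = A (fst q) * slope X1 X2 q ^ 3 + B (fst q) * slope X1 X2 q ^ 2 + C (fst q) * slope X1 X2 q + D (fst q)" if q: "q \<in> S" for q
  proof -
    have "fst q \<in> U" using q S(3) bmD(2) by auto
    note J0[OF this]
    moreover have "J (fst q) * (pdz1 (slope X1 X2) q + slope X1 X2 q * pdz2 (slope X1 X2) q + X3 q / X1 q * pdy (slope X1 X2) q)
      = (J (fst q) * A (fst q)) * slope X1 X2 q ^ 3 + (J (fst q) * B (fst q)) * slope X1 X2 q ^ 2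
        + (J (fst q) * C (fst q)) * slope X1 X2 q + J (fst q) * D (fst q)"
    proof -
      have cancel: "J (fst q) * (x / J (fst q)) = x" for x using \<open>J (fst q) \<noteq> 0\<close> by simp
      show ?thesis
        unfolding A_def B_def C_def D_def cancel unfolding J_def
        by (rule trans[OF ts(2)[OF q, folded \<tau>_def \<xi>_def] cubic_expansion])
    qed
    then have "J (fst q) * (pdz1 (slope X1 X2) q + slope X1 X2 q * pdz2 (slope X1 X2) q + X3 q / X1 q * pdy (slope X1 X2) q)
      = J (fst q) * (A (fst q) * slope X1 X2 q ^ 3 + B (fst q) * slope X1 X2 q ^ 2 + C (fst q) * slope X1 X2 q + D (fst q))"
      by (simp only: distrib_left mult.assoc)
    ultimately show ?thesis by simp
  qed
  have "\<forall>\<^sub>F q in nhds p. pdz1 (slope X1 X2) q + slope X1 X2 q * pdz2 (slope X1 X2) q + X3 q / X1 q * pdy (slope X1 X2) q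
      = A (fst q) * slope X1 X2 q ^ 3 + B (fst q) * slope X1 X2 q ^ 2 + C (fst q) * slope X1 X2 q + D (fst q)"
    unfolding eventually_nhds using S(1,2) id by (intro exI[of _ S] conjI ballI)
  moreover have "smooth_near (fst p) A" "smooth_near (fst p) B" "smooth_near (fst p) C" "smooth_near (fst p) D"
    unfolding smooth_near_def using oT pT A B C D by blast+
  ultimately have "cubic_identity_near X1 X2 X3 p A B C D"
    by (simp add: cubic_identity_near_def Let_def case_prod_unfold)
  moreover have "slope_y_nonzero_near X1 X2 p"
    unfolding slope_y_nonzero_near_def eventually_nhds using ts(1) S(1,2) by (intro exI[of _ S] conjI ballI)
  ultimately show ?thesis by blast
qed

section \<open>Renaming the base coordinates\<close>

text \<open>The swap of the base coordinates and its lift to the total space are both linear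
  involutions, so precomposition with them is treated at once. Images under \<open>L\<close> are
  preimages, and the new inverse is the old one followed by \<open>L\<close>.\<close>

lemma diffeo_on_compose_involution:
  fixes L :: "'a::euclidean_space \<Rightarrow> 'a"
  assumes f: "diffeo_on U f" and L: "bounded_linear L" "\<And>x. L (L x) = x"
  shows "diffeo_on (L ` U) (\<lambda>x. f (L x))"
    and "y \<in> f ` U \<Longrightarrow> inv_into (L ` U) (\<lambda>x. f (L x)) y = L (inv_into U f y)"
proof -
  have U: "open U" "inj_on f U" "open (f ` U)" "smooth_on U f" "smooth_on (f ` U) (inv_into U f)"
    using f by (auto simp: diffeo_on_def)
  have "L ` U = L -` U" using L(2) by (auto simp: image_iff) (metis L(2))
  then have o: "open (L ` U)" using open_vimage[OF U(1)] linear_continuous_on[OF L(1)] by metis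
  have img: "(\<lambda>x. f (L x)) ` L ` U = f ` U" by (simp add: image_image L(2))
  have inj: "inj_on (\<lambda>x. f (L x)) (L ` U)" using U(2) by (auto simp: inj_on_def L(2))
  have sm: "smooth_on (L ` U) (\<lambda>x. f (L x))"
    by (rule smooth_on_compose[OF o U(1,4) smooth_on_linear[OF o L(1)]]) (auto simp: L(2))
  have inv: "inv_into (L ` U) (\<lambda>x. f (L x)) y = L (inv_into U f y)" if "y \<in> f ` U" for y
  proof (rule inv_into_f_eq[OF inj])
    show "L (inv_into U f y) \<in> L ` U" using that by (intro imageI inv_into_into)
    show "f (L (L (inv_into U f y))) = y" using that by (simp add: L(2) f_inv_into_f)
  qed
  then show "y \<in> f ` U \<Longrightarrow> inv_into (L ` U) (\<lambda>x. f (L x)) y = L (inv_into U f y)" .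
  have "smooth_on (f ` U) (inv_into (L ` U) (\<lambda>x. f (L x))) \<longleftrightarrow> smooth_on (f ` U) (\<lambda>y. L (inv_into U f y))"
    by (rule smooth_on_cong[OF U(3) inv])
  then show "diffeo_on (L ` U) (\<lambda>x. f (L x))"
    unfolding diffeo_on_def img using o inj U(3) sm smooth_on_linear_compose[OF U(3) L(1) U(5)] by simp
qed

lemma bounded_linear_swap: "bounded_linear (prod.swap :: 'a::real_normed_vector \<times> 'b::real_normed_vector \<Rightarrow> _)"
  using bounded_linear_Pair[OF bounded_linear_snd bounded_linear_fst] by (simp add: prod.swap_def[abs_def])

definition swap_total :: "plane \<times> real \<Rightarrow> plane \<times> real" where
  "swap_total p = (prod.swap (fst p), snd p)"

lemma swap_total: "bounded_linear swap_total" "swap_total (swap_total p) = p"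
  unfolding swap_total_def[abs_def]
  by (auto intro!: bounded_linear_Pair bounded_linear_compose[OF bounded_linear_swap] bounded_linear_fst bounded_linear_snd)

lemma swap_base_swap_total: "swap_base X = (\<lambda>p. X (swap_total p))"
  by (simp add: swap_base_def swap_total_def fun_eq_iff)

lemma swap_base_swap_base [simp]: "swap_base (swap_base X) = X"
  by (simp add: swap_base_swap_total swap_total)

lemma open_swap_image: "open D \<Longrightarrow> open (prod.swap ` D)" for D :: "plane set"
proof -
  assume "open D"
  moreover have "prod.swap ` D = prod.swap -` D" by (force simp: image_iff)
  ultimately show ?thesis using open_vimage[OF _ continuous_on_swap] by metis
qed

lemma open_swap_total_image: "open S \<Longrightarrow> open (swap_total ` S)"
proof -
  assume "open S"
  moreover have "swap_total ` S = swap_total -` S" using swap_total(2) by (auto simp: image_iff) (metis swap_total(2))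
  ultimately show ?thesis using open_vimage[OF _ linear_continuous_on[OF swap_total(1)]] by metis
qed

lemma smooth_near_swap_base:
  assumes "smooth_near (z, y) X"
  shows "smooth_near (prod.swap z, y) (swap_base X)"
proof -
  obtain S where S: "open S" "(z, y) \<in> S" "smooth_on S X" using assms by (auto simp: smooth_near_def)
  note o = open_swap_total_image[OF S(1)]
  have "smooth_on (swap_total ` S) (\<lambda>p. X (swap_total p))"
    by (rule smooth_on_compose[OF o S(1,3) smooth_on_linear[OF o swap_total(1)]]) (auto simp: swap_total)
  moreover have "(prod.swap z, y) \<in> swap_total ` S" using S(2) by (force simp: swap_total_def)
  ultimately show ?thesis using o by (auto simp: smooth_near_def swap_base_swap_total)
qed

lemma swapped_solution:
  assumes "classical_solution (quasilinear_eq (swap_base X2) (swap_base X1) (swap_base X3)) D v"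
  shows "classical_solution (quasilinear_eq X1 X2 X3) (prod.swap ` D) (\<lambda>z. v (prod.swap z))"
proof -
  have D: "open D" "Ck_on 1 D v" using assms by (auto simp: classical_solution_def)
  note o = open_swap_image[OF D(1)]
  have "Ck_on 1 (prod.swap ` D) (\<lambda>z. v (prod.swap z))"
    by (rule Ck_on_compose[OF o D Ck_on_linear[OF o bounded_linear_swap]]) auto
  moreover have "quasilinear_eq X1 X2 X3 z (v (prod.swap z)) (pd1 (\<lambda>z. v (prod.swap z)) z) (pd2 (\<lambda>z. v (prod.swap z)) z)"
    if "z \<in> prod.swap ` D" for z
  proof -
    have z: "prod.swap z \<in> D" using that by auto
    have "((\<lambda>z. v (prod.swap z)) has_derivative (\<lambda>h. fst (prod.swap h) * pd1 v (prod.swap z) + snd (prod.swap h) * pd2 v (prod.swap z))) (at z)"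
      by (rule has_derivative_compose[OF bounded_linear_imp_has_derivative[OF bounded_linear_swap]
          has_derivative_pd[OF classical_solution_differentiable[OF assms z]]])
    then have "pd1 (\<lambda>z. v (prod.swap z)) z = pd2 v (prod.swap z)" "pd2 (\<lambda>z. v (prod.swap z)) z = pd1 v (prod.swap z)"
      by (simp_all add: pd1_eq pd2_eq)
    moreover have "quasilinear_eq (swap_base X2) (swap_base X1) (swap_base X3) (prod.swap z) (v (prod.swap z))
        (pd1 v (prod.swap z)) (pd2 v (prod.swap z))"
      using assms z by (auto simp: classical_solution_def)
    ultimately show ?thesis by (simp add: quasilinear_eq_def swap_base_def)
  qed
  ultimately show ?thesis using o by (simp add: classical_solution_def)
qed

text \<open>Swapping twice is the identity on coefficients and on functions, so one direction,
  applied to the swapped data, gives the other.\<close>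

lemma swapped_solution_iff:
  "classical_solution (quasilinear_eq (swap_base X2) (swap_base X1) (swap_base X3)) D v \<longleftrightarrow>
    classical_solution (quasilinear_eq X1 X2 X3) (prod.swap ` D) (\<lambda>z. v (prod.swap z))" (is "?L \<longleftrightarrow> ?R")
proof
  assume ?R
  then have "classical_solution (quasilinear_eq (swap_base (swap_base X1)) (swap_base (swap_base X2)) (swap_base (swap_base X3)))
      (prod.swap ` D) (\<lambda>z. v (prod.swap z))" by simp
  from swapped_solution[OF this] show ?L by (simp add: image_image)
qed (rule swapped_solution)

text \<open>Only the source is renamed: base map and fiber map are precomposed with the swap, while
  the target equation and its coefficients stay the same.\<close>

lemma equivalent_swap:
  assumes "equivalent_to_cubic_burgers (quasilinear_eq X1 X2 X3) (z0, y0)"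
  shows "equivalent_to_cubic_burgers (quasilinear_eq (swap_base X2) (swap_base X1) (swap_base X3)) (prod.swap z0, y0)"
proof -
  obtain \<phi> \<theta> U W a b c d where bm: "bundle_map \<phi> \<theta> U W" and p: "(z0, y0) \<in> W"
    and sm: "smooth_near (\<phi> z0) a" "smooth_near (\<phi> z0) b" "smooth_near (\<phi> z0) c" "smooth_near (\<phi> z0) d"
    and ex: "exchanges_solutions (quasilinear_eq X1 X2 X3) (cubic_burgers_eq a b c d) \<phi> \<theta> U W"
    using assms unfolding equivalent_to_cubic_burgers_def fst_conv by (elim exE conjE)
  note bmD = bundle_mapD[OF bm]
  let ?\<phi> = "\<lambda>z. \<phi> (prod.swap z)" and ?\<theta> = "\<lambda>p. \<theta> (swap_total p)"
  let ?U = "prod.swap ` U" and ?W = "swap_total ` W"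
  have \<phi>: "diffeo_on U \<phi>" and F: "diffeo_on W (\<lambda>(z, y). (\<phi> z, \<theta> (z, y)))"
    using bm by (auto simp: bundle_map_def)
  note \<phi>' = diffeo_on_compose_involution[OF \<phi> bounded_linear_swap swap_swap]
  have "(\<lambda>(z, y). (?\<phi> z, ?\<theta> (z, y))) = (\<lambda>p. (\<lambda>(z, y). (\<phi> z, \<theta> (z, y))) (swap_total p))"
    by (simp add: swap_total_def fun_eq_iff)
  then have "diffeo_on ?W (\<lambda>(z, y). (?\<phi> z, ?\<theta> (z, y)))"
    using diffeo_on_compose_involution(1)[OF F swap_total] by simp
  moreover have "?W \<subseteq> ?U \<times> UNIV" using bmD(2) by (auto simp: swap_total_def)
  ultimately have bm': "bundle_map ?\<phi> ?\<theta> ?U ?W" using \<phi>'(1) by (simp add: bundle_map_def)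
  have "exchanges_solutions (quasilinear_eq (swap_base X2) (swap_base X1) (swap_base X3)) (cubic_burgers_eq a b c d) ?\<phi> ?\<theta> ?U ?W"
    unfolding exchanges_solutions_def
  proof (intro allI impI)
    fix D v assume D: "open D \<and> graph_in ?W D v"
    let ?D = "prod.swap ` D" and ?v = "\<lambda>z. v (prod.swap z)"
    have g: "(z, ?v z) \<in> W" if "z \<in> ?D" for z
    proof -
      have "(prod.swap z, ?v z) \<in> ?W" using D that by (auto simp: graph_in_def)
      then have "swap_total (prod.swap z, ?v z) \<in> W" using swap_total(2) by force
      then show ?thesis by (simp add: swap_total_def)
    qed
    have "classical_solution (quasilinear_eq X1 X2 X3) ?D ?v \<longleftrightarrow>
        classical_solution (cubic_burgers_eq a b c d) (\<phi> ` ?D) (push \<phi> \<theta> U ?v)"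
      using ex[unfolded exchanges_solutions_def, rule_format, of ?D ?v] D g open_swap_image by (simp add: graph_in_def)
    also have "\<dots> \<longleftrightarrow> classical_solution (cubic_burgers_eq a b c d) (\<phi> ` ?D) (push ?\<phi> ?\<theta> ?U v)"
    proof (rule classical_solution_cong)
      fix z assume "z \<in> \<phi> ` ?D"
      then have "z \<in> \<phi> ` U" using g bmD(2) by auto
      from \<phi>'(2)[OF this] show "push \<phi> \<theta> U ?v z = push ?\<phi> ?\<theta> ?U v z"
        by (simp add: push_def swap_total_def)
    qed
    finally show "classical_solution (quasilinear_eq (swap_base X2) (swap_base X1) (swap_base X3)) D v \<longleftrightarrow>
        classical_solution (cubic_burgers_eq a b c d) (?\<phi> ` D) (push ?\<phi> ?\<theta> ?U v)"
      by (simp add: swapped_solution_iff image_image)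
  qed
  moreover have "(prod.swap z0, y0) \<in> ?W" using p by (force simp: swap_total_def)
  moreover have "smooth_near (?\<phi> (prod.swap z0)) a" "smooth_near (?\<phi> (prod.swap z0)) b"
    "smooth_near (?\<phi> (prod.swap z0)) c" "smooth_near (?\<phi> (prod.swap z0)) d" using sm by simp_all
  ultimately show ?thesis
    using bm' unfolding equivalent_to_cubic_burgers_def fst_conv by (intro exI conjI)
qed

text \<open>If \<open>X\<^sup>1\<close> and \<open>X\<^sup>2\<close> vanish at a point where \<open>X\<^sup>3\<close> does not, the equation has no solution through
  that point, whereas the transformed equation has one.\<close>

lemma equivalent_imp_noncharacteristic:
  assumes "equivalent_to_cubic_burgers (quasilinear_eq X1 X2 X3) (z0, y0)" "X1 (z0, y0) = 0" "X2 (z0, y0) = 0"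
  shows "X3 (z0, y0) = 0"
proof -
  obtain \<phi> \<theta> U W a b c d where bm: "bundle_map \<phi> \<theta> U W" and p: "(z0, y0) \<in> W"
    and sm: "smooth_near (\<phi> z0) a" "smooth_near (\<phi> z0) b" "smooth_near (\<phi> z0) c" "smooth_near (\<phi> z0) d"
    and ex: "exchanges_solutions (quasilinear_eq X1 X2 X3) (cubic_burgers_eq a b c d) \<phi> \<theta> U W"
    using assms(1) unfolding equivalent_to_cubic_burgers_def fst_conv by (elim exE conjE)
  note bmD = bundle_mapD[OF bm]
  let ?F = "\<lambda>(z, y). (\<phi> z, \<theta> (z, y))"
  note rec = bundle_map_recover[OF bm]
  obtain Na where Na: "open Na" "\<phi> z0 \<in> Na" "smooth_on Na a" using sm(1) by (auto simp: smooth_near_def)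
  obtain Nb where Nb: "open Nb" "\<phi> z0 \<in> Nb" "Nb \<subseteq> Na" "smooth_on Nb b" by (rule smooth_near_open[OF sm(2) Na(1,2)])
  obtain Nc where Nc: "open Nc" "\<phi> z0 \<in> Nc" "Nc \<subseteq> Nb" "smooth_on Nc c" by (rule smooth_near_open[OF sm(3) Nb(1,2)])
  obtain Nd where Nd: "open Nd" "\<phi> z0 \<in> Nd" "Nd \<subseteq> Nc" "smooth_on Nd d" by (rule smooth_near_open[OF sm(4) Nc(1,2)])
  define T where "T = ?F ` W \<inter> Nd \<times> UNIV"
  have oT: "open T" unfolding T_def using rec(1) Nd(1) by (intro open_Int open_Times) auto
  have pT: "(\<phi> z0, \<theta> (z0, y0)) \<in> T" using p Nd(2) by (force simp: T_def)
  have base: "smooth_on T (\<lambda>p. f (fst p))" if "smooth_on Nd f" for f :: "plane \<Rightarrow> real"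
    by (rule smooth_on_compose[OF oT Nd(1) that smooth_on_fst[OF oT smooth_on_ident[OF oT]]]) (auto simp: T_def)
  have abcd: "smooth_on T (\<lambda>p. a (fst p))" "smooth_on T (\<lambda>p. b (fst p))" "smooth_on T (\<lambda>p. c (fst p))" "smooth_on T (\<lambda>p. d (fst p))"
    by (rule base, rule smooth_on_subset, (rule Na(3) Nb(4) Nc(4) Nd(4)), use Nb(3) Nc(3) Nd(3) in blast)+
  let ?P = "\<lambda>p. a (fst p) * snd p ^ 3 + b (fst p) * snd p ^ 2 + c (fst p) * snd p + d (fst p)"
  have P: "smooth_on T ?P" by (intro smooth_intros abcd oT)
  have s: "smooth_on T snd" by (rule smooth_on_linear[OF oT bounded_linear_snd])
  obtain D' u where u: "\<phi> z0 \<in> D'" "graph_in T D' u" "u (\<phi> z0) = \<theta> (z0, y0)"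
    "classical_solution (quasilinear_eq (\<lambda>_. 1) snd ?P) D' u" "0 * pd1 u (\<phi> z0) + 1 * pd2 u (\<phi> z0) = 0"
    by (rule quasilinear_local_solution[of T "\<phi> z0" "\<theta> (z0, y0)" "\<lambda>_. 1" snd ?P 1 0 0,
      OF oT pT Ck_on_const smooth_on_Ck[OF s] smooth_on_Ck[OF P]]) (simp, rule that)
  define D where "D = U \<inter> \<phi> -` D'"
  \<comment> \<open>The solution \<open>u\<close> is pulled back through the inverse of the total
    map. The base component of that inverse at \<open>(\<phi> z, u (\<phi> z))\<close> is
    \<open>z\<close> again, so the preimage of the graph of \<open>u\<close> is a graph over
    \<open>D\<close>.\<close>
  define v where "v = (\<lambda>z. snd (inv_into W ?F (\<phi> z, u (\<phi> z))))"
  have oD: "open D" unfolding D_def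
    using u(4) by (intro continuous_open_preimage[OF smooth_on_continuous[OF bmD(8)] bmD(5)]) (simp add: classical_solution_def)
  have gD: "inv_into W ?F (\<phi> z, u (\<phi> z)) = (z, v z) \<and> (z, v z) \<in> W \<and> \<theta> (z, v z) = u (\<phi> z)" if "z \<in> D" for z
  proof -
    have "(\<phi> z, u (\<phi> z)) \<in> ?F ` W" using u(2) that by (auto simp: graph_in_def T_def D_def)
    note r = rec(4)[OF this]
    have "z \<in> U" using that by (simp add: D_def)
    then have e: "inv_into W ?F (\<phi> z, u (\<phi> z)) = (z, v z)"
      using r inv_into_f_f[OF bmD(6)] by (simp add: v_def prod_eq_iff)
    show ?thesis using r unfolding e by simp
  qed
  have "\<phi> ` D = D'"
  proof
    show "D' \<subseteq> \<phi> ` D"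
    proof
      fix z assume z: "z \<in> D'"
      then have "(z, u z) \<in> ?F ` W" using u(2) by (auto simp: graph_in_def T_def)
      from rec(4)[OF this] show "z \<in> \<phi> ` D" using z by (auto simp: D_def)
    qed
  qed (auto simp: D_def)
  have "classical_solution (cubic_burgers_eq a b c d) (\<phi> ` D) (push \<phi> \<theta> U v) \<longleftrightarrow> classical_solution (cubic_burgers_eq a b c d) (\<phi> ` D) u"
  proof (rule classical_solution_cong)
    fix z assume "z \<in> \<phi> ` D"
    then obtain z' where z': "z' \<in> D" "z = \<phi> z'" by blast
    then have "z' \<in> U" by (simp add: D_def)
    then show "push \<phi> \<theta> U v z = u z" using gD[OF z'(1)] push_apply[OF bmD(6)] by (simp add: z'(2))
  qed
  moreover have "classical_solution (cubic_burgers_eq a b c d) (\<phi> ` D) u"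
    using u(4) \<open>\<phi> ` D = D'\<close> by (simp add: cubic_burgers_eq_quasilinear)
  moreover have "graph_in W D v" using gD by (auto simp: graph_in_def)
  ultimately have v: "classical_solution (quasilinear_eq X1 X2 X3) D v"
    using ex[unfolded exchanges_solutions_def, rule_format, of D v] oD by simp
  have z0: "z0 \<in> D" using p u(1) bmD(2) by (auto simp: D_def)
  have "(z0, v z0) = (z0, y0)"
    using gD[OF z0] inv_into_f_f[OF rec(2) p] u(3) by simp
  then show ?thesis using v z0 assms(2,3) by (auto simp: classical_solution_def quasilinear_eq_def)
qed

section \<open>The characterization in (1)\<close>

lemma admissible_equivalent:
  assumes sm: "smooth_near p X1" "smooth_near p X2" "smooth_near p X3" and ad: "admissible X1 X2 X3 p"
  shows "equivalent_to_cubic_burgers (quasilinear_eq X1 X2 X3) p"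
proof -
  have X1: "X1 p \<noteq> 0" using ad eventually_nhds_x_imp_x[of "\<lambda>p. X1 p \<noteq> 0" p] by (auto simp: admissible_def)
  obtain a b c d where abcd: "cubic_identity_near X1 X2 X3 p a b c d" and s: "slope_y_nonzero_near X1 X2 p"
    using ad by (auto simp: admissible_def)
  obtain S where "p \<in> S" "cubic_region X1 X2 X3 a b c d S"
    by (rule cubic_region_exists[OF sm X1 s abcd])
  then show ?thesis using abcd by (intro cubic_region_equivalent) (auto simp: cubic_identity_near_def)
qed

lemma smooth_near_eventually_nonzero:
  fixes f :: "'a::euclidean_space \<Rightarrow> real"
  assumes "smooth_near p f" "f p \<noteq> 0"
  shows "\<forall>\<^sub>F q in nhds p. f q \<noteq> 0"
proof -
  obtain S where S: "open S" "p \<in> S" "smooth_on S f" using assms by (auto simp: smooth_near_def)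
  obtain T where "open T" "p \<in> T" "\<And>q. q \<in> T \<Longrightarrow> f q \<noteq> 0"
    by (rule eventually_nonzero[OF S(1,2) smooth_on_continuous[OF S(3)] assms(2)]) (rule that)
  then show ?thesis unfolding eventually_nhds by blast
qed

lemma transformable_admissible:
  assumes "smooth_near p X1" "smooth_near p X2" "smooth_near p X3" "X1 p \<noteq> 0"
    and "transformable_to_cubic_burgers (quasilinear_eq X1 X2 X3) p"
  shows "admissible X1 X2 X3 p"
  using transformable_conditions[OF assms] smooth_near_eventually_nonzero[OF assms(1,4)] by (simp add: admissible_def)

text \<open>As not all three coefficients vanish at the point, equivalence forces \<open>X1\<close>
  or \<open>X2\<close> to be nonzero there, and the second case becomes the first one after the
  swap. With \<open>X1\<close> nonzero, mapping solutions in one direction already gives the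
  conditions, and the conditions give the two-sided notion back.\<close>

lemma equivalent_iff_admissible:
  assumes sm: "smooth_near (z0, y0) X1" "smooth_near (z0, y0) X2" "smooth_near (z0, y0) X3"
    and X: "(X1 (z0, y0), X2 (z0, y0), X3 (z0, y0)) \<noteq> (0, 0, 0)"
  shows "equivalent_to_cubic_burgers (quasilinear_eq X1 X2 X3) (z0, y0) \<longleftrightarrow>
    (\<forall>\<^sub>F p in nhds (z0, y0). (X1 p, X2 p) \<noteq> (0, 0)) \<and>
    (admissible X1 X2 X3 (z0, y0) \<or> admissible (swap_base X2) (swap_base X1) (swap_base X3) (prod.swap z0, y0))"
proof
  assume eq: "equivalent_to_cubic_burgers (quasilinear_eq X1 X2 X3) (z0, y0)"
  consider "X1 (z0, y0) \<noteq> 0" | "X2 (z0, y0) \<noteq> 0"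
    using equivalent_imp_noncharacteristic[OF eq] X by auto
  then show "(\<forall>\<^sub>F p in nhds (z0, y0). (X1 p, X2 p) \<noteq> (0, 0)) \<and>
    (admissible X1 X2 X3 (z0, y0) \<or> admissible (swap_base X2) (swap_base X1) (swap_base X3) (prod.swap z0, y0))"
  proof cases
    case 1
    from smooth_near_eventually_nonzero[OF sm(1) this] have "\<forall>\<^sub>F p in nhds (z0, y0). (X1 p, X2 p) \<noteq> (0, 0)"
      by (rule eventually_mono) simp
    then show ?thesis using transformable_admissible[OF sm 1 equivalent_imp_transformable[OF eq]] by simp
  next
    case 2
    from smooth_near_eventually_nonzero[OF sm(2) this] have "\<forall>\<^sub>F p in nhds (z0, y0). (X1 p, X2 p) \<noteq> (0, 0)"
      by (rule eventually_mono) simp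
    moreover have "swap_base X2 (prod.swap z0, y0) \<noteq> 0" using 2 by (simp add: swap_base_def)
    ultimately show ?thesis
      using transformable_admissible[OF smooth_near_swap_base[OF sm(2)] smooth_near_swap_base[OF sm(1)] smooth_near_swap_base[OF sm(3)]]
        equivalent_imp_transformable[OF equivalent_swap[OF eq]] by simp
  qed
next
  assume "(\<forall>\<^sub>F p in nhds (z0, y0). (X1 p, X2 p) \<noteq> (0, 0)) \<and>
    (admissible X1 X2 X3 (z0, y0) \<or> admissible (swap_base X2) (swap_base X1) (swap_base X3) (prod.swap z0, y0))"
  then consider "admissible X1 X2 X3 (z0, y0)" | "admissible (swap_base X2) (swap_base X1) (swap_base X3) (prod.swap z0, y0)"
    by blast
  then show "equivalent_to_cubic_burgers (quasilinear_eq X1 X2 X3) (z0, y0)"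
  proof cases
    case 1
    then show ?thesis by (rule admissible_equivalent[OF sm])
  next
    case 2
    from equivalent_swap[OF admissible_equivalent[OF smooth_near_swap_base[OF sm(2)] smooth_near_swap_base[OF sm(1)] smooth_near_swap_base[OF sm(3)] 2]]
    show ?thesis by simp
  qed
qed

text \<open>Sufficiency produces a map that even exchanges solutions, and necessity starts from the
  one-sided notion; where \<open>X1\<close> does not vanish both notions therefore coincide.\<close>

lemma transformable_iff_conditions:
  assumes sm: "smooth_near p X1" "smooth_near p X2" "smooth_near p X3" and X1: "X1 p \<noteq> 0"
  shows "transformable_to_cubic_burgers (quasilinear_eq X1 X2 X3) p \<longleftrightarrow>
    slope_y_nonzero_near X1 X2 p \<and> (\<exists>a b c d. cubic_identity_near X1 X2 X3 p a b c d)"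
proof
  assume "slope_y_nonzero_near X1 X2 p \<and> (\<exists>a b c d. cubic_identity_near X1 X2 X3 p a b c d)"
  then have "admissible X1 X2 X3 p"
    using smooth_near_eventually_nonzero[OF sm(1) X1] by (simp add: admissible_def)
  then show "transformable_to_cubic_burgers (quasilinear_eq X1 X2 X3) p"
    by (rule equivalent_imp_transformable[OF admissible_equivalent[OF sm]])
qed (rule transformable_conditions[OF sm X1])

lemma slope_maps_solutions:
  assumes sm: "smooth_near p X1" "smooth_near p X2" "smooth_near p X3" and "X1 p \<noteq> 0"
    "slope_y_nonzero_near X1 X2 p" "cubic_identity_near X1 X2 X3 p a b c d"
  shows "\<exists>W. open W \<and> p \<in> W \<and>
    (\<forall>D v. graph_in W D v \<and> classical_solution (quasilinear_eq X1 X2 X3) D v \<longrightarrow>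
      classical_solution (cubic_burgers_eq a b c d) D (\<lambda>z. X2 (z, v z) / X1 (z, v z)))"
proof -
  obtain S where S: "p \<in> S" "cubic_region X1 X2 X3 a b c d S"
    by (rule cubic_region_exists[OF assms])
  have "classical_solution (cubic_burgers_eq a b c d) D (\<lambda>z. X2 (z, v z) / X1 (z, v z))"
    if v: "graph_in S D v" "classical_solution (quasilinear_eq X1 X2 X3) D v" for D v
  proof -
    have "open D" "Ck_on 1 D v" using v(2) by (auto simp: classical_solution_def)
    from slope_solution_iff[OF S(2) this v(1)] v(2) show ?thesis by (simp add: slope_def)
  qed
  with S show ?thesis by (intro exI[of _ S]) (auto simp: cubic_region_def)
qed

section \<open>Reduction to the Burgers equation\<close>

text \<open>The characteristics of \<open>(B)\<close> are the solutions of \<open>x'' = a x'\<^sup>3 + b x'\<^sup>2 + c x' + d\<close>. With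
  \<open>B = b/3\<close>, \<open>C = c/3\<close>, the functions \<open>r0\<close>, \<open>r1\<close>, \<open>r2\<close> are the ones forced by the coefficients of the
  first derivatives in the integrability conditions of
  \<open>f\<^sub>t\<^sub>t = C f\<^sub>t - d f\<^sub>x + r0 f\<close>, \<open>f\<^sub>t\<^sub>x = B f\<^sub>t - C f\<^sub>x + r1 f\<close>, \<open>f\<^sub>x\<^sub>x = a f\<^sub>t - B f\<^sub>x + r2 f\<close>.
  The remaining integrability conditions \<open>E1\<close>, \<open>E2\<close> are the two equations of the system.\<close>

locale cubic_coefficients =
  fixes a B C d :: "plane \<Rightarrow> real" and N :: "plane set"
  assumes N: "open N" and sm: "smooth_on N a" "smooth_on N B" "smooth_on N C" "smooth_on N d"
begin

definition "r0 = (\<lambda>z. pd2 d z - pd1 C z + 2 * (C z * C z) - 2 * (B z * d z))"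
definition "r1 = (\<lambda>z. pd2 C z - pd1 B z + B z * C z - a z * d z)"
definition "r2 = (\<lambda>z. pd2 B z - pd1 a z + 2 * (B z * B z) - 2 * (a z * C z))"

definition "E1 z \<longleftrightarrow> pd2 r0 z - pd1 r1 z + 2 * C z * r1 z - d z * r2 z - B z * r0 z = 0"
definition "E2 z \<longleftrightarrow> pd2 r1 z - pd1 r2 z + 2 * B z * r1 z - C z * r2 z - a z * r0 z = 0"

lemma smooth_r: "smooth_on N r0" "smooth_on N r1" "smooth_on N r2"
  unfolding r0_def r1_def r2_def by (intro smooth_intros N sm)+

lemmas sm1 = sm[THEN smooth_on_pd1] sm[THEN smooth_on_pd2]
lemmas diff_N = sm[THEN smooth_on_differentiable] sm1[THEN smooth_on_differentiable]
  smooth_r[THEN smooth_on_differentiable]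

lemmas pd_rules = pd1_add pd2_add pd1_diff pd2_diff pd1_mult pd2_mult

lemma pd_r:
  assumes z: "z \<in> N"
  shows "pd2 r0 z = pd2 (pd2 d) z - pd1 (pd2 C) z + 4 * C z * pd2 C z - 2 * pd2 B z * d z - 2 * B z * pd2 d z"
    "pd1 r1 z = pd1 (pd2 C) z - pd1 (pd1 B) z + pd1 B z * C z + B z * pd1 C z - pd1 a z * d z - a z * pd1 d z"
    "pd2 r1 z = pd2 (pd2 C) z - pd1 (pd2 B) z + pd2 B z * C z + B z * pd2 C z - pd2 a z * d z - a z * pd2 d z"
    "pd1 r2 z = pd1 (pd2 B) z - pd1 (pd1 a) z + 4 * B z * pd1 B z - 2 * pd1 a z * C z - 2 * a z * pd1 C z"
  using pd_commute[OF N sm(2) z] pd_commute[OF N sm(3) z]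
  unfolding r0_def r1_def r2_def by (simp_all add: pd_rules diff_N[OF z] algebra_simps)

text \<open>\<open>E1\<close> is the second equation of the system and \<open>E2\<close> the first;
  after inserting \<open>r0\<close>, \<open>r1\<close>, \<open>r2\<close> all terms free of
  derivatives cancel.\<close>

lemma system_iff:
  assumes z: "z \<in> N"
  shows "linearizable_system a (\<lambda>z. 3 * B z) (\<lambda>z. 3 * C z) d z \<longleftrightarrow> E1 z \<and> E2 z"
proof -
  have 1: "pd1 (\<lambda>z. 3 * f z) z = 3 * pd1 f z" "pd2 (\<lambda>z. 3 * f z) z = 3 * pd2 f z" if "smooth_on N f" "z \<in> N" for f z
    using pd1_cmult[OF smooth_on_differentiable[OF that]] pd2_cmult[OF smooth_on_differentiable[OF that]] by auto
  have 2: "pd1 (pd1 (\<lambda>z. 3 * f z)) z = 3 * pd1 (pd1 f) z" "pd2 (pd2 (\<lambda>z. 3 * f z)) z = 3 * pd2 (pd2 f) z"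
    "pd2 (pd1 (\<lambda>z. 3 * f z)) z = 3 * pd1 (pd2 f) z" "pd1 (pd2 (\<lambda>z. 3 * f z)) z = 3 * pd1 (pd2 f) z" if "smooth_on N f" for f
    using pd1_cong[OF N z, of "pd1 (\<lambda>z. 3 * f z)" "\<lambda>z. 3 * pd1 f z"] pd2_cong[OF N z, of "pd2 (\<lambda>z. 3 * f z)" "\<lambda>z. 3 * pd2 f z"]
      pd2_cong[OF N z, of "pd1 (\<lambda>z. 3 * f z)" "\<lambda>z. 3 * pd1 f z"] pd1_cong[OF N z, of "pd2 (\<lambda>z. 3 * f z)" "\<lambda>z. 3 * pd2 f z"]
      1[OF that] 1[OF smooth_on_pd1[OF that] z] 1[OF smooth_on_pd2[OF that] z] pd_commute[OF N that z] by simp_all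
  show ?thesis
    unfolding linearizable_system_def E1_def E2_def pd_r[OF z] 1[OF sm(2) z] 1[OF sm(3) z] 2[OF sm(2)] 2[OF sm(3)]
    unfolding r0_def r1_def r2_def by (simp add: algebra_simps) (auto simp: algebra_simps)
qed

subsection \<open>Sufficiency\<close>

text \<open>Solutions serve as homogeneous coordinates: quotients of them will be the affine
  coordinates of the straightened plane. The domain belongs to the notion because different
  solutions are obtained on different neighbourhoods.\<close>

definition "linear_solution D f \<longleftrightarrow> open D \<and> D \<subseteq> N \<and> smooth_on D f \<and> (\<forall>z\<in>D.
    pd1 (pd1 f) z = C z * pd1 f z - d z * pd2 f z + r0 z * f z \<and>
    pd1 (pd2 f) z = B z * pd1 f z - C z * pd2 f z + r1 z * f z \<and>
    pd2 (pd2 f) z = a z * pd1 f z - B z * pd2 f z + r2 z * f z)"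

lemma linear_solution_subset: "linear_solution D f \<Longrightarrow> open D' \<Longrightarrow> D' \<subseteq> D \<Longrightarrow> linear_solution D' f"
  unfolding linear_solution_def using smooth_on_subset[of D f D'] by auto

text \<open>Frobenius theorem for the unknown \<open>(f, f_t, f_x)\<close>, whose initial value is
  arbitrary. In the compatibility conditions the terms with first derivatives of \<open>f\<close>
  agree by the choice of \<open>r0\<close>, \<open>r1\<close>, \<open>r2\<close>, and those with
  \<open>f\<close> itself agree by \<open>E1\<close> and \<open>E2\<close>.\<close>

lemma linear_solution_exists:
  assumes z0: "z0 \<in> N" and E: "\<And>z. z \<in> N \<Longrightarrow> E1 z \<and> E2 z"
  obtains D f where "z0 \<in> D" "linear_solution D f" "f z0 = k0" "pd1 f z0 = k1" "pd2 f z0 = k2"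
proof -
  define A1 where "A1 = (\<lambda>x :: plane \<times> real \<times> real \<times> real. fst (snd (snd x)))"
  define A2 where "A2 = (\<lambda>x :: plane \<times> real \<times> real \<times> real. C (fst x) * fst (snd (snd x)) - d (fst x) * snd (snd (snd x)) + r0 (fst x) * fst (snd x))"
  define A3 where "A3 = (\<lambda>x :: plane \<times> real \<times> real \<times> real. B (fst x) * fst (snd (snd x)) - C (fst x) * snd (snd (snd x)) + r1 (fst x) * fst (snd x))"
  define B1 where "B1 = (\<lambda>x :: plane \<times> real \<times> real \<times> real. snd (snd (snd x)))"
  define B3 where "B3 = (\<lambda>x :: plane \<times> real \<times> real \<times> real. a (fst x) * fst (snd (snd x)) - B (fst x) * snd (snd (snd x)) + r2 (fst x) * fst (snd x))"
  let ?N = "N \<times> (UNIV :: (real \<times> real \<times> real) set)"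
  have oN: "open ?N" using N by (intro open_Times) auto
  have base: "smooth_on ?N (\<lambda>x. f (fst x))" if "smooth_on N f" for f :: "plane \<Rightarrow> real"
    by (rule smooth_on_compose[OF oN N that smooth_on_fst[OF oN smooth_on_ident[OF oN]]]) auto
  have dbase: "((\<lambda>x. f (fst x)) has_derivative (\<lambda>h. fst (fst h) * pd1 f (fst x) + snd (fst h) * pd2 f (fst x))) (at x)"
    if "smooth_on N f" "x \<in> ?N" for f and x :: "plane \<times> real \<times> real \<times> real"
    by (rule has_derivative_compose[OF has_derivative_fst[OF has_derivative_ident] has_derivative_pd[OF smooth_on_differentiable[OF that(1)]]])
      (use that(2) in auto)
  have AB: "smooth_on ?N A1" "smooth_on ?N A2" "smooth_on ?N A3" "smooth_on ?N B1" "smooth_on ?N B3"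
    unfolding A1_def A2_def A3_def B1_def B3_def
    by (intro smooth_intros oN base sm smooth_r)+
  have comp: "((\<lambda>x. g1 (fst x) * fst (snd (snd x)) - g2 (fst x) * snd (snd (snd x)) + g3 (fst x) * fst (snd x)) has_derivative
     (\<lambda>h. g1 (fst x) * fst (snd (snd h)) + (fst (fst h) * pd1 g1 (fst x) + snd (fst h) * pd2 g1 (fst x)) * fst (snd (snd x))
        - (g2 (fst x) * snd (snd (snd h)) + (fst (fst h) * pd1 g2 (fst x) + snd (fst h) * pd2 g2 (fst x)) * snd (snd (snd x)))
        + (g3 (fst x) * fst (snd h) + (fst (fst h) * pd1 g3 (fst x) + snd (fst h) * pd2 g3 (fst x)) * fst (snd x)))) (at x)"
    if "smooth_on N g1" "smooth_on N g2" "smooth_on N g3" "x \<in> ?N"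
    for g1 g2 g3 and x :: "plane \<times> real \<times> real \<times> real"
    by (intro has_derivative_add has_derivative_diff has_derivative_mult dbase that has_derivative_fst has_derivative_snd has_derivative_ident)
  have lin: "((\<lambda>x. fst (snd (snd x))) has_derivative (\<lambda>h. fst (snd (snd h)))) (at x)"
    "((\<lambda>x. snd (snd (snd x))) has_derivative (\<lambda>h. snd (snd (snd h)))) (at x)" for x :: "plane \<times> real \<times> real \<times> real"
    by (intro has_derivative_fst has_derivative_snd has_derivative_ident)+
  let ?A = "\<lambda>x. (A1 x, A2 x, A3 x)" and ?B = "\<lambda>x. (B1 x, A3 x, B3 x)"
  have AS: "smooth_on ?N ?A" and BS: "smooth_on ?N ?B" by (intro smooth_intros oN AB)+
  have compat: "frechet_derivative ?A (at x) ((0, 1), ?B x) = frechet_derivative ?B (at x) ((1, 0), ?A x)" if x: "x \<in> ?N" for x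
  proof -
    obtain z f p q where xe: "x = (z, f, p, q)" by (cases x) auto
    have z: "z \<in> N" using x xe by simp
    note DA = frechet_derivative_eq[OF has_derivative_Pair[OF lin(1) has_derivative_Pair[OF comp[OF sm(3) sm(4) smooth_r(1) x] comp[OF sm(2) sm(3) smooth_r(2) x]]]]
    note DB = frechet_derivative_eq[OF has_derivative_Pair[OF lin(2) has_derivative_Pair[OF comp[OF sm(2) sm(3) smooth_r(2) x] comp[OF sm(1) sm(2) smooth_r(3) x]]]]
    have e1: "pd2 r0 z = pd1 r1 z - 2 * C z * r1 z + d z * r2 z + B z * r0 z"
      and e2: "pd2 r1 z = pd1 r2 z - 2 * B z * r1 z + C z * r2 z + a z * r0 z"
      using E[OF z] by (simp_all add: E1_def E2_def)
    show ?thesis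
      unfolding A1_def A2_def A3_def B1_def B3_def unfolding DA DB unfolding xe
      by (simp add: e1 e2) (simp add: r0_def r1_def r2_def algebra_simps)
  qed
  obtain D F where D: "open D" "z0 \<in> D" "F z0 = (k0, k1, k2)" "smooth_on D F"
    "\<And>z. z \<in> D \<Longrightarrow> (z, F z) \<in> ?N"
    "\<And>z. z \<in> D \<Longrightarrow> (F has_derivative (\<lambda>h. fst h *\<^sub>R ?A (z, F z) + snd h *\<^sub>R ?B (z, F z))) (at z)"
    by (rule frobenius_plane[of ?N z0 "(k0, k1, k2)" ?A ?B, OF oN _ AS BS compat]) (use z0 in simp, assumption, rule that)
  define f where "f = (\<lambda>z. fst (F z))"
  define p where "p = (\<lambda>z. fst (snd (F z)))"
  define q where "q = (\<lambda>z. snd (snd (F z)))"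
  have F: "F z = (f z, p z, q z)" for z by (simp add: f_def p_def q_def)
  have f: "pd1 f z = p z" "pd2 f z = q z" if "z \<in> D" for z
    using has_derivative_fst[OF D(6)[OF that]] unfolding f_def[symmetric]
    by (simp_all add: pd1_eq pd2_eq A1_def B1_def F)
  have p: "pd1 p z = A2 (z, F z)" "pd2 p z = A3 (z, F z)" if "z \<in> D" for z
    using has_derivative_fst[OF has_derivative_snd[OF D(6)[OF that]]] unfolding p_def[symmetric]
    by (simp_all add: pd1_eq pd2_eq)
  have q: "pd1 q z = A3 (z, F z)" "pd2 q z = B3 (z, F z)" if "z \<in> D" for z
    using has_derivative_snd[OF has_derivative_snd[OF D(6)[OF that]]] unfolding q_def[symmetric]
    by (simp_all add: pd1_eq pd2_eq)
  have pd: "pd1 (pd1 f) z = pd1 p z" "pd1 (pd2 f) z = pd1 q z" "pd2 (pd2 f) z = pd2 q z" if "z \<in> D" for z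
    using pd1_cong[OF D(1) that f(1)] pd1_cong[OF D(1) that f(2)] pd2_cong[OF D(1) that f(2)] by auto
  show thesis
  proof (rule that[OF D(2)])
    show "linear_solution D f"
      unfolding linear_solution_def
    proof (intro conjI ballI)
      show "D \<subseteq> N" using D(5) by auto
      show "smooth_on D f" unfolding f_def by (rule smooth_on_fst[OF D(1,4)])
    qed (use D(1) in \<open>simp_all add: pd p q f A2_def A3_def B3_def F\<close>)
    show "f z0 = k0" "pd1 f z0 = k1" "pd2 f z0 = k2" using D(2,3) f by (auto simp: F)
  qed
qed

text \<open>\<open>m\<close> is the Wronskian of \<open>f\<close> and \<open>h\<close> for the
  derivation \<open>\<delta> = \<partial>_t + u \<partial>_x\<close> along characteristics. By the
  linear system and (B), \<open>\<delta> (\<delta> f)\<close> is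
  \<open>(C + 2 B u + a u^2) \<delta> f\<close> plus \<open>(r0 + 2 u r1 + u^2 r2) f\<close>, with
  factors that are the same for all solutions. So all Wronskians satisfy one linear equation, and
  their quotients are constant along characteristics.\<close>

lemma wronskian_along_solution:
  assumes f: "linear_solution D f" and h: "linear_solution D h" and z: "z \<in> D" and u: "u differentiable at z"
    and eq: "pd1 u z + u z * pd2 u z = a z * u z ^ 3 + 3 * B z * u z ^ 2 + 3 * C z * u z + d z"
  defines "m \<equiv> \<lambda>z. (pd1 f z + pd2 f z * u z) * h z - f z * (pd1 h z + pd2 h z * u z)"
  shows "m differentiable at z"
    "pd1 m z + u z * pd2 m z = (C z + 2 * B z * u z + a z * u z ^ 2) * m z"
proof -
  have sD: "open D" "smooth_on D f" "smooth_on D h" using f h by (auto simp: linear_solution_def)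
  note dif = smooth_on_differentiable[OF sD(2) z] smooth_on_differentiable[OF sD(3) z]
    smooth_on_differentiable[OF smooth_on_pd1[OF sD(2)] z] smooth_on_differentiable[OF smooth_on_pd1[OF sD(3)] z]
    smooth_on_differentiable[OF smooth_on_pd2[OF sD(2)] z] smooth_on_differentiable[OF smooth_on_pd2[OF sD(3)] z] u
  show "m differentiable at z" unfolding m_def by (simp add: dif)
  note com = pd_commute[OF sD(1,2) z, symmetric] pd_commute[OF sD(1,3) z, symmetric]
  have ff: "pd1 (pd1 f) z = C z * pd1 f z - d z * pd2 f z + r0 z * f z"
    "pd1 (pd2 f) z = B z * pd1 f z - C z * pd2 f z + r1 z * f z"
    "pd2 (pd2 f) z = a z * pd1 f z - B z * pd2 f z + r2 z * f z"
    and hh: "pd1 (pd1 h) z = C z * pd1 h z - d z * pd2 h z + r0 z * h z"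
    "pd1 (pd2 h) z = B z * pd1 h z - C z * pd2 h z + r1 z * h z"
    "pd2 (pd2 h) z = a z * pd1 h z - B z * pd2 h z + r2 z * h z"
    using f h z by (auto simp: linear_solution_def)
  have ut: "pd1 u z = a z * u z ^ 3 + 3 * B z * u z ^ 2 + 3 * C z * u z + d z - u z * pd2 u z" using eq by simp
  show "pd1 m z + u z * pd2 m z = (C z + 2 * B z * u z + a z * u z ^ 2) * m z"
    unfolding m_def
    by (simp add: pd_rules dif com ff hh ut) (simp add: algebra_simps power2_eq_square power3_eq_cube)
qed

text \<open>The new coordinates are \<open>f/h\<close> and \<open>g/h\<close>, and the new dependent
  variable is a quotient of two Wronskians; its constancy along characteristics is the Burgers
  equation. The number \<open>q0\<close> enters because the denominator has to be nonzero at a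
  prescribed point of the fiber.\<close>

lemma burgers_transformation:
  assumes z0: "z0 \<in> N" and E: "\<And>z. z \<in> N \<Longrightarrow> E1 z \<and> E2 z"
  obtains \<tau> \<xi> U where "z0 \<in> U" "diffeo_on U (\<lambda>z. (\<tau> z, \<xi> z))" "smooth_on U \<tau>" "smooth_on U \<xi>"
    "pd1 \<tau> z0 + pd2 \<tau> z0 * q0 \<noteq> 0"
    "\<forall>D u u'. D \<subseteq> U \<and> classical_solution (cubic_burgers_eq a (\<lambda>z. 3 * B z) (\<lambda>z. 3 * C z) d) D u \<and>
       (\<forall>z\<in>D. pd1 \<tau> z + pd2 \<tau> z * u z \<noteq> 0) \<and>
       (\<forall>z\<in>D. u' (\<tau> z, \<xi> z) = (pd1 \<xi> z + pd2 \<xi> z * u z) / (pd1 \<tau> z + pd2 \<tau> z * u z)) \<longrightarrow>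
       classical_solution burgers_eq ((\<lambda>z. (\<tau> z, \<xi> z)) ` D) u'"
proof -
  \<comment> \<open>At \<open>z0\<close> the gradients of \<open>f\<close> and \<open>g\<close> are
    \<open>(1, q0)\<close> and \<open>(- q0, 1)\<close>, both functions vanish, and \<open>h\<close>
    is \<open>1\<close> with gradient zero. Hence the Jacobian and the denominator at
    \<open>q0\<close> are both \<open>1 + q0 * q0\<close>, which is positive.\<close>
  obtain Df f where f: "z0 \<in> Df" "linear_solution Df f" "f z0 = 0" "pd1 f z0 = 1" "pd2 f z0 = q0"
    by (rule linear_solution_exists[OF z0 E]) (assumption, rule that)
  obtain Dg g where g: "z0 \<in> Dg" "linear_solution Dg g" "g z0 = 0" "pd1 g z0 = - q0" "pd2 g z0 = 1"
    by (rule linear_solution_exists[OF z0 E]) (assumption, rule that)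
  obtain Dh h where h: "z0 \<in> Dh" "linear_solution Dh h" "h z0 = 1" "pd1 h z0 = 0" "pd2 h z0 = 0"
    by (rule linear_solution_exists[OF z0 E]) (assumption, rule that)
  have oh: "open Dh" "smooth_on Dh h" using h(2) by (auto simp: linear_solution_def)
  obtain D1 where D1: "open D1" "z0 \<in> D1" "D1 \<subseteq> Dh" "\<And>z. z \<in> D1 \<Longrightarrow> h z \<noteq> 0"
    by (rule eventually_nonzero[OF oh(1) h(1) smooth_on_continuous[OF oh(2)]]) (use h(3) in simp, rule that)
  define S where "S = D1 \<inter> Df \<inter> Dg"
  have oS: "open S" "z0 \<in> S" using D1 f g by (auto simp: S_def linear_solution_def)
  have lin: "linear_solution S f" "linear_solution S g" "linear_solution S h"
    using linear_solution_subset[OF f(2) oS(1)] linear_solution_subset[OF g(2) oS(1)] linear_solution_subset[OF h(2) oS(1)]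
      D1(3) by (auto simp: S_def)
  have smS: "smooth_on S f" "smooth_on S g" "smooth_on S h" using lin by (auto simp: linear_solution_def)
  have h0: "h z \<noteq> 0" if "z \<in> S" for z using D1(4) that by (auto simp: S_def)
  define \<tau> where "\<tau> = (\<lambda>z. f z / h z)"
  define \<xi> where "\<xi> = (\<lambda>z. g z / h z)"
  have \<tau>\<xi>: "smooth_on S \<tau>" "smooth_on S \<xi>"
    unfolding \<tau>_def \<xi>_def
    using smooth_on_divide[OF oS(1) smS(1,3) h0] smooth_on_divide[OF oS(1) smS(2,3) h0] by simp_all
  have pd: "pd1 \<tau> z = (pd1 f z * h z - f z * pd1 h z) / (h z)^2" "pd2 \<tau> z = (pd2 f z * h z - f z * pd2 h z) / (h z)^2"
    "pd1 \<xi> z = (pd1 g z * h z - g z * pd1 h z) / (h z)^2" "pd2 \<xi> z = (pd2 g z * h z - g z * pd2 h z) / (h z)^2" if "z \<in> S" for z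
    unfolding \<tau>_def \<xi>_def using that smS[THEN smooth_on_differentiable, OF that] h0[OF that]
    by (simp_all add: pd1_divide pd2_divide)
  have "pd1 \<tau> z0 * pd2 \<xi> z0 - pd2 \<tau> z0 * pd1 \<xi> z0 = 1 + q0 * q0"
    by (simp add: pd[OF oS(2)] f g h)
  moreover have pos: "1 + q0 * q0 > 0" using zero_le_square[of q0] by linarith
  ultimately have J: "pd1 \<tau> z0 * pd2 \<xi> z0 - pd2 \<tau> z0 * pd1 \<xi> z0 \<noteq> 0" by linarith
  let ?\<phi> = "\<lambda>z. (\<tau> z, \<xi> z)"
  obtain U where U: "open U" "z0 \<in> U" "U \<subseteq> S" "inj_on ?\<phi> U" "open (?\<phi> ` U)"
    "\<And>k. Ck_on (Suc k) S \<tau> \<Longrightarrow> Ck_on (Suc k) S \<xi> \<Longrightarrow> Ck_on (Suc k) (?\<phi> ` U) (inv_into U ?\<phi>)"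
    by (rule plane_inverse_function[OF oS smooth_on_Ck[OF \<tau>\<xi>(1)] smooth_on_Ck[OF \<tau>\<xi>(2)] J]) (rule that)
  have "Ck_on (Suc k) (?\<phi> ` U) (inv_into U ?\<phi>)" for k
    by (rule U(6)) (intro smooth_on_Ck \<tau>\<xi>)+
  then have inv: "smooth_on (?\<phi> ` U) (inv_into U ?\<phi>)" unfolding smooth_on_def using Ck_on_SucD by fast
  have \<tau>\<xi>U: "smooth_on U \<tau>" "smooth_on U \<xi>" by (rule smooth_on_subset[OF _ U(3)], rule \<tau>\<xi>)+
  have diffeo: "diffeo_on U ?\<phi>"
    unfolding diffeo_on_def using U(1,4,5) inv smooth_on_Pair[OF U(1) \<tau>\<xi>U] by simp
  show thesis
  proof (rule that[OF U(2) diffeo \<tau>\<xi>U])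
    have "pd1 \<tau> z0 + pd2 \<tau> z0 * q0 = 1 + q0 * q0" by (simp add: pd[OF oS(2)] f g h)
    then show "pd1 \<tau> z0 + pd2 \<tau> z0 * q0 \<noteq> 0" using pos by linarith
    have claim: "classical_solution burgers_eq (?\<phi> ` D) u'"
      if D: "D \<subseteq> U" and u: "classical_solution (cubic_burgers_eq a (\<lambda>z. 3 * B z) (\<lambda>z. 3 * C z) d) D u"
        and M0: "\<And>z. z \<in> D \<Longrightarrow> pd1 \<tau> z + pd2 \<tau> z * u z \<noteq> 0"
        and u': "\<And>z. z \<in> D \<Longrightarrow> u' (\<tau> z, \<xi> z) = (pd1 \<xi> z + pd2 \<xi> z * u z) / (pd1 \<tau> z + pd2 \<tau> z * u z)"
      for D u u'
    proof -
    define m where "m = (\<lambda>z. (pd1 f z + pd2 f z * u z) * h z - f z * (pd1 h z + pd2 h z * u z))"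
    define n where "n = (\<lambda>z. (pd1 g z + pd2 g z * u z) * h z - g z * (pd1 h z + pd2 h z * u z))"
    have oD: "open D" and u1: "Ck_on 1 D u" using u by (auto simp: classical_solution_def)
    have DS: "D \<subseteq> S" using D U(3) by blast
    have smD: "smooth_on D f" "smooth_on D g" "smooth_on D h" by (rule smooth_on_subset[OF _ DS], rule smS)+
    have mn1: "Ck_on 1 D m" "Ck_on 1 D n"
      unfolding m_def n_def
      by (intro Ck_on_diff Ck_on_mult Ck_on_add oD u1 smooth_on_Ck[OF smD(1)] smooth_on_Ck[OF smD(2)] smooth_on_Ck[OF smD(3)]
        smooth_on_Ck[OF smooth_on_pd1[OF smD(1)]] smooth_on_Ck[OF smooth_on_pd1[OF smD(2)]] smooth_on_Ck[OF smooth_on_pd1[OF smD(3)]]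
        smooth_on_Ck[OF smooth_on_pd2[OF smD(1)]] smooth_on_Ck[OF smooth_on_pd2[OF smD(2)]] smooth_on_Ck[OF smooth_on_pd2[OF smD(3)]])+
    \<comment> \<open>By the quotient rule numerator and denominator carry the same factor
      \<open>1 / h^2\<close>, so the transformed function is \<open>n / m\<close>.\<close>
    have M: "pd1 \<tau> z + pd2 \<tau> z * u z = m z / (h z)^2" "pd1 \<xi> z + pd2 \<xi> z * u z = n z / (h z)^2" if "z \<in> D" for z
    proof -
      have "z \<in> S" using that DS by blast
      then show "pd1 \<tau> z + pd2 \<tau> z * u z = m z / (h z)^2" "pd1 \<xi> z + pd2 \<xi> z * u z = n z / (h z)^2"
        by (simp_all add: pd m_def n_def add_divide_distrib diff_divide_distrib algebra_simps)
    qed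
    have m0: "m z \<noteq> 0" if "z \<in> D" for z using M0[OF that] M(1)[OF that] by auto
    have k: "u' (?\<phi> z) = n z / m z" if "z \<in> D" for z
      using u'[OF that] M[OF that] h0[of z] that DS by auto
    have k1: "Ck_on 1 D (\<lambda>z. n z / m z)" by (rule Ck_on_divide[OF oD mn1(2,1) m0])
    have iU: "inv_into U ?\<phi> (?\<phi> z) = z" if "z \<in> U" for z by (rule inv_into_f_f[OF U(4) that])
    have img: "?\<phi> ` D = ?\<phi> ` U \<inter> inv_into U ?\<phi> -` D"
    proof (intro equalityI subsetI)
      fix w assume "w \<in> ?\<phi> ` D"
      then obtain z where z: "z \<in> D" "w = ?\<phi> z" by (rule imageE)
      then show "w \<in> ?\<phi> ` U \<inter> inv_into U ?\<phi> -` D" using iU[of z] D by auto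
    next
      fix w assume "w \<in> ?\<phi> ` U \<inter> inv_into U ?\<phi> -` D"
      then obtain z where z: "z \<in> U" "w = ?\<phi> z" "inv_into U ?\<phi> w \<in> D" by blast
      then show "w \<in> ?\<phi> ` D" using iU[OF z(1)] by simp
    qed
    have o\<phi>D: "open (?\<phi> ` D)" unfolding img
      by (rule continuous_open_preimage[OF smooth_on_continuous[OF inv] U(5) oD])
    have "Ck_on 1 (?\<phi> ` D) (inv_into U ?\<phi>)"
      by (rule Ck_on_subset[OF smooth_on_Ck[OF inv]]) (use D in blast)
    then have k1': "Ck_on 1 (?\<phi> ` D) (\<lambda>w. n (inv_into U ?\<phi> w) / m (inv_into U ?\<phi> w))"
      by (rule Ck_on_compose[OF o\<phi>D oD k1]) (rule image_subsetI, drule equalityD1[OF img, THEN subsetD], simp)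
    have eq: "u' w = n (inv_into U ?\<phi> w) / m (inv_into U ?\<phi> w)" if w: "w \<in> ?\<phi> ` D" for w
    proof -
      obtain z where z: "z \<in> D" "w = ?\<phi> z" using w by (rule imageE)
      then have "inv_into U ?\<phi> w = z" using iU[of z] D by auto
      then show ?thesis using k[OF z(1)] z(2) by simp
    qed
    have u'1: "Ck_on 1 (?\<phi> ` D) u'"
      using k1' Ck_on_cong[OF o\<phi>D eq, where k = 1] by simp
    have "pd1 u' (?\<phi> z) + u' (?\<phi> z) * pd2 u' (?\<phi> z) = 0" if z: "z \<in> D" for z
    proof -
      have zS: "z \<in> S" using z DS by blast
      have du: "u differentiable at z" by (rule classical_solution_differentiable[OF u z])
      have eq: "pd1 u z + u z * pd2 u z = a z * u z ^ 3 + 3 * B z * u z ^ 2 + 3 * C z * u z + d z"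
        using u z by (auto simp: classical_solution_def cubic_burgers_eq_def)
      note wm = wronskian_along_solution[OF lin(1,3) zS du eq, folded m_def]
      note wn = wronskian_along_solution[OF lin(2,3) zS du eq, folded n_def]
      have "u' differentiable at (?\<phi> z)" using u'1 z by (simp add: Ck_on.simps(2))
      moreover have "?\<phi> differentiable at z"
        using smooth_on_differentiable[OF smooth_on_Pair[OF oS(1) \<tau>\<xi>] zS] .
      ultimately have "((\<lambda>z. u' (?\<phi> z)) has_derivative (\<lambda>h. fst h * (pd1 \<tau> z * pd1 u' (?\<phi> z) + pd1 \<xi> z * pd2 u' (?\<phi> z))
          + snd h * (pd2 \<tau> z * pd1 u' (?\<phi> z) + pd2 \<xi> z * pd2 u' (?\<phi> z)))) (at z)"
        using has_derivative_plane_compose[of u' ?\<phi> z] by simp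
      then have "((\<lambda>z. n z / m z) has_derivative (\<lambda>h. fst h * (pd1 \<tau> z * pd1 u' (?\<phi> z) + pd1 \<xi> z * pd2 u' (?\<phi> z))
          + snd h * (pd2 \<tau> z * pd1 u' (?\<phi> z) + pd2 \<xi> z * pd2 u' (?\<phi> z)))) (at z)"
        by (rule has_derivative_transform_within_open[OF _ oD z]) (rule k)
      then have p: "pd1 (\<lambda>z. n z / m z) z = pd1 \<tau> z * pd1 u' (?\<phi> z) + pd1 \<xi> z * pd2 u' (?\<phi> z)"
        "pd2 (\<lambda>z. n z / m z) z = pd2 \<tau> z * pd1 u' (?\<phi> z) + pd2 \<xi> z * pd2 u' (?\<phi> z)"
        by (simp_all add: pd1_eq pd2_eq)
      define M where "M = pd1 \<tau> z + pd2 \<tau> z * u z"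
      \<comment> \<open>Up to the nonzero factor \<open>M\<close>, the left-hand side of the Burgers
        equation at the image point is the derivative of \<open>n / m\<close> along
        \<open>(1, u)\<close>; it vanishes because \<open>m\<close> and \<open>n\<close> satisfy the
        same linear equation.\<close>
      have "M * (pd1 u' (?\<phi> z) + u' (?\<phi> z) * pd2 u' (?\<phi> z)) = M * pd1 u' (?\<phi> z) + (pd1 \<xi> z + pd2 \<xi> z * u z) * pd2 u' (?\<phi> z)"
        using u'[OF z] M0[OF z] by (simp add: M_def distrib_left)
      also have "\<dots> = pd1 (\<lambda>z. n z / m z) z + u z * pd2 (\<lambda>z. n z / m z) z"
        unfolding p M_def by (simp add: algebra_simps)
      also have "\<dots> = ((pd1 n z + u z * pd2 n z) * m z - n z * (pd1 m z + u z * pd2 m z)) / (m z)^2"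
        by (simp add: pd1_divide[OF wn(1) wm(1) m0[OF z]] pd2_divide[OF wn(1) wm(1) m0[OF z]] add_divide_distrib diff_divide_distrib algebra_simps)
      also have "\<dots> = 0" unfolding wm(2) wn(2) by (simp add: m_def n_def)
      finally show ?thesis using M0[OF z] by (simp add: M_def)
    qed
    then show ?thesis
      using u'1 o\<phi>D by (auto simp: classical_solution_def burgers_eq_def)
    qed
    show "\<forall>D u u'. D \<subseteq> U \<and> classical_solution (cubic_burgers_eq a (\<lambda>z. 3 * B z) (\<lambda>z. 3 * C z) d) D u \<and>
       (\<forall>z\<in>D. pd1 \<tau> z + pd2 \<tau> z * u z \<noteq> 0) \<and>
       (\<forall>z\<in>D. u' (\<tau> z, \<xi> z) = (pd1 \<xi> z + pd2 \<xi> z * u z) / (pd1 \<tau> z + pd2 \<tau> z * u z)) \<longrightarrow>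
       classical_solution burgers_eq (?\<phi> ` D) u'"
      by (intro allI impI, elim conjE) (rule claim, assumption, assumption, (drule (1) bspec, assumption)+)
  qed
qed

end

subsection \<open>Necessity\<close>

text \<open>Comparison of cubics gives four relations for the six second derivatives of
  \<open>\<tau>\<close> and \<open>\<xi>\<close>; the two remaining degrees of freedom are named
  \<open>P\<close> and \<open>Q\<close>. All six become combinations of first derivatives, with the
  same coefficients for \<open>\<tau>\<close> and \<open>\<xi>\<close>: the Christoffel symbols of
  the flat connection pulled back by \<open>\<phi>\<close>.\<close>

lemma connection_algebra:
  fixes t1 t2 t11 t12 t22 x1 x2 x11 x12 x22 a B C d P Q J :: real
  assumes J: "J = t1 * x2 - t2 * x1" "J \<noteq> 0"
    and "J * a = x2 * t22 - t2 * x22"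
    and "J * (3 * B) = x1 * t22 + 2 * x2 * t12 - t1 * x22 - 2 * t2 * x12"
    and "J * (3 * C) = 2 * x1 * t12 + x2 * t11 - 2 * t1 * x12 - t2 * x11"
    and "J * d = x1 * t11 - t1 * x11"
    and "J * (C - 2 * P) = t11 * x2 - x11 * t2" "J * (B - Q) = t12 * x2 - x12 * t2"
  shows "t11 = (C - 2 * P) * t1 - d * t2" "x11 = (C - 2 * P) * x1 - d * x2"
    "t12 = (B - Q) * t1 - (C + P) * t2" "x12 = (B - Q) * x1 - (C + P) * x2"
    "t22 = a * t1 - (B + 2 * Q) * t2" "x22 = a * x1 - (B + 2 * Q) * x2"
proof -
  have CP: "J * (C + P) = x1 * t12 - t1 * x12" and BQ: "J * (B + 2 * Q) = x1 * t22 - t1 * x22"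
    using assms(4-8) by (simp_all add: algebra_simps)
  have "J * t11 = (J * (C - 2 * P)) * t1 - (J * d) * t2" "J * x11 = (J * (C - 2 * P)) * x1 - (J * d) * x2"
    "J * t12 = (J * (B - Q)) * t1 - (J * (C + P)) * t2" "J * x12 = (J * (B - Q)) * x1 - (J * (C + P)) * x2"
    "J * t22 = (J * a) * t1 - (J * (B + 2 * Q)) * t2" "J * x22 = (J * a) * x1 - (J * (B + 2 * Q)) * x2"
    unfolding CP BQ assms(3,6-8) unfolding J(1) by (simp_all add: algebra_simps)
  then have "J * t11 = J * ((C - 2 * P) * t1 - d * t2)" "J * x11 = J * ((C - 2 * P) * x1 - d * x2)"
    "J * t12 = J * ((B - Q) * t1 - (C + P) * t2)" "J * x12 = J * ((B - Q) * x1 - (C + P) * x2)"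
    "J * t22 = J * (a * t1 - (B + 2 * Q) * t2)" "J * x22 = J * (a * x1 - (B + 2 * Q) * x2)"
    by (simp_all add: algebra_simps)
  then show "t11 = (C - 2 * P) * t1 - d * t2" "x11 = (C - 2 * P) * x1 - d * x2"
    "t12 = (B - Q) * t1 - (C + P) * t2" "x12 = (B - Q) * x1 - (C + P) * x2"
    "t22 = a * t1 - (B + 2 * Q) * t2" "x22 = a * x1 - (B + 2 * Q) * x2"
    using J(2) by simp_all
qed

lemma independent_rows:
  fixes X Y t1 t2 x1 x2 :: real
  assumes "X * t1 + Y * t2 = 0" "X * x1 + Y * x2 = 0" "t1 * x2 - t2 * x1 \<noteq> 0"
  shows "X = 0" "Y = 0"
proof -
  have "X * (t1 * x2 - t2 * x1) = (X * t1 + Y * t2) * x2 - (X * x1 + Y * x2) * t2"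
    "Y * (t1 * x2 - t2 * x1) = (X * x1 + Y * x2) * t1 - (X * t1 + Y * t2) * x1"
    by (simp_all add: algebra_simps)
  then show "X = 0" "Y = 0" using assms(3) unfolding assms(1,2) by simp_all
qed

context cubic_coefficients
begin

text \<open>Computing the third derivatives \<open>s_ttx\<close> and \<open>s_txx\<close> in two
  ways and eliminating second derivatives leaves two linear relations between \<open>s_t\<close> and
  \<open>s_x\<close>; their coefficients are curvature components of the connection.\<close>

lemma connection_integrability:
  assumes s: "smooth_on N s" and PQ: "smooth_on N P" "smooth_on N Q" and z: "z \<in> N"
    and s11: "\<And>z. z \<in> N \<Longrightarrow> pd1 (pd1 s) z = (C z - 2 * P z) * pd1 s z - d z * pd2 s z"
    and s12: "\<And>z. z \<in> N \<Longrightarrow> pd1 (pd2 s) z = (B z - Q z) * pd1 s z - (C z + P z) * pd2 s z"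
    and s22: "\<And>z. z \<in> N \<Longrightarrow> pd2 (pd2 s) z = a z * pd1 s z - (B z + 2 * Q z) * pd2 s z"
  shows "(pd2 C z - 2 * pd2 P z - d z * a z - pd1 B z + pd1 Q z + (C z + P z) * (B z - Q z)) * pd1 s z
      + (pd1 C z + pd1 P z - pd2 d z + (B z + 2 * Q z) * d z + (B z - Q z) * d z - (C z - 2 * P z) * (C z + P z) - (C z + P z) * (C z + P z)) * pd2 s z = 0"
    "(pd2 B z - pd2 Q z - pd1 a z + (B z - Q z) * (B z - Q z) - (C z + P z) * a z - a z * (C z - 2 * P z) + (B z + 2 * Q z) * (B z - Q z)) * pd1 s z
      + (pd1 B z + 2 * pd1 Q z - pd2 C z - pd2 P z - (B z - Q z) * (C z + P z) + a z * d z) * pd2 s z = 0"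
proof -
  note com = pd_commute[OF N s]
  note s1 = smooth_on_pd1[OF s] and s2 = smooth_on_pd2[OF s]
  note dif = diff_N[OF z] smooth_on_differentiable[OF PQ(1) z] smooth_on_differentiable[OF PQ(2) z]
    smooth_on_differentiable[OF s1 z] smooth_on_differentiable[OF s2 z]
  have "pd2 (pd1 (pd1 s)) z = pd1 (pd1 (pd2 s)) z"
    using pd_commute[OF N s1 z] pd1_cong[OF N z com] by simp
  moreover have "pd2 (pd1 (pd1 s)) z = pd2 (\<lambda>z. (C z - 2 * P z) * pd1 s z - d z * pd2 s z) z"
    by (rule pd2_cong[OF N z s11])
  moreover have "pd1 (pd1 (pd2 s)) z = pd1 (\<lambda>z. (B z - Q z) * pd1 s z - (C z + P z) * pd2 s z) z"
    by (rule pd1_cong[OF N z s12])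
  ultimately have 1: "pd2 (\<lambda>z. (C z - 2 * P z) * pd1 s z - d z * pd2 s z) z = pd1 (\<lambda>z. (B z - Q z) * pd1 s z - (C z + P z) * pd2 s z) z"
    by simp
  have "pd2 (pd1 (pd2 s)) z = pd1 (pd2 (pd2 s)) z"
    using pd_commute[OF N s2 z] by simp
  moreover have "pd2 (pd1 (pd2 s)) z = pd2 (\<lambda>z. (B z - Q z) * pd1 s z - (C z + P z) * pd2 s z) z"
    by (rule pd2_cong[OF N z s12])
  moreover have "pd1 (pd2 (pd2 s)) z = pd1 (\<lambda>z. a z * pd1 s z - (B z + 2 * Q z) * pd2 s z) z"
    by (rule pd1_cong[OF N z s22])
  ultimately have 2: "pd2 (\<lambda>z. (B z - Q z) * pd1 s z - (C z + P z) * pd2 s z) z = pd1 (\<lambda>z. a z * pd1 s z - (B z + 2 * Q z) * pd2 s z) z"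
    by simp
  show "(pd2 C z - 2 * pd2 P z - d z * a z - pd1 B z + pd1 Q z + (C z + P z) * (B z - Q z)) * pd1 s z
      + (pd1 C z + pd1 P z - pd2 d z + (B z + 2 * Q z) * d z + (B z - Q z) * d z - (C z - 2 * P z) * (C z + P z) - (C z + P z) * (C z + P z)) * pd2 s z = 0"
    using 1 by (simp add: pd_rules dif com[OF z, symmetric] s11[OF z] s12[OF z] s22[OF z]) (simp add: algebra_simps)
  show "(pd2 B z - pd2 Q z - pd1 a z + (B z - Q z) * (B z - Q z) - (C z + P z) * a z - a z * (C z - 2 * P z) + (B z + 2 * Q z) * (B z - Q z)) * pd1 s z
      + (pd1 B z + 2 * pd1 Q z - pd2 C z - pd2 P z - (B z - Q z) * (C z + P z) + a z * d z) * pd2 s z = 0"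
    using 2 by (simp add: pd_rules dif com[OF z, symmetric] s11[OF z] s12[OF z] s22[OF z]) (simp add: algebra_simps)
qed

text \<open>With \<open>h = J\<^sup>-\<^sup>1\<^sup>/\<^sup>3\<close>, the functions \<open>h\<close>, \<open>\<tau> h\<close>, \<open>\<xi> h\<close> solve the linear system; \<open>P\<close> and \<open>Q\<close>
  are the logarithmic derivatives of \<open>h\<close>.\<close>

lemma linearized_system:
  assumes \<tau>\<xi>: "smooth_on N \<tau>" "smooth_on N \<xi>"
  defines "J \<equiv> \<lambda>z. pd1 \<tau> z * pd2 \<xi> z - pd2 \<tau> z * pd1 \<xi> z"
  assumes J0: "\<And>z. z \<in> N \<Longrightarrow> J z \<noteq> 0"
    and Ja: "\<And>z. z \<in> N \<Longrightarrow> J z * a z = pd2 \<xi> z * pd2 (pd2 \<tau>) z - pd2 \<tau> z * pd2 (pd2 \<xi>) z"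
    and JB: "\<And>z. z \<in> N \<Longrightarrow> J z * (3 * B z) = pd1 \<xi> z * pd2 (pd2 \<tau>) z + 2 * pd2 \<xi> z * pd1 (pd2 \<tau>) z
        - pd1 \<tau> z * pd2 (pd2 \<xi>) z - 2 * pd2 \<tau> z * pd1 (pd2 \<xi>) z"
    and JC: "\<And>z. z \<in> N \<Longrightarrow> J z * (3 * C z) = 2 * pd1 \<xi> z * pd1 (pd2 \<tau>) z + pd2 \<xi> z * pd1 (pd1 \<tau>) z
        - 2 * pd1 \<tau> z * pd1 (pd2 \<xi>) z - pd2 \<tau> z * pd1 (pd1 \<xi>) z"
    and Jd: "\<And>z. z \<in> N \<Longrightarrow> J z * d z = pd1 \<xi> z * pd1 (pd1 \<tau>) z - pd1 \<tau> z * pd1 (pd1 \<xi>) z"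
    and z: "z \<in> N"
  shows "E1 z \<and> E2 z"
proof -
  define P where "P = (\<lambda>z. (C z - (pd1 (pd1 \<tau>) z * pd2 \<xi> z - pd1 (pd1 \<xi>) z * pd2 \<tau> z) / J z) / 2)"
  define Q where "Q = (\<lambda>z. B z - (pd1 (pd2 \<tau>) z * pd2 \<xi> z - pd1 (pd2 \<xi>) z * pd2 \<tau> z) / J z)"
  have J: "smooth_on N J" unfolding J_def by (intro smooth_intros N \<tau>\<xi>)
  have P: "smooth_on N P" unfolding P_def
    by (intro smooth_on_divide[OF N _ smooth_on_const] smooth_on_diff[OF N] smooth_on_divide[OF N _ J J0]
      smooth_on_mult[OF N] smooth_on_pd1 smooth_on_pd2 sm \<tau>\<xi>) simp_all
  have Q: "smooth_on N Q" unfolding Q_def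
    by (intro smooth_on_diff[OF N] smooth_on_divide[OF N _ J J0] smooth_on_mult[OF N] smooth_on_pd1 smooth_on_pd2 sm \<tau>\<xi>)
  have PJ: "J z * (C z - 2 * P z) = pd1 (pd1 \<tau>) z * pd2 \<xi> z - pd1 (pd1 \<xi>) z * pd2 \<tau> z"
    and QJ: "J z * (B z - Q z) = pd1 (pd2 \<tau>) z * pd2 \<xi> z - pd1 (pd2 \<xi>) z * pd2 \<tau> z" if "z \<in> N" for z
    using J0[OF that] by (simp_all add: P_def Q_def field_simps)
  note con = connection_algebra[OF J_def[THEN meta_eq_to_obj_eq, THEN fun_cong] J0 Ja JB JC Jd PJ QJ]
  \<comment> \<open>The relations hold for \<open>\<tau>\<close> and \<open>\<xi>\<close>, whose
    gradients are independent, so all four coefficients vanish. The outcome is a Riccati system for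
    \<open>(P, Q)\<close>, including \<open>P_x = Q_t\<close> as for a gradient.\<close>
  have DP: "pd1 P z = r0 z - P z * P z + C z * P z - d z * Q z"
    and DPQ: "pd2 P z = r1 z - P z * Q z + B z * P z - C z * Q z" "pd1 Q z = r1 z - P z * Q z + B z * P z - C z * Q z"
    and DQ: "pd2 Q z = r2 z - Q z * Q z + a z * P z - B z * Q z" if z: "z \<in> N" for z
  proof -
    have Jz: "pd1 \<tau> z * pd2 \<xi> z - pd2 \<tau> z * pd1 \<xi> z \<noteq> 0" using J0[OF z] by (simp add: J_def)
    note i\<tau> = connection_integrability[OF \<tau>\<xi>(1) P Q z con(1,3,5)]
      and i\<xi> = connection_integrability[OF \<tau>\<xi>(2) P Q z con(2,4,6)]
    note eqs = independent_rows[OF i\<tau>(1) i\<xi>(1) Jz] independent_rows[OF i\<tau>(2) i\<xi>(2) Jz]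
    show "pd1 P z = r0 z - P z * P z + C z * P z - d z * Q z"
      using eqs(2) by (simp add: r0_def algebra_simps)
    show "pd2 P z = r1 z - P z * Q z + B z * P z - C z * Q z" "pd1 Q z = r1 z - P z * Q z + B z * P z - C z * Q z"
      using eqs(1,4) by (simp_all add: r1_def algebra_simps)
    show "pd2 Q z = r2 z - Q z * Q z + a z * P z - B z * Q z"
      using eqs(3) by (simp add: r2_def algebra_simps)
  qed
  note dif = diff_N[OF z] smooth_on_differentiable[OF P z] smooth_on_differentiable[OF Q z]
  have r: "r0 z = pd2 d z - pd1 C z + 2 * (C z * C z) - 2 * (B z * d z)"
    "r1 z = pd2 C z - pd1 B z + B z * C z - a z * d z"
    "r2 z = pd2 B z - pd1 a z + 2 * (B z * B z) - 2 * (a z * C z)"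
    by (simp_all add: r0_def r1_def r2_def)
  \<comment> \<open>Integrability of the Riccati system: in the equality of mixed derivatives of
    \<open>P\<close> all terms with \<open>P\<close> and \<open>Q\<close> cancel and
    \<open>E1\<close> remains; the condition for \<open>Q\<close> leaves \<open>E2\<close>.\<close>
  have "pd2 (\<lambda>z. r0 z - P z * P z + C z * P z - d z * Q z) z = pd1 (\<lambda>z. r1 z - P z * Q z + B z * P z - C z * Q z) z"
    using pd_commute[OF N P z] pd2_cong[OF N z DP] pd1_cong[OF N z DPQ(1)] by simp
  then have "pd2 r0 z = pd1 r1 z - 2 * C z * r1 z + d z * r2 z + B z * r0 z"
    by (simp add: pd_rules dif DP[OF z] DPQ[OF z] DQ[OF z]) (simp add: r algebra_simps)
  moreover have "pd2 (\<lambda>z. r1 z - P z * Q z + B z * P z - C z * Q z) z = pd1 (\<lambda>z. r2 z - Q z * Q z + a z * P z - B z * Q z) z"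
    using pd_commute[OF N Q z] pd2_cong[OF N z DPQ(2)] pd1_cong[OF N z DQ] by simp
  then have "pd2 r1 z = pd1 r2 z - 2 * B z * r1 z + C z * r2 z + a z * r0 z"
    by (simp add: pd_rules dif DP[OF z] DPQ[OF z] DQ[OF z]) (simp add: r algebra_simps)
  ultimately show ?thesis by (simp add: E1_def E2_def)
qed

end

section \<open>Comparison of coefficients and the bundle map in (2)\<close>

lemma cubic_zero_on_interval:
  fixes e0 e1 e2 e3 q \<delta> :: real
  assumes "\<delta> > 0" "\<And>y. \<bar>y - q\<bar> < \<delta> \<Longrightarrow> e3 * y ^ 3 + e2 * y ^ 2 + e1 * y + e0 = 0"
  shows "e3 = 0" "e2 = 0" "e1 = 0" "e0 = 0"
proof -
  have "{q<..<q + \<delta>} \<subseteq> {y. poly [:e0, e1, e2, e3:] y = 0}"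
  proof
    fix y assume "y \<in> {q<..<q + \<delta>}"
    then have "e3 * y ^ 3 + e2 * y ^ 2 + e1 * y + e0 = 0" by (intro assms(2)) auto
    then show "y \<in> {y. poly [:e0, e1, e2, e3:] y = 0}"
      by (simp add: algebra_simps power2_eq_square power3_eq_cube)
  qed
  moreover have "infinite {q<..<q + \<delta>}" using assms(1) by (intro infinite_Ioo) simp
  ultimately have "infinite {y. poly [:e0, e1, e2, e3:] y = 0}" using finite_subset by blast
  then have "[:e0, e1, e2, e3:] = 0" using poly_roots_finite by blast
  then show "e3 = 0" "e2 = 0" "e1 = 0" "e0 = 0" by auto
qed

lemma smooth_near_cubic_coefficients:
  assumes "smooth_near z0 a" "smooth_near z0 b" "smooth_near z0 c" "smooth_near z0 d" "open T" "z0 \<in> T"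
  obtains N where "z0 \<in> N" "N \<subseteq> T" "cubic_coefficients a (\<lambda>z. b z / 3) (\<lambda>z. c z / 3) d N"
proof -
  obtain N1 where N1: "open N1" "z0 \<in> N1" "N1 \<subseteq> T" "smooth_on N1 a" by (rule smooth_near_open[OF assms(1,5,6)])
  obtain N2 where N2: "open N2" "z0 \<in> N2" "N2 \<subseteq> N1" "smooth_on N2 b" by (rule smooth_near_open[OF assms(2) N1(1,2)])
  obtain N3 where N3: "open N3" "z0 \<in> N3" "N3 \<subseteq> N2" "smooth_on N3 c" by (rule smooth_near_open[OF assms(3) N2(1,2)])
  obtain N where N: "open N" "z0 \<in> N" "N \<subseteq> N3" "smooth_on N d" by (rule smooth_near_open[OF assms(4) N3(1,2)])
  have "smooth_on N a" "smooth_on N b" "smooth_on N c"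
    using N3(3) N2(3) N(3) by (auto intro: smooth_on_subset[OF N1(4)] smooth_on_subset[OF N2(4)] smooth_on_subset[OF N3(4)])
  then have "cubic_coefficients a (\<lambda>z. b z / 3) (\<lambda>z. c z / 3) d N"
    using N by unfold_locales (auto intro!: smooth_on_divide)
  then show thesis using that[of N] N1 N2 N3 N by blast
qed

text \<open>Equation (B) has slope \<open>y\<close>, so the left-hand side of its transformed
  identity is just the Jacobian times the cubic of (B). The target (C) has zero coefficients, and
  what remains on the other side is a cubic in \<open>y\<close> built from derivatives of
  \<open>\<phi>\<close>. Comparing coefficients yields the relations from which \<open>E1\<close>
  and \<open>E2\<close> follow.\<close>

lemma transformable_to_burgers_system:
  assumes sm: "smooth_near z0 a" "smooth_near z0 b" "smooth_near z0 c" "smooth_near z0 d"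
    and "transformable (cubic_burgers_eq a b c d) burgers_eq (z0, q0)"
  shows "\<forall>\<^sub>F z in nhds z0. linearizable_system a b c d z"
proof -
  let ?X3 = "\<lambda>p. a (fst p) * snd p ^ 3 + b (fst p) * snd p ^ 2 + c (fst p) * snd p + d (fst p)"
  obtain \<phi> \<theta> U W where bm: "bundle_map \<phi> \<theta> U W" and pW: "(z0, q0) \<in> W"
    and maps: "maps_solutions (quasilinear_eq (\<lambda>_. 1) snd ?X3) (cubic_burgers_eq (\<lambda>_. 0) (\<lambda>_. 0) (\<lambda>_. 0) (\<lambda>_. 0)) \<phi> \<theta> U W"
    using assms(5) unfolding transformable_def cubic_burgers_eq_quasilinear[of a b c d] burgers_eq_cubic
    by (elim exE conjE)
  note bmD = bundle_mapD[OF bm]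
  have z0U: "z0 \<in> U" using pW bmD(2) by auto
  obtain N0 where N0: "z0 \<in> N0" "N0 \<subseteq> U" "cubic_coefficients a (\<lambda>z. b z / 3) (\<lambda>z. c z / 3) d N0"
    by (rule smooth_near_cubic_coefficients[OF sm bmD(5) z0U])
  have oN0: "open N0" and smN0: "smooth_on N0 a" "smooth_on N0 (\<lambda>z. b z / 3)" "smooth_on N0 (\<lambda>z. c z / 3)" "smooth_on N0 d"
    using N0(3) by (auto simp: cubic_coefficients_def)
  have bc: "smooth_on N0 b" "smooth_on N0 c"
    using smooth_on_mult[OF oN0 smooth_on_const[of _ 3] smN0(2)] smooth_on_mult[OF oN0 smooth_on_const[of _ 3] smN0(3)] by simp_all
  define S0 where "S0 = W \<inter> N0 \<times> UNIV"
  have oS0: "open S0" unfolding S0_def using bmD(1) oN0 by (intro open_Int open_Times) auto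
  have "(z0, q0) \<in> S0" using pW N0 by (simp add: S0_def)
  then obtain T I where TI: "open T" "open I" "(z0, q0) \<in> T \<times> I" "T \<times> I \<subseteq> S0"
    by (rule open_prod_elim[OF oS0])
  obtain \<delta> where \<delta>: "\<delta> > 0" "\<And>y. \<bar>y - q0\<bar> < \<delta> \<Longrightarrow> y \<in> I"
    using TI(2,3) unfolding open_dist dist_real_def by auto
  \<comment> \<open>The fiber interval is the same for all base points near \<open>z0\<close>, so
    that over each of them the identity holds for infinitely many \<open>y\<close>.\<close>
  define S where "S = T \<times> {q0 - \<delta><..<q0 + \<delta>}"
  have oS: "open S" unfolding S_def using TI(1) by (intro open_Times) auto
  have inI: "y \<in> I" if "y \<in> {q0 - \<delta><..<q0 + \<delta>}" for y using that by (intro \<delta>(2)) auto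
  have S_S0: "S \<subseteq> S0" using TI(4) inI by (auto simp: S_def)
  have SW: "S \<subseteq> W" using S_S0 by (auto simp: S0_def)
  have base: "smooth_on S (\<lambda>p. f (fst p))" if "smooth_on N0 f" for f :: "plane \<Rightarrow> real"
    by (rule smooth_on_compose[OF oS oN0 that smooth_on_fst[OF oS smooth_on_ident[OF oS]]]) (use S_S0 in \<open>auto simp: S0_def\<close>)
  have X3: "smooth_on S ?X3"
    by (intro smooth_intros oS base smN0(1,4) bc)
  have X2: "smooth_on S snd" by (rule smooth_on_linear[OF oS bounded_linear_snd])
  note ts = transformed_slope[OF bm maps oS SW smooth_on_const X2 X3]
  have slope: "slope (\<lambda>_. 1) snd = (snd :: plane \<times> real \<Rightarrow> real)" by (simp add: slope_def fun_eq_iff)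
  have dsnd: "((snd :: plane \<times> real \<Rightarrow> real) has_derivative snd) (at p)" for p
    by (rule bounded_linear_imp_has_derivative[OF bounded_linear_snd])
  define \<tau> where "\<tau> = (\<lambda>z. fst (\<phi> z))"
  define \<xi> where "\<xi> = (\<lambda>z. snd (\<phi> z))"
  define J where "J = (\<lambda>z. pd1 \<tau> z * pd2 \<xi> z - pd2 \<tau> z * pd1 \<xi> z)"
  have TN0: "T \<subseteq> N0" and z0T: "z0 \<in> T" using TI(3,4) by (auto simp: S0_def)
  have "smooth_on T \<phi>" using bmD(8) TN0 N0(2) by (auto intro: smooth_on_subset)
  then have \<tau>\<xi>: "smooth_on T \<tau>" "smooth_on T \<xi>"
    unfolding \<tau>_def \<xi>_def using TI(1) by (auto intro!: smooth_on_fst smooth_on_snd)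
  have J0: "J z \<noteq> 0" if "z \<in> T" for z
    using diffeo_on_jacobian[of U \<phi> z] bm that TN0 N0(2) by (auto simp: bundle_map_def J_def \<tau>_def \<xi>_def)
  have rel: "J z * a z = pd2 \<xi> z * pd2 (pd2 \<tau>) z - pd2 \<tau> z * pd2 (pd2 \<xi>) z
      \<and> J z * b z = pd1 \<xi> z * pd2 (pd2 \<tau>) z + 2 * pd2 \<xi> z * pd1 (pd2 \<tau>) z - pd1 \<tau> z * pd2 (pd2 \<xi>) z - 2 * pd2 \<tau> z * pd1 (pd2 \<xi>) z
      \<and> J z * c z = 2 * pd1 \<xi> z * pd1 (pd2 \<tau>) z + pd2 \<xi> z * pd1 (pd1 \<tau>) z - 2 * pd1 \<tau> z * pd1 (pd2 \<xi>) z - pd2 \<tau> z * pd1 (pd1 \<xi>) z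
      \<and> J z * d z = pd1 \<xi> z * pd1 (pd1 \<tau>) z - pd1 \<tau> z * pd1 (pd1 \<xi>) z" if z: "z \<in> T" for z
  proof -
    let ?e3 = "J z * a z - (pd2 \<xi> z * pd2 (pd2 \<tau>) z - pd2 \<tau> z * pd2 (pd2 \<xi>) z)"
    let ?e2 = "J z * b z - (pd1 \<xi> z * pd2 (pd2 \<tau>) z + 2 * pd2 \<xi> z * pd1 (pd2 \<tau>) z - pd1 \<tau> z * pd2 (pd2 \<xi>) z - 2 * pd2 \<tau> z * pd1 (pd2 \<xi>) z)"
    let ?e1 = "J z * c z - (2 * pd1 \<xi> z * pd1 (pd2 \<tau>) z + pd2 \<xi> z * pd1 (pd1 \<tau>) z - 2 * pd1 \<tau> z * pd1 (pd2 \<xi>) z - pd2 \<tau> z * pd1 (pd1 \<xi>) z)"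
    let ?e0 = "J z * d z - (pd1 \<xi> z * pd1 (pd1 \<tau>) z - pd1 \<tau> z * pd1 (pd1 \<xi>) z)"
    have "?e3 * y ^ 3 + ?e2 * y ^ 2 + ?e1 * y + ?e0 = 0" if "\<bar>y - q0\<bar> < \<delta>" for y
    proof -
      have p: "(z, y) \<in> S" using that z by (auto simp: S_def)
      have "J z * (a z * y ^ 3 + b z * y ^ 2 + c z * y + d z)
        = (pd2 \<xi> z * pd2 (pd2 \<tau>) z - pd2 \<tau> z * pd2 (pd2 \<xi>) z) * y ^ 3
        + (pd1 \<xi> z * pd2 (pd2 \<tau>) z + 2 * pd2 \<xi> z * pd1 (pd2 \<tau>) z - pd1 \<tau> z * pd2 (pd2 \<xi>) z - 2 * pd2 \<tau> z * pd1 (pd2 \<xi>) z) * y ^ 2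
        + (2 * pd1 \<xi> z * pd1 (pd2 \<tau>) z + pd2 \<xi> z * pd1 (pd1 \<tau>) z - 2 * pd1 \<tau> z * pd1 (pd2 \<xi>) z - pd2 \<tau> z * pd1 (pd1 \<xi>) z) * y
        + (pd1 \<xi> z * pd1 (pd1 \<tau>) z - pd1 \<tau> z * pd1 (pd1 \<xi>) z)"
        using trans[OF ts(2)[OF _ p, folded \<tau>_def \<xi>_def, unfolded slope] cubic_expansion]
        by (simp add: pdz1_eq[OF dsnd] pdz2_eq[OF dsnd] pdy_eq[OF dsnd] J_def)
      then show ?thesis by (simp add: algebra_simps)
    qed
    from cubic_zero_on_interval[OF \<delta>(1) this] show ?thesis by simp
  qed
  interpret cubic_coefficients a "\<lambda>z. b z / 3" "\<lambda>z. c z / 3" d T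
    using TI(1) smN0 TN0 by unfold_locales (auto intro: smooth_on_subset)
  have "linearizable_system a b c d z" if z: "z \<in> T" for z
  proof -
    have "E1 z \<and> E2 z"
      by (rule linearized_system[OF \<tau>\<xi> _ _ _ _ _ z]) (use J0 rel in \<open>simp_all add: J_def\<close>)
    then show ?thesis using system_iff[OF z] by simp
  qed
  then show ?thesis unfolding eventually_nhds using TI(1) z0T by blast
qed

lemma system_burgers_transformation:
  assumes sm: "smooth_near z0 a" "smooth_near z0 b" "smooth_near z0 c" "smooth_near z0 d"
    and "\<forall>\<^sub>F z in nhds z0. linearizable_system a b c d z"
  obtains \<tau> \<xi> U where "z0 \<in> U" "diffeo_on U (\<lambda>z. (\<tau> z, \<xi> z))" "smooth_on U \<tau>" "smooth_on U \<xi>"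
    "pd1 \<tau> z0 + pd2 \<tau> z0 * q0 \<noteq> 0"
    "\<forall>D u u'. D \<subseteq> U \<and> classical_solution (cubic_burgers_eq a b c d) D u \<and>
       (\<forall>z\<in>D. pd1 \<tau> z + pd2 \<tau> z * u z \<noteq> 0) \<and>
       (\<forall>z\<in>D. u' (\<tau> z, \<xi> z) = (pd1 \<xi> z + pd2 \<xi> z * u z) / (pd1 \<tau> z + pd2 \<tau> z * u z)) \<longrightarrow>
       classical_solution burgers_eq ((\<lambda>z. (\<tau> z, \<xi> z)) ` D) u'"
proof -
  obtain T where T: "open T" "z0 \<in> T" "\<And>z. z \<in> T \<Longrightarrow> linearizable_system a b c d z"
    using assms(5) unfolding eventually_nhds by blast
  obtain N where N: "z0 \<in> N" "N \<subseteq> T" "cubic_coefficients a (\<lambda>z. b z / 3) (\<lambda>z. c z / 3) d N"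
    by (rule smooth_near_cubic_coefficients[OF sm T(1,2)])
  note NT = subsetD[OF N(2)] and z0 = N(1)
  interpret cubic_coefficients a "\<lambda>z. b z / 3" "\<lambda>z. c z / 3" d N by (rule N(3))
  have E: "E1 z \<and> E2 z" if "z \<in> N" for z
    using T(3)[OF NT[OF that]] system_iff[OF that] by simp
  have 3: "(\<lambda>z. 3 * (f z / 3)) = f" for f :: "plane \<Rightarrow> real" by simp
  show thesis
    by (rule burgers_transformation[OF z0 E, of q0, unfolded 3]) (assumption, rule that)
qed

text \<open>The formula for the transformed function defines the fiber map
  \<open>\<theta> = L / M\<close>, whose vertical derivative is the Jacobian divided by
  \<open>M^2\<close>. Hence it gives a bundle map near every point with \<open>M\<close> nonzero,
  and the coordinates are chosen so that this holds at \<open>q0\<close>.\<close>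

lemma transformable_to_burgers_iff:
  assumes sm: "smooth_near z0 a" "smooth_near z0 b" "smooth_near z0 c" "smooth_near z0 d"
  shows "transformable (cubic_burgers_eq a b c d) burgers_eq (z0, q0) \<longleftrightarrow>
    (\<forall>\<^sub>F z in nhds z0. linearizable_system a b c d z)"
proof
  assume "\<forall>\<^sub>F z in nhds z0. linearizable_system a b c d z"
  then obtain \<tau> \<xi> U where U: "z0 \<in> U" "diffeo_on U (\<lambda>z. (\<tau> z, \<xi> z))" "smooth_on U \<tau>" "smooth_on U \<xi>"
    "pd1 \<tau> z0 + pd2 \<tau> z0 * q0 \<noteq> 0"
    "\<forall>D u u'. D \<subseteq> U \<and> classical_solution (cubic_burgers_eq a b c d) D u \<and>
       (\<forall>z\<in>D. pd1 \<tau> z + pd2 \<tau> z * u z \<noteq> 0) \<and>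
       (\<forall>z\<in>D. u' (\<tau> z, \<xi> z) = (pd1 \<xi> z + pd2 \<xi> z * u z) / (pd1 \<tau> z + pd2 \<tau> z * u z)) \<longrightarrow>
       classical_solution burgers_eq ((\<lambda>z. (\<tau> z, \<xi> z)) ` D) u'"
    by (rule system_burgers_transformation[OF sm]) (rule that)
  have oU: "open U" and inj: "inj_on (\<lambda>z. (\<tau> z, \<xi> z)) U" using U(2) by (auto simp: diffeo_on_def)
  let ?U = "U \<times> (UNIV :: real set)"
  have oU': "open ?U" using oU by (intro open_Times) auto
  define M where "M = (\<lambda>p. pd1 \<tau> (fst p) + pd2 \<tau> (fst p) * snd p)"
  define L where "L = (\<lambda>p. pd1 \<xi> (fst p) + pd2 \<xi> (fst p) * snd p)"
  define \<theta> where "\<theta> = (\<lambda>p. L p / M p)"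
  have base: "smooth_on ?U (\<lambda>p. f (fst p))" if "smooth_on U f" for f :: "plane \<Rightarrow> real"
    by (rule smooth_on_compose[OF oU' oU that smooth_on_fst[OF oU' smooth_on_ident[OF oU']]]) auto
  have LM: "smooth_on ?U M" "smooth_on ?U L"
    unfolding M_def L_def by (intro smooth_intros oU' base U(3,4))+
  have p0: "(z0, q0) \<in> ?U" and M0: "M (z0, q0) \<noteq> 0" using U(1,5) by (simp_all add: M_def)
  obtain S where S: "open S" "(z0, q0) \<in> S" "S \<subseteq> ?U" "\<And>p. p \<in> S \<Longrightarrow> M p \<noteq> 0"
    by (rule eventually_nonzero[OF oU' p0 smooth_on_continuous[OF LM(1)] M0]) (rule that)
  have LMS: "smooth_on S M" "smooth_on S L" by (rule smooth_on_subset[OF _ S(3)], rule LM)+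
  have \<theta>: "smooth_on S \<theta>" unfolding \<theta>_def by (rule smooth_on_divide[OF S(1) LMS(2,1) S(4)])
  have \<theta>y: "pdy \<theta> p \<noteq> 0" if p: "p \<in> S" for p
  proof -
    have z: "fst p \<in> U" using p S(3) by auto
    have lin: "pdy (\<lambda>p. pd1 f (fst p) + pd2 f (fst p) * snd p) p = pd2 f (fst p)" if "smooth_on U f" for f
    proof -
      have D: "((\<lambda>p. g (fst p)) has_derivative (\<lambda>h. fst (fst h) * pd1 g (fst p) + snd (fst h) * pd2 g (fst p))) (at p)"
        if "smooth_on U g" for g
        by (rule has_derivative_compose[OF has_derivative_fst[OF has_derivative_ident] has_derivative_pd[OF smooth_on_differentiable[OF that z]]])
      from has_derivative_add[OF D[OF smooth_on_pd1[OF that]] has_derivative_mult[OF D[OF smooth_on_pd2[OF that]] has_derivative_snd[OF has_derivative_ident]]]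
      show ?thesis by (simp add: pdy_eq)
    qed
    have My: "pdy M p = pd2 \<tau> (fst p)" and Ly: "pdy L p = pd2 \<xi> (fst p)"
      unfolding M_def L_def by (rule lin[OF U(3)], rule lin[OF U(4)])
    have dM: "M differentiable at p" and dL: "L differentiable at p"
      by (rule smooth_on_differentiable[OF _ p], rule LMS)+
    have "pdy \<theta> p = (pdy L p * M p - L p * pdy M p) / (M p)^2"
      using pdy_eq[OF has_derivative_divide[OF has_derivative_pdz[OF dL] has_derivative_pdz[OF dM] S(4)[OF p]]] S(4)[OF p]
      unfolding \<theta>_def by (simp add: field_simps power2_eq_square)
    also have "\<dots> = (pd1 \<tau> (fst p) * pd2 \<xi> (fst p) - pd2 \<tau> (fst p) * pd1 \<xi> (fst p)) / (M p)^2"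
      unfolding My Ly by (simp add: M_def L_def algebra_simps)
    finally show ?thesis using diffeo_on_jacobian[OF U(2) z] S(4)[OF p] by simp
  qed
  obtain W where W: "W \<subseteq> S" "(z0, q0) \<in> W" "bundle_map (\<lambda>z. (\<tau> z, \<xi> z)) \<theta> U W"
    by (rule bundle_map_exists[OF U(2) S(1,3) \<theta> S(2) \<theta>y]) (assumption, rule that)
  have "maps_solutions (cubic_burgers_eq a b c d) burgers_eq (\<lambda>z. (\<tau> z, \<xi> z)) \<theta> U W"
    unfolding maps_solutions_def
  proof (intro allI impI)
    fix D u assume u: "graph_in W D u \<and> classical_solution (cubic_burgers_eq a b c d) D u"
    have g: "(z, u z) \<in> S" if "z \<in> D" for z using u W(1) that by (auto simp: graph_in_def)
    have D: "D \<subseteq> U" using g S(3) by auto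
    show "classical_solution burgers_eq ((\<lambda>z. (\<tau> z, \<xi> z)) ` D) (push (\<lambda>z. (\<tau> z, \<xi> z)) \<theta> U u)"
    proof (rule U(6)[rule_format], intro conjI ballI D)
      show "classical_solution (cubic_burgers_eq a b c d) D u" using u by simp
      show "pd1 \<tau> z + pd2 \<tau> z * u z \<noteq> 0" if "z \<in> D" for z using S(4)[OF g[OF that]] by (simp add: M_def)
      show "push (\<lambda>z. (\<tau> z, \<xi> z)) \<theta> U u (\<tau> z, \<xi> z) = (pd1 \<xi> z + pd2 \<xi> z * u z) / (pd1 \<tau> z + pd2 \<tau> z * u z)" if "z \<in> D" for z
        using push_apply[OF inj subsetD[OF D that], of \<theta> u] by (simp add: \<theta>_def M_def L_def)
    qed
  qed
  then show "transformable (cubic_burgers_eq a b c d) burgers_eq (z0, q0)"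
    unfolding transformable_def using W by blast
qed (rule transformable_to_burgers_system[OF sm])

theorem theorem4:
  fixes X1 X2 X3 :: "plane \<times> real \<Rightarrow> real" and z0 :: plane and y0 :: real
  assumes "smooth_near (z0, y0) X1" and "smooth_near (z0, y0) X2" and "smooth_near (z0, y0) X3"
  shows
    \<comment> \<open>(1), with transformations taken in both directions\<close>
    "((X1 (z0, y0), X2 (z0, y0), X3 (z0, y0)) \<noteq> (0, 0, 0) \<longrightarrow>
        (equivalent_to_cubic_burgers (quasilinear_eq X1 X2 X3) (z0, y0) \<longleftrightarrow>
           (\<forall>\<^sub>F p in nhds (z0, y0). (X1 p, X2 p) \<noteq> (0, 0)) \<and>
           (admissible X1 X2 X3 (z0, y0) \<or>
            admissible (swap_base X2) (swap_base X1) (swap_base X3) (prod.swap z0, y0))))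
     \<and>
     \<comment> \<open>(1), with transformations taken in one direction only\<close>
     (X1 (z0, y0) \<noteq> 0 \<longrightarrow>
        (transformable_to_cubic_burgers (quasilinear_eq X1 X2 X3) (z0, y0) \<longleftrightarrow>
           slope_y_nonzero_near X1 X2 (z0, y0) \<and>
           (\<exists>a b c d. cubic_identity_near X1 X2 X3 (z0, y0) a b c d)))
     \<and>
     \<comment> \<open>the transformation in (1)\<close>
     (\<forall>a b c d.
        X1 (z0, y0) \<noteq> 0 \<and> slope_y_nonzero_near X1 X2 (z0, y0) \<and>
        cubic_identity_near X1 X2 X3 (z0, y0) a b c d \<longrightarrow>
        (\<exists>W. open W \<and> (z0, y0) \<in> W \<and>
           (\<forall>D v. graph_in W D v \<and> classical_solution (quasilinear_eq X1 X2 X3) D v \<longrightarrow>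
              classical_solution (cubic_burgers_eq a b c d) D
                (\<lambda>z. X2 (z, v z) / X1 (z, v z)))))
     \<and>
     \<comment> \<open>(2), around any point of the total space over \<open>z0\<close>\<close>
     (\<forall>a b c d.
        smooth_near z0 a \<and> smooth_near z0 b \<and> smooth_near z0 c \<and> smooth_near z0 d \<longrightarrow>
        (\<forall>q0. transformable (cubic_burgers_eq a b c d) burgers_eq (z0, q0) \<longleftrightarrow>
           (\<forall>\<^sub>F z in nhds z0. linearizable_system a b c d z)) \<and>
        ((\<forall>\<^sub>F z in nhds z0. linearizable_system a b c d z) \<longrightarrow>
           (\<exists>\<tau> \<xi> U. z0 \<in> U \<and> diffeo_on U (\<lambda>z. (\<tau> z, \<xi> z)) \<and>
              (\<forall>D u u'. D \<subseteq> U \<and> classical_solution (cubic_burgers_eq a b c d) D u \<and>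
                 (\<forall>z\<in>D. pd1 \<tau> z + pd2 \<tau> z * u z \<noteq> 0) \<and>
                 (\<forall>z\<in>D. u' (\<tau> z, \<xi> z) =
                    (pd1 \<xi> z + pd2 \<xi> z * u z) / (pd1 \<tau> z + pd2 \<tau> z * u z)) \<longrightarrow>
                 classical_solution burgers_eq ((\<lambda>z. (\<tau> z, \<xi> z)) ` D) u'))))"
proof (intro conjI impI allI)
  assume "(X1 (z0, y0), X2 (z0, y0), X3 (z0, y0)) \<noteq> (0, 0, 0)"
  then show "equivalent_to_cubic_burgers (quasilinear_eq X1 X2 X3) (z0, y0) \<longleftrightarrow>
    (\<forall>\<^sub>F p in nhds (z0, y0). (X1 p, X2 p) \<noteq> (0, 0)) \<and>
    (admissible X1 X2 X3 (z0, y0) \<or> admissible (swap_base X2) (swap_base X1) (swap_base X3) (prod.swap z0, y0))"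
    by (rule equivalent_iff_admissible[OF assms])
next
  assume "X1 (z0, y0) \<noteq> 0"
  then show "transformable_to_cubic_burgers (quasilinear_eq X1 X2 X3) (z0, y0) \<longleftrightarrow>
    slope_y_nonzero_near X1 X2 (z0, y0) \<and> (\<exists>a b c d. cubic_identity_near X1 X2 X3 (z0, y0) a b c d)"
    by (rule transformable_iff_conditions[OF assms])
next
  fix a b c d :: "plane \<Rightarrow> real"
  assume "X1 (z0, y0) \<noteq> 0 \<and> slope_y_nonzero_near X1 X2 (z0, y0) \<and> cubic_identity_near X1 X2 X3 (z0, y0) a b c d"
  then show "\<exists>W. open W \<and> (z0, y0) \<in> W \<and>
      (\<forall>D v. graph_in W D v \<and> classical_solution (quasilinear_eq X1 X2 X3) D v \<longrightarrow>
        classical_solution (cubic_burgers_eq a b c d) D (\<lambda>z. X2 (z, v z) / X1 (z, v z)))"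
    by (elim conjE) (rule slope_maps_solutions[OF assms])
next
  fix a b c d :: "plane \<Rightarrow> real" and q0
  assume "smooth_near z0 a \<and> smooth_near z0 b \<and> smooth_near z0 c \<and> smooth_near z0 d"
  then show "transformable (cubic_burgers_eq a b c d) burgers_eq (z0, q0) \<longleftrightarrow>
      (\<forall>\<^sub>F z in nhds z0. linearizable_system a b c d z)"
    by (intro transformable_to_burgers_iff) auto
next
  fix a b c d :: "plane \<Rightarrow> real"
  assume sm: "smooth_near z0 a \<and> smooth_near z0 b \<and> smooth_near z0 c \<and> smooth_near z0 d"
    and "\<forall>\<^sub>F z in nhds z0. linearizable_system a b c d z"
  then obtain \<tau> \<xi> U where "z0 \<in> U" "diffeo_on U (\<lambda>z. (\<tau> z, \<xi> z))"
    "\<forall>D u u'. D \<subseteq> U \<and> classical_solution (cubic_burgers_eq a b c d) D u \<and>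
       (\<forall>z\<in>D. pd1 \<tau> z + pd2 \<tau> z * u z \<noteq> 0) \<and>
       (\<forall>z\<in>D. u' (\<tau> z, \<xi> z) = (pd1 \<xi> z + pd2 \<xi> z * u z) / (pd1 \<tau> z + pd2 \<tau> z * u z)) \<longrightarrow>
       classical_solution burgers_eq ((\<lambda>z. (\<tau> z, \<xi> z)) ` D) u'"
    by (elim conjE) (rule system_burgers_transformation[of z0 a b c d])
  then show "\<exists>\<tau> \<xi> U. z0 \<in> U \<and> diffeo_on U (\<lambda>z. (\<tau> z, \<xi> z)) \<and>
      (\<forall>D u u'. D \<subseteq> U \<and> classical_solution (cubic_burgers_eq a b c d) D u \<and>
         (\<forall>z\<in>D. pd1 \<tau> z + pd2 \<tau> z * u z \<noteq> 0) \<and>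
         (\<forall>z\<in>D. u' (\<tau> z, \<xi> z) = (pd1 \<xi> z + pd2 \<xi> z * u z) / (pd1 \<tau> z + pd2 \<tau> z * u z)) \<longrightarrow>
         classical_solution burgers_eq ((\<lambda>z. (\<tau> z, \<xi> z)) ` D) u')"
    by (intro exI conjI)
qed

end
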